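(* Let $N\ge 1$ and let $\Gamma$ be $\Gamma_0(N)$ or an Atkin--Lehner extension of $\Gamma_0(N)$ such that the associated modular curve $X(\Gamma)$ is of genus zero. Let $\mathcal{O}\subset\mathbb{C}$ be a subring. Suppose that $t=t(\tau)\in q+q^{2}\mathcal{O}[[q]]$, with $q=\exp(2\pi i\tau)$, is a uniformizer (Hauptmodul) of $X(\Gamma)$ with a unique zero at the cusp $[i\infty]$ and a unique pole at a point $[\tau_0]\in X(\Gamma)$. Suppose that $Z=Z(\tau)\in 1+q\mathcal{O}[[q]]$ is a holomorphic modular form of weight $2$ for $\Gamma$ with multiplier $\chi$ of order $\le 2$, having a unique zero, supported at $[\tau_0]$, of order smaller than or equal to $1$. Define the sequence $\{T(n)\}_{n\ge 0}$ by $$\sum_{n=0}^{\infty}T(n)t^{n}=Z .$$ Then the sequence $\{T(n)\}$ satisfies the Lucas congruences modulo any prime $p$ such that $\mathcal{O}$ can be embedded into the ring $\mathbb{Z}_p$ of $p$-adic integers.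
   Context: Modular forms: for $\gamma=\begin{pmatrix}a&b\\c&d\end{pmatrix}\in \mathrm{GL}_2^+(\mathbb{R})$ and $F:\mathbb{H}\to\mathbb{C}$, put $F|_k\gamma(\tau)=\det(\gamma)^{k/2}(c\tau+d)^{-k}F(\gamma\tau)$. $F$ is a modular form of weight $k$ with multiplier $\chi$ for a discrete subgroup $\Gamma\subset\mathrm{GL}_2^+(\mathbb{R})$ if $F|_k\gamma=\chi(\gamma)F$ for all $\gamma\in\Gamma$, where $\chi:\Gamma\to\mathbb{C}$ has $|\chi(\gamma)|=1$ (with the usual holomorphy conditions on $\mathbb{H}$ and at the cusps). Atkin--Lehner extensions: a Hall divisor $e$ of $N$ is a divisor with $\gcd(e,N/e)=1$ (written $e\| N$). The Atkin--Lehner involution is $w_e=\begin{pmatrix}a_e&b_e\\c_eN&d_e\end{pmatrix}$ with $a_e,b_e,c_e,d_e\in\mathbb{Z}$, $e\mid a_e$, $e\mid d_e$ and $\det w_e=e$. For a set $S$ of Hall divisors of $N$, the group $\Gamma_0(N)+S=\langle \Gamma_0(N), w_e : e\in S\rangle$ is called an Atkin--Lehner extension of $\Gamma_0(N)$. $X(\Gamma)$ is the compactified quotient of $\mathbb{H}$ by $\Gamma$; $[\tau]$ denotes the class of a point or cusp $\tau$ in $X(\Gamma)$ (the point $[\tau_0]$ may be a cusp). A uniformizer of $X(\Gamma)$ is a modular function for $\Gamma$ giving an isomorphism of $X(\Gamma)$ with the projective line. The order of vanishing of $Z$ at a point of $X(\Gamma)$ is measured with respect to a local parameter of $X(\Gamma)$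 at that point, so it may be fractional (e.g. at elliptic points). The identity $\sum T(n)t^n=Z$ is one of power series in $q$; it determines $T(n)\in\mathcal{O}$ uniquely. Lucas congruences: $\{T(n)\}$ satisfies the Lucas congruences modulo a prime $p$ if for every $n\ge0$ with base-$p$ expansion $n=n_0+n_1p+\cdots+n_sp^s$, $0\le n_i\le p-1$, one has $T(n)\equiv T(n_0)T(n_1)\cdots T(n_s)\pmod p$. Here $\mathcal{O}$ is regarded as a subring of $\mathbb{Z}_p$ via an embedding (injective ring homomorphism) and the congruence is modulo $p\mathbb{Z}_p$. *)

theory Defs
  imports
    "HOL-Complex_Analysis.Complex_Analysis"
    "HOL-Homology.Homology"
    "HOL-Algebra.Free_Abelian_Groups"
    "HOL-Algebra.Algebraic_Closure_Type"
begin

section \<open>Moebius action of GL2+(R) on the Riemann sphere\<close>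

definition mat2 :: "real \<Rightarrow> real \<Rightarrow> real \<Rightarrow> real \<Rightarrow> real^2^2" where
  "mat2 a b c d = vector [vector [a, b], vector [c, d]]"

definition GL2pos :: "(real^2^2) monoid" where
  "GL2pos = \<lparr>carrier = {A. det A > 0}, monoid.mult = (**), one = mat 1\<rparr>"

lemma group_GL2pos: "group GL2pos"
proof (rule groupI)
  fix A assume "A \<in> carrier GL2pos"
  hence A: "det A > 0" by (simp add: GL2pos_def)
  hence "invertible A" by (simp add: invertible_det_nz)
  then obtain B where B: "B ** A = mat 1" unfolding invertible_def by blast
  hence "det B * det A = 1" by (metis det_I det_mul)
  hence "det B > 0"
    using A by (metis zero_less_mult_pos2 zero_less_one)
  with B show "\<exists>B\<in>carrier GL2pos. B \<otimes>\<^bsub>GL2pos\<^esub> A = \<one>\<^bsub>GL2pos\<^esub>"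
    by (intro bexI[of _ B]) (simp_all add: GL2pos_def)
qed (simp_all add: GL2pos_def det_mul matrix_mul_assoc)

datatype sphere = Pt complex | Infinity

definition upper_half :: "complex set" where
  "upper_half = {z. Im z > 0}"

definition cocycle :: "real^2^2 \<Rightarrow> complex \<Rightarrow> complex" where
  "cocycle A z = of_real (A $ 2 $ 1) * z + of_real (A $ 2 $ 2)"

definition moebius :: "real^2^2 \<Rightarrow> complex \<Rightarrow> complex" where
  "moebius A z = (of_real (A $ 1 $ 1) * z + of_real (A $ 1 $ 2)) / cocycle A z"

fun act :: "real^2^2 \<Rightarrow> sphere \<Rightarrow> sphere" where
  "act A (Pt z) = (if cocycle A z = 0 then Infinity else Pt (moebius A z))"
| "act A Infinity =
     (if A $ 2 $ 1 = 0 then Infinity else Pt (of_real (A $ 1 $ 1 / A $ 2 $ 1)))"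

definition slash :: "int \<Rightarrow> (complex \<Rightarrow> complex) \<Rightarrow> real^2^2 \<Rightarrow> complex \<Rightarrow> complex" where
  "slash k F A z =
     of_real (det A powr (of_int k / 2)) * cocycle A z powi (- k) * F (moebius A z)"


section \<open>Gamma_0(N) and its Atkin-Lehner extensions\<close>

definition SL2Z :: "(real^2^2) set" where
  "SL2Z = {mat2 (of_int a) (of_int b) (of_int c) (of_int d) | a b c d :: int. a * d - b * c = 1}"

definition Gamma0 :: "nat \<Rightarrow> (real^2^2) set" where
  "Gamma0 N = {mat2 (of_int a) (of_int b) (of_int (c * int N)) (of_int d) | a b c d :: int.
     a * d - b * (c * int N) = 1}"

definition hall_divisor :: "nat \<Rightarrow> nat \<Rightarrow> bool" where
  "hall_divisor e N \<longleftrightarrow> e dvd N \<and> gcd e (N div e) = 1"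

text \<open>All matrices that may serve as \<open>w\<^sub>e\<close>. They form one coset of \<open>Gamma0 N\<close>, so a
  group containing \<open>Gamma0 N\<close> and one of them contains all of them.\<close>

definition AL_matrices :: "nat \<Rightarrow> nat \<Rightarrow> (real^2^2) set" where
  "AL_matrices N e =
     {mat2 (of_int a) (of_int b) (of_int (c * int N)) (of_int d) | a b c d :: int.
        int e dvd a \<and> int e dvd d \<and> a * d - b * (c * int N) = int e}"

text \<open>The case \<open>S = {}\<close> is \<open>Gamma0 N\<close> itself. As the \<open>w\<^sub>e\<close> are not normalised to
  determinant 1, the group may contain scalar matrices other than 1 and -1.\<close>

definition AL_extension :: "nat \<Rightarrow> nat set \<Rightarrow> (real^2^2) set" where
  "AL_extension N S = generate GL2pos (Gamma0 N \<union> (\<Union>e\<in>S. AL_matrices N e))"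


section \<open>The compactified quotient\<close>

text \<open>The groups considered are commensurable with \<open>SL2Z\<close> up to scalars, so that their cusps
  are the points of the rational projective line.\<close>

definition cusps :: "sphere set" where
  "cusps = insert Infinity (Pt ` \<rat>)"

definition Hstar :: "sphere set" where
  "Hstar = Pt ` upper_half \<union> cusps"

definition Hstar_open :: "sphere set \<Rightarrow> bool" where
  "Hstar_open U \<longleftrightarrow> U \<subseteq> Hstar \<and> open {z \<in> upper_half. Pt z \<in> U} \<and>
     (\<forall>\<sigma>\<in>SL2Z. act \<sigma> Infinity \<in> U \<longrightarrow> (\<exists>M>0. \<forall>z. Im z > M \<longrightarrow> Pt (moebius \<sigma> z) \<in> U))"

lemma istopology_Hstar_open: "istopology Hstar_open"
  unfolding istopology_def
proof (intro conjI allI impI)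
  fix S T assume S: "Hstar_open S" and T: "Hstar_open T"
  have *: "{z \<in> upper_half. Pt z \<in> S \<inter> T} =
      {z \<in> upper_half. Pt z \<in> S} \<inter> {z \<in> upper_half. Pt z \<in> T}" by auto
  show "Hstar_open (S \<inter> T)"
    unfolding Hstar_open_def *
  proof (intro conjI ballI impI)
    fix \<sigma> assume \<sigma>: "\<sigma> \<in> SL2Z" "act \<sigma> Infinity \<in> S \<inter> T"
    from S \<sigma> obtain M where M: "M > 0" "\<forall>z. Im z > M \<longrightarrow> Pt (moebius \<sigma> z) \<in> S"
      unfolding Hstar_open_def by blast
    from T \<sigma> obtain M' where M': "M' > 0" "\<forall>z. Im z > M' \<longrightarrow> Pt (moebius \<sigma> z) \<in> T"
      unfolding Hstar_open_def by blast
    show "\<exists>M>0. \<forall>z. Im z > M \<longrightarrow> Pt (moebius \<sigma> z) \<in> S \<inter> T"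
      using M M' by (intro exI[of _ "max M M'"]) auto
  qed (use S T in \<open>auto simp: Hstar_open_def\<close>)
next
  fix \<K> assume K: "\<forall>K\<in>\<K>. Hstar_open K"
  have *: "{z \<in> upper_half. Pt z \<in> \<Union>\<K>} = (\<Union>K\<in>\<K>. {z \<in> upper_half. Pt z \<in> K})" by auto
  show "Hstar_open (\<Union>\<K>)"
    unfolding Hstar_open_def *
  proof (intro conjI ballI impI)
    fix \<sigma> assume \<sigma>: "\<sigma> \<in> SL2Z" "act \<sigma> Infinity \<in> \<Union>\<K>"
    then obtain K where "K \<in> \<K>" "act \<sigma> Infinity \<in> K" by auto
    moreover from this K \<sigma> obtain M where "M > 0" "\<forall>z. Im z > M \<longrightarrow> Pt (moebius \<sigma> z) \<in> K"
      unfolding Hstar_open_def by blast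
    ultimately show "\<exists>M>0. \<forall>z. Im z > M \<longrightarrow> Pt (moebius \<sigma> z) \<in> \<Union>\<K>" by blast
  qed (use K in \<open>auto simp: Hstar_open_def\<close>)
qed

definition Gamma_orbit :: "(real^2^2) set \<Rightarrow> sphere \<Rightarrow> sphere set" where
  "Gamma_orbit \<Gamma> P = (\<lambda>\<gamma>. act \<gamma> P) ` \<Gamma>"

definition modular_curve :: "(real^2^2) set \<Rightarrow> sphere set set" where
  "modular_curve \<Gamma> = Gamma_orbit \<Gamma> ` Hstar"

definition modular_curve_topology :: "(real^2^2) set \<Rightarrow> sphere set topology" where
  "modular_curve_topology \<Gamma> =
     topology (\<lambda>U. U \<subseteq> modular_curve \<Gamma> \<and> Hstar_open {P \<in> Hstar. Gamma_orbit \<Gamma> P \<in> U})"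

lemma istopology_modular_curve:
  "istopology (\<lambda>U. U \<subseteq> modular_curve \<Gamma> \<and> Hstar_open {P \<in> Hstar. Gamma_orbit \<Gamma> P \<in> U})"
  unfolding istopology_def
proof (intro conjI allI impI)
  fix S T
  assume S: "S \<subseteq> modular_curve \<Gamma> \<and> Hstar_open {P \<in> Hstar. Gamma_orbit \<Gamma> P \<in> S}"
     and T: "T \<subseteq> modular_curve \<Gamma> \<and> Hstar_open {P \<in> Hstar. Gamma_orbit \<Gamma> P \<in> T}"
  show "S \<inter> T \<subseteq> modular_curve \<Gamma>" using S by auto
  have "{P \<in> Hstar. Gamma_orbit \<Gamma> P \<in> S \<inter> T} =
      {P \<in> Hstar. Gamma_orbit \<Gamma> P \<in> S} \<inter> {P \<in> Hstar. Gamma_orbit \<Gamma> P \<in> T}" by auto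
  thus "Hstar_open {P \<in> Hstar. Gamma_orbit \<Gamma> P \<in> S \<inter> T}"
    using S T istopology_Hstar_open[unfolded istopology_def] by simp
next
  fix \<K> assume K: "\<forall>K\<in>\<K>. K \<subseteq> modular_curve \<Gamma> \<and> Hstar_open {P \<in> Hstar. Gamma_orbit \<Gamma> P \<in> K}"
  show "\<Union>\<K> \<subseteq> modular_curve \<Gamma>" using K by auto
  have "{P \<in> Hstar. Gamma_orbit \<Gamma> P \<in> \<Union>\<K>} = \<Union>((\<lambda>K. {P \<in> Hstar. Gamma_orbit \<Gamma> P \<in> K}) ` \<K>)" by auto
  moreover have "Hstar_open (\<Union>((\<lambda>K. {P \<in> Hstar. Gamma_orbit \<Gamma> P \<in> K}) ` \<K>))"
    using K by (intro istopology_Hstar_open[unfolded istopology_def, THEN conjunct2, rule_format])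
      auto
  ultimately show "Hstar_open {P \<in> Hstar. Gamma_orbit \<Gamma> P \<in> \<Union>\<K>}" by simp
qed

text \<open>Topological genus of a compact connected oriented surface.\<close>

definition has_genus :: "'a topology \<Rightarrow> nat \<Rightarrow> bool" where
  "has_genus Y g \<longleftrightarrow> homology_group 1 Y \<cong> free_Abelian_group {..<2 * g}"


section \<open>Modular forms, modular functions and their orders\<close>

definition at_ioo :: "complex filter" where
  "at_ioo = filtercomap Im at_top"

text \<open>Every cusp is \<open>act \<sigma> Infinity\<close> for some \<open>\<sigma> \<in> SL2Z\<close>, so ranging over \<open>SL2Z\<close> imposes the
  growth conditions at all cusps.\<close>

definition modular_form ::
  "(real^2^2) set \<Rightarrow> int \<Rightarrow> (real^2^2 \<Rightarrow> complex) \<Rightarrow> (complex \<Rightarrow> complex) \<Rightarrow> bool" where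
  "modular_form \<Gamma> k \<psi> F \<longleftrightarrow>
     F holomorphic_on upper_half \<and>
     (\<forall>\<gamma>\<in>\<Gamma>. norm (\<psi> \<gamma>) = 1 \<and> (\<forall>z\<in>upper_half. slash k F \<gamma> z = \<psi> \<gamma> * F z)) \<and>
     (\<forall>\<sigma>\<in>SL2Z. Bfun (slash k F \<sigma>) at_ioo)"

text \<open>The predicate \<open>nicely_meromorphic_on\<close> fixes the value 0 at poles, so invariance can be
  demanded at every point of the upper half plane. Meromorphy at a cusp is growth at most
  exponential in the imaginary part.\<close>

definition modular_function :: "(real^2^2) set \<Rightarrow> (complex \<Rightarrow> complex) \<Rightarrow> bool" where
  "modular_function \<Gamma> f \<longleftrightarrow>
     f nicely_meromorphic_on upper_half \<and>
     (\<forall>\<gamma>\<in>\<Gamma>. \<forall>z\<in>upper_half. f (moebius \<gamma> z) = f z) \<and>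
     (\<forall>\<sigma>\<in>SL2Z. \<exists>n::nat. Bfun (\<lambda>z. f (moebius \<sigma> z) * exp (2 * pi * \<i> * of_nat n * z)) at_ioo)"

text \<open>Order of the stabiliser of a point as a group of Moebius transformations, that is,
  modulo scalar matrices.\<close>

definition elliptic_index :: "(real^2^2) set \<Rightarrow> complex \<Rightarrow> nat" where
  "elliptic_index \<Gamma> z = card (act ` {\<gamma>\<in>\<Gamma>. moebius \<gamma> z = z})"

definition cusp_width :: "(real^2^2) set \<Rightarrow> real^2^2 \<Rightarrow> real" where
  "cusp_width \<Gamma> \<sigma> = Inf {h. h > 0 \<and>
     (\<exists>\<gamma>\<in>\<Gamma>. \<forall>z\<in>upper_half. moebius \<gamma> (moebius \<sigma> z) = moebius \<sigma> (z + of_real h))}"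

text \<open>The order \<open>r\<close> of a weight \<open>k\<close> form at a point of the modular curve, measured by the local
  parameter there: this is \<open>((w - z) / (w - cnj z)) ^ m\<close> at a point \<open>z\<close> of the upper half plane
  with stabiliser of order \<open>m\<close>, and \<open>exp (2 * pi * \<i> * z / h)\<close> (in the coordinate
  \<open>z\<close> with the cusp moved to infinity) at a cusp of width \<open>h\<close>.\<close>

definition has_order ::
  "(real^2^2) set \<Rightarrow> int \<Rightarrow> (complex \<Rightarrow> complex) \<Rightarrow> sphere \<Rightarrow> real \<Rightarrow> bool" where
  "has_order \<Gamma> k F P r \<longleftrightarrow>
     (\<exists>z\<in>upper_half. P = Pt z \<and> (\<exists>\<^sub>F w in at z. F w \<noteq> 0) \<and>
        r = of_int (zorder F z) / of_nat (elliptic_index \<Gamma> z)) \<or>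
     (\<exists>\<sigma>\<in>SL2Z. P = act \<sigma> Infinity \<and> (\<exists>c. c \<noteq> 0 \<and>
        ((\<lambda>z. slash k F \<sigma> z / exp (2 * pi * \<i> * of_real r * z / of_real (cusp_width \<Gamma> \<sigma>)))
           \<longlongrightarrow> c) at_ioo))"

definition cusp_value :: "(complex \<Rightarrow> complex) \<Rightarrow> sphere \<Rightarrow> sphere" where
  "cusp_value f P =
     (let g = (\<lambda>z. f (moebius (SOME \<sigma>. \<sigma> \<in> SL2Z \<and> act \<sigma> Infinity = P) z))
      in if filterlim g at_infinity at_ioo then Infinity else Pt (Lim at_ioo g))"

text \<open>Value in the Riemann sphere of a modular function at a point of \<open>Hstar\<close>.\<close>

definition value_at :: "(complex \<Rightarrow> complex) \<Rightarrow> sphere \<Rightarrow> sphere" where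
  "value_at f P =
     (case P of
        Pt z \<Rightarrow> if z \<in> upper_half then (if is_pole f z then Infinity else Pt (f z))
                else cusp_value f P
      | Infinity \<Rightarrow> cusp_value f P)"

text \<open>An isomorphism from the modular curve to the projective line is a bijection that is given
  in local parameters by a function with nonvanishing derivative, that is, \<open>f - c\<close> has a simple
  zero where the value is \<open>c\<close>, and \<open>f\<close> has a simple pole where it is infinite.\<close>

definition uniformizer :: "(real^2^2) set \<Rightarrow> (complex \<Rightarrow> complex) \<Rightarrow> bool" where
  "uniformizer \<Gamma> f \<longleftrightarrow>
     modular_function \<Gamma> f \<and>
     bij_betw (\<lambda>C. the_elem (value_at f ` C)) (modular_curve \<Gamma>) UNIV \<and>
     (\<forall>P\<in>Hstar. case value_at f P of
        Pt c \<Rightarrow> has_order \<Gamma> 0 (\<lambda>z. f z - c) P 1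
      | Infinity \<Rightarrow> has_order \<Gamma> 0 f P (- 1))"

text \<open>As \<open>f\<close> may have poles in the upper half plane, its expansion is only required to represent
  it for large imaginary part.\<close>

definition has_q_expansion :: "(complex \<Rightarrow> complex) \<Rightarrow> complex fps \<Rightarrow> bool" where
  "has_q_expansion f A \<longleftrightarrow> fps_conv_radius A > 0 \<and>
     eventually (\<lambda>\<tau>. f \<tau> = eval_fps A (exp (2 * pi * \<i> * \<tau>))) at_ioo"


section \<open>p-adic integers and Lucas congruences\<close>

text \<open>The inverse limit of the rings of residues modulo \<open>p ^ n\<close>, with residues represented
  in \<open>{0..<p ^ n}\<close>.\<close>

definition padic_ints :: "nat \<Rightarrow> (nat \<Rightarrow> int) ring" where
  "padic_ints p =
     \<lparr>carrier = {x. \<forall>n. x n \<in> {0..<int p ^ n} \<and> x (Suc n) mod int p ^ n = x n},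
      monoid.mult = (\<lambda>x y n. (x n * y n) mod int p ^ n),
      one = (\<lambda>n. 1 mod int p ^ n),
      zero = (\<lambda>n. 0),
      add = (\<lambda>x y n. (x n + y n) mod int p ^ n)\<rparr>"

lemma cring_padic_ints:
  assumes "p > 0"
  shows "cring (padic_ints p)"
proof -
  have pos: "int p ^ n > 0" for n using assms by simp
  have dv: "int p ^ n dvd int p ^ Suc n" for n by simp
  have mm: "(x mod int p ^ Suc n) mod int p ^ n = x mod int p ^ n" for x n
    using mod_mod_cancel[OF dv] .
  have comp2: "(h (x (Suc n)) (y (Suc n)) mod int p ^ Suc n) mod int p ^ n
      = h (x n) (y n) mod int p ^ n"
    if "x (Suc n) mod int p ^ n = x n" "y (Suc n) mod int p ^ n = y n"
       "\<And>a b. h (a mod int p ^ n) (b mod int p ^ n) mod int p ^ n = h a b mod int p ^ n"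
    for h x y n
    using mm[of "h (x (Suc n)) (y (Suc n))" n] that(3)[of "x (Suc n)" "y (Suc n)"] that(1,2)
    by simp
  have carr: "x \<in> carrier (padic_ints p) \<longleftrightarrow>
      (\<forall>n. 0 \<le> x n \<and> x n < int p ^ n \<and> x (Suc n) mod int p ^ n = x n)" for x
    by (auto simp: padic_ints_def)
  have ops: "(x \<oplus>\<^bsub>padic_ints p\<^esub> y) = (\<lambda>n. (x n + y n) mod int p ^ n)"
    "(x \<otimes>\<^bsub>padic_ints p\<^esub> y) = (\<lambda>n. (x n * y n) mod int p ^ n)"
    "\<one>\<^bsub>padic_ints p\<^esub> = (\<lambda>n. 1 mod int p ^ n)" "\<zero>\<^bsub>padic_ints p\<^esub> = (\<lambda>n. 0)" for x y
    by (simp_all add: padic_ints_def)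
  have red: "x n mod int p ^ n = x n" if "x \<in> carrier (padic_ints p)" for x n
    using that by (simp add: carr)
  have add_closed: "x \<oplus>\<^bsub>padic_ints p\<^esub> y \<in> carrier (padic_ints p)"
    if "x \<in> carrier (padic_ints p)" "y \<in> carrier (padic_ints p)" for x y
    using that comp2[of x _ y "(+)"] pos unfolding carr ops by (simp add: mod_add_eq)
  have mult_closed: "x \<otimes>\<^bsub>padic_ints p\<^esub> y \<in> carrier (padic_ints p)"
    if "x \<in> carrier (padic_ints p)" "y \<in> carrier (padic_ints p)" for x y
    using that comp2[of x _ y "(*)"] pos unfolding carr ops by (simp add: mod_mult_eq)
  have neg_closed: "(\<lambda>n. (- x n) mod int p ^ n) \<in> carrier (padic_ints p)"
    if "x \<in> carrier (padic_ints p)" for x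
    using that comp2[of x _ x "\<lambda>a b. - a"] pos unfolding carr by (simp add: mod_minus_eq)
  show ?thesis
  proof (intro cringI abelian_groupI comm_monoidI add_closed mult_closed)
    fix x assume x: "x \<in> carrier (padic_ints p)"
    show "\<exists>y\<in>carrier (padic_ints p). y \<oplus>\<^bsub>padic_ints p\<^esub> x = \<zero>\<^bsub>padic_ints p\<^esub>"
      by (rule bexI[OF _ neg_closed[OF x]]) (simp add: ops mod_add_left_eq)
    show "\<one>\<^bsub>padic_ints p\<^esub> \<otimes>\<^bsub>padic_ints p\<^esub> x = x" "\<zero>\<^bsub>padic_ints p\<^esub> \<oplus>\<^bsub>padic_ints p\<^esub> x = x"
      by (simp_all add: ops mod_mult_left_eq red[OF x])
  next
    show "\<one>\<^bsub>padic_ints p\<^esub> \<in> carrier (padic_ints p)" "\<zero>\<^bsub>padic_ints p\<^esub> \<in> carrier (padic_ints p)"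
      using pos mm[of 1] by (simp_all add: carr ops)
  next
    fix x y z
    show "(x \<oplus>\<^bsub>padic_ints p\<^esub> y) \<oplus>\<^bsub>padic_ints p\<^esub> z = x \<oplus>\<^bsub>padic_ints p\<^esub> (y \<oplus>\<^bsub>padic_ints p\<^esub> z)"
      by (simp add: ops mod_add_left_eq mod_add_right_eq add.assoc)
    show "(x \<otimes>\<^bsub>padic_ints p\<^esub> y) \<otimes>\<^bsub>padic_ints p\<^esub> z = x \<otimes>\<^bsub>padic_ints p\<^esub> (y \<otimes>\<^bsub>padic_ints p\<^esub> z)"
      by (simp add: ops mod_mult_left_eq mod_mult_right_eq mult.assoc)
    show "(x \<oplus>\<^bsub>padic_ints p\<^esub> y) \<otimes>\<^bsub>padic_ints p\<^esub> z =
        (x \<otimes>\<^bsub>padic_ints p\<^esub> z) \<oplus>\<^bsub>padic_ints p\<^esub> (y \<otimes>\<^bsub>padic_ints p\<^esub> z)"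
      by (simp add: ops mod_mult_left_eq mod_add_eq distrib_right)
    show "x \<oplus>\<^bsub>padic_ints p\<^esub> y = y \<oplus>\<^bsub>padic_ints p\<^esub> x" "x \<otimes>\<^bsub>padic_ints p\<^esub> y = y \<otimes>\<^bsub>padic_ints p\<^esub> x"
      by (simp_all add: ops add.commute mult.commute)
  qed
qed

definition ring_embedding :: "('a, 'm) ring_scheme \<Rightarrow> ('b, 'n) ring_scheme \<Rightarrow> ('a \<Rightarrow> 'b) \<Rightarrow> bool" where
  "ring_embedding R S \<phi> \<longleftrightarrow> \<phi> \<in> ring_hom R S \<and> inj_on \<phi> (carrier R)"

text \<open>The congruences modulo \<open>p\<close> for a sequence in a ring embedded by \<open>\<phi>\<close> in the
  p-adic integers.\<close>

definition lucas_congruences :: "nat \<Rightarrow> (complex \<Rightarrow> nat \<Rightarrow> int) \<Rightarrow> (nat \<Rightarrow> complex) \<Rightarrow> bool" where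
  "lucas_congruences p \<phi> T \<longleftrightarrow>
     (\<forall>s. \<forall>d :: nat \<Rightarrow> nat. (\<forall>i\<le>s. d i \<le> p - 1) \<longrightarrow>
        \<phi> (T (\<Sum>i\<le>s. d i * p ^ i)) \<ominus>\<^bsub>padic_ints p\<^esub> \<phi> (\<Prod>i\<le>s. T (d i))
          \<in> PIdl\<^bsub>padic_ints p\<^esub> (add_pow (padic_ints p) p \<one>\<^bsub>padic_ints p\<^esub>))"

end

theory Submission
  imports Defs "HOL-Number_Theory.Residues"
begin

text \<open>
  Let \<open>M = (p - 1) * p ^ i\<close>. For a suitable even \<open>M\<close> there is a holomorphic form \<open>E\<close> of weight
  \<open>2 * M\<close> for \<open>\<Gamma>\<close> whose q-expansion is congruent to 1 modulo \<open>p\<close>: a power of a normalised Eisenstein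
  series of level one is p-adically close to 1 because \<open>p\<close> divides the denominator of the Bernoulli
  number, and \<open>E\<close> is the normalised sum of its finitely many transforms under \<open>\<Gamma>\<close>.
  Since \<open>Z\<close> vanishes only at the pole of \<open>t\<close>, and to order at most 1, the function \<open>E / Z ^ M\<close> is a polynomial in \<open>t\<close> of degree at most \<open>M\<close>. Writing \<open>F\<close>
  for the generating function of \<open>T\<close>, this means that \<open>h * F ^ M\<close> is congruent to 1 for a polynomial
  \<open>h\<close> of degree at most \<open>M\<close>. Multiplying by \<open>F ^ (p ^ i)\<close> and applying Frobenius twice,
  \<open>h(x) * F(x ^ (p ^ (i + 1)))\<close> is congruent to \<open>F(x ^ (p ^ i))\<close>. The coefficients at multiples of
  \<open>p ^ i\<close> now give \<open>T(a + p * n) = T(a) * T(n)\<close> modulo \<open>p\<close> for \<open>a < p\<close>, because \<open>deg h \<le> (p - 1) * p ^ i\<close>.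
\<close>

section \<open>Power series modulo an ideal with trivial Frobenius\<close>

text \<open>The obstacle is the normalisation of the invariant form. The transforms under
  \<open>\<Gamma>\<close> are functions \<open>e^M * E(e z)\<close> for certain divisors
  \<open>e\<close> of \<open>N\<close>, so their sum has constant term \<open>C\<close>, the sum of
  the \<open>e^M\<close>, and \<open>p\<close> may divide \<open>C\<close>. Two choices repair this.
  The exponent \<open>i\<close> is at least \<open>N\<close>, so that each \<open>e^M\<close> is 0
  or 1 modulo \<open>p^(N+1)\<close> and the valuation of \<open>C\<close> is at most
  \<open>N\<close>; and the level one form is congruent to 1 modulo \<open>p^(N+1)\<close>, so that
  one factor \<open>p\<close> survives the division by \<open>C\<close>. Both force a high power
  \<open>p^i\<close> into the weight, and this is why the Frobenius argument works with
  \<open>M = (p - 1) * p^i\<close> instead of \<open>p - 1\<close>. Evenness of \<open>M\<close>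
  kills the multiplier of \<open>Z\<close>. The polynomial in \<open>t\<close> has complex
  coefficients about which nothing is known in advance. Their integrality is recovered from the
  \<open>q\<close>-expansions: \<open>t = q + ...\<close> makes composition with \<open>t\<close> a
  unitriangular operation, and a denominator \<open>D\<close> prime to \<open>p\<close> is carried
  along until it can be inverted modulo \<open>p\<close>.\<close>

definition fps_stretch :: "nat \<Rightarrow> 'a::zero fps \<Rightarrow> 'a fps" where
  "fps_stretch m A = Abs_fps (\<lambda>n. if m dvd n then fps_nth A (n div m) else 0)"

lemma fps_stretch_nth: "fps_nth (fps_stretch m A) n = (if m dvd n then fps_nth A (n div m) else 0)"
  by (simp add: fps_stretch_def)

lemma fps_stretch_1 [simp]: "fps_stretch (Suc 0) A = A"
  by (simp add: fps_eq_iff fps_stretch_nth)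

lemma fps_stretch_stretch:
  assumes "m > 0" "k > 0"
  shows "fps_stretch m (fps_stretch k A) = fps_stretch (m * k) A"
proof (rule fps_ext)
  fix n
  show "fps_nth (fps_stretch m (fps_stretch k A)) n = fps_nth (fps_stretch (m * k) A) n"
  proof (cases "m dvd n")
    case True
    then obtain l where l: "n = m * l" by blast
    show ?thesis using assms by (auto simp: fps_stretch_nth l div_mult2_eq)
  next
    case False
    hence "\<not> m * k dvd n" by (meson dvd_trans dvd_triv_left)
    thus ?thesis using False by (simp add: fps_stretch_nth)
  qed
qed

text \<open>Models a subring of the complex numbers that maps to the p-adic integers, together with
  the preimage of the maximal ideal. That the residue field is the prime field enters as
  \<open>frob_I\<close>. \<open>R\<close> is a set and not a type of its own, because the expansion
  of the invariant form and the polynomial in \<open>t\<close> may have coefficients outside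
  \<open>R\<close>.\<close>

locale prime_residue_ideal =
  fixes R I :: "'a::idom set" and p :: nat
  assumes prime_p: "Factorial_Ring.prime p"
    and one_R: "1 \<in> R"
    and diff_R: "a \<in> R \<Longrightarrow> b \<in> R \<Longrightarrow> a - b \<in> R"
    and mult_R: "a \<in> R \<Longrightarrow> b \<in> R \<Longrightarrow> a * b \<in> R"
    and I_subset: "I \<subseteq> R"
    and diff_I: "a \<in> I \<Longrightarrow> b \<in> I \<Longrightarrow> a - b \<in> I"
    and mult_I: "a \<in> I \<Longrightarrow> b \<in> R \<Longrightarrow> a * b \<in> I"
    and p_in_I: "of_nat p \<in> I"
    and frob_I: "a \<in> R \<Longrightarrow> a ^ p - a \<in> I"
begin

lemma zero_R: "0 \<in> R" and zero_I: "0 \<in> I"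
  using diff_R[OF one_R one_R] diff_I[OF p_in_I p_in_I] by simp_all

lemma uminus_R: "a \<in> R \<Longrightarrow> - a \<in> R" and uminus_I: "a \<in> I \<Longrightarrow> - a \<in> I"
  using diff_R[OF zero_R] diff_I[OF zero_I] by simp_all

lemma add_R: "a \<in> R \<Longrightarrow> b \<in> R \<Longrightarrow> a + b \<in> R"
  using diff_R[OF _ uminus_R, of a b] by simp

lemma add_I: "a \<in> I \<Longrightarrow> b \<in> I \<Longrightarrow> a + b \<in> I"
  using diff_I[OF _ uminus_I, of a b] by simp

lemma mult_I': "a \<in> R \<Longrightarrow> b \<in> I \<Longrightarrow> a * b \<in> I"
  using mult_I[of b a] by (simp add: mult.commute)

lemma sum_R: "(\<And>x. x \<in> Y \<Longrightarrow> f x \<in> R) \<Longrightarrow> sum f Y \<in> R"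
  by (induction Y rule: infinite_finite_induct) (auto intro: zero_R add_R)

lemma sum_I: "(\<And>x. x \<in> Y \<Longrightarrow> f x \<in> I) \<Longrightarrow> sum f Y \<in> I"
  by (induction Y rule: infinite_finite_induct) (auto intro: zero_I add_I)

lemma prod_R: "(\<And>x. x \<in> Y \<Longrightarrow> f x \<in> R) \<Longrightarrow> prod f Y \<in> R"
  by (induction Y rule: infinite_finite_induct) (auto intro: one_R mult_R)

lemma of_nat_R: "of_nat n \<in> R"
  by (induction n) (auto intro: zero_R add_R one_R)

lemma of_int_R: "of_int k \<in> R"
  by (cases k rule: int_cases2) (auto intro: of_nat_R uminus_R)

section \<open>Power series over the ring and Frobenius on them\<close>

definition RF :: "'a fps set" where "RF = {A. \<forall>n. fps_nth A n \<in> R}"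
definition IF :: "'a fps set" where "IF = {A. \<forall>n. fps_nth A n \<in> I}"

lemma IF_subset: "A \<in> IF \<Longrightarrow> A \<in> RF"
  using I_subset by (auto simp: RF_def IF_def)

lemma one_RF: "1 \<in> RF" by (auto simp: RF_def one_R zero_R)
lemma zero_IF: "0 \<in> IF" by (auto simp: IF_def zero_I)
lemma zero_RF: "0 \<in> RF" by (auto simp: RF_def zero_R)

lemma diff_RF: "A \<in> RF \<Longrightarrow> B \<in> RF \<Longrightarrow> A - B \<in> RF"
  and diff_IF: "A \<in> IF \<Longrightarrow> B \<in> IF \<Longrightarrow> A - B \<in> IF"
  and add_RF: "A \<in> RF \<Longrightarrow> B \<in> RF \<Longrightarrow> A + B \<in> RF"
  and add_IF: "A \<in> IF \<Longrightarrow> B \<in> IF \<Longrightarrow> A + B \<in> IF"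
  by (simp_all add: RF_def IF_def diff_R diff_I add_R add_I)

lemma mult_RF: "A \<in> RF \<Longrightarrow> B \<in> RF \<Longrightarrow> A * B \<in> RF"
  by (auto simp: RF_def fps_mult_nth intro!: sum_R mult_R)

lemma mult_IF: "A \<in> IF \<Longrightarrow> B \<in> RF \<Longrightarrow> A * B \<in> IF"
  by (auto simp: RF_def IF_def fps_mult_nth intro!: sum_I mult_I)

lemma mult_IF': "A \<in> RF \<Longrightarrow> B \<in> IF \<Longrightarrow> A * B \<in> IF"
  using mult_IF[of B A] by (simp add: mult.commute)

lemma power_RF: "A \<in> RF \<Longrightarrow> A ^ n \<in> RF"
  by (induction n) (auto intro: one_RF mult_RF)

lemma sum_IF: "(\<And>x. x \<in> Y \<Longrightarrow> f x \<in> IF) \<Longrightarrow> sum f Y \<in> IF"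
  by (induction Y rule: infinite_finite_induct) (auto intro: zero_IF add_IF)

lemma const_X_RF: "a \<in> R \<Longrightarrow> fps_const a * fps_X ^ i \<in> RF"
  by (auto simp: RF_def zero_R)

text \<open>The inner binomial coefficients of a \<open>p\<close>-th power are multiples of
  \<open>p\<close>, hence in \<open>I\<close>.\<close>

lemma frobenius_add:
  assumes "A \<in> RF" "B \<in> RF"
  shows "(A + B) ^ p - A ^ p - B ^ p \<in> IF"
proof -
  have p: "p > 0" "p > 1" using prime_p prime_gt_1_nat by (auto simp: prime_gt_0_nat)
  have "(A + B) ^ p = (\<Sum>k\<le>p. of_nat (p choose k) * A ^ k * B ^ (p - k))"
    by (rule binomial_ring)
  also have "{..p} = insert 0 (insert p {1..<p})" using p by auto
  also have "(\<Sum>k\<in>\<dots>. of_nat (p choose k) * A ^ k * B ^ (p - k)) =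
      B ^ p + (A ^ p + (\<Sum>k\<in>{1..<p}. of_nat (p choose k) * A ^ k * B ^ (p - k)))"
    using p by (subst sum.insert; simp)
  finally have eq: "(A + B) ^ p - A ^ p - B ^ p =
      (\<Sum>k\<in>{1..<p}. of_nat (p choose k) * A ^ k * B ^ (p - k))" by simp
  show ?thesis unfolding eq
  proof (intro sum_IF mult_IF power_RF assms)
    fix k assume "k \<in> {1..<p}"
    hence "p dvd (p choose k)" using prime_p by (intro dvd_choose_prime) auto
    then obtain c where c: "p choose k = p * c" by blast
    have "of_nat (p choose k) \<in> I"
      unfolding c of_nat_mult by (intro mult_I p_in_I of_nat_R)
    thus "of_nat (p choose k) \<in> IF"
      by (auto simp: IF_def zero_I fps_of_nat[symmetric])
  qed
qed

lemma frobenius_poly: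
  assumes "\<And>i. a i \<in> R"
  shows "(\<Sum>i<n. fps_const (a i) * fps_X ^ i) ^ p - (\<Sum>i<n. fps_const (a i) * fps_X ^ (p * i)) \<in> IF"
proof (induction n)
  case 0
  have "p > 0" using prime_p by (simp add: prime_gt_0_nat)
  thus ?case by (simp add: zero_IF power_0_left)
next
  case (Suc n)
  let ?P = "\<Sum>i<n. fps_const (a i) * fps_X ^ i" and ?Q = "\<Sum>i<n. fps_const (a i) * fps_X ^ (p * i)"
  have P: "?P \<in> RF"
    by (induction n) (auto intro!: zero_RF add_RF const_X_RF assms)
  \<comment> \<open>On a single monomial the claim is \<open>frob_I\<close> for its
    coefficient.\<close>
  have "(fps_const (a n) * fps_X ^ n) ^ p - fps_const (a n) * fps_X ^ (p * n)
      = fps_const (a n ^ p - a n) * fps_X ^ (p * n)"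
    by (simp add: power_mult_distrib power_mult [symmetric] fps_const_power algebra_simps
          flip: fps_const_sub)
  also have "\<dots> \<in> IF" using frob_I[OF assms] by (auto simp: IF_def zero_I)
  finally have *: "(fps_const (a n) * fps_X ^ n) ^ p - fps_const (a n) * fps_X ^ (p * n) \<in> IF" .
  have "(?P + fps_const (a n) * fps_X ^ n) ^ p - (?Q + fps_const (a n) * fps_X ^ (p * n)) =
     ((?P + fps_const (a n) * fps_X ^ n) ^ p - ?P ^ p - (fps_const (a n) * fps_X ^ n) ^ p)
     + (?P ^ p - ?Q) + ((fps_const (a n) * fps_X ^ n) ^ p - fps_const (a n) * fps_X ^ (p * n))"
    by simp
  also have "\<dots> \<in> IF"
    by (intro add_IF frobenius_add P const_X_RF assms Suc.IH *)
  finally show ?case by simp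
qed

text \<open>Coefficient \<open>k\<close> sees only the truncation of the series at degree
  \<open>k\<close>: the remainder \<open>B\<close> starts beyond degree \<open>k\<close>, and so
  does its \<open>p\<close>-th power. The polynomial case and \<open>frobenius_add\<close> then
  settle coefficient \<open>k\<close>.\<close>

lemma frobenius:
  assumes "A \<in> RF"
  shows "A ^ p - fps_stretch p A \<in> IF"
  unfolding IF_def
proof (intro CollectI allI)
  fix k
  have p: "p > 0" "p > 1" using prime_p prime_gt_1_nat by (auto simp: prime_gt_0_nat)
  define P where "P = (\<Sum>i<Suc k. fps_const (fps_nth A i) * fps_X ^ i)"
  define Q where "Q = (\<Sum>i<Suc k. fps_const (fps_nth A i) * fps_X ^ (p * i))"
  define B where "B = A - P"
  have A: "fps_nth A i \<in> R" for i using assms by (auto simp: RF_def)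
  have P: "P \<in> RF"
    by (auto simp: P_def RF_def fps_sum_nth zero_R A intro!: sum_R simp del: sum.lessThan_Suc)
  have B: "B \<in> RF" unfolding B_def by (intro diff_RF assms P)
  have B0: "fps_nth B i = 0" if "i \<le> k" for i
    using that by (simp add: B_def P_def fps_sum_nth if_distrib[of "\<lambda>x. _ * x"] cong: if_cong
        del: sum.lessThan_Suc)
  have "fps_nth (B ^ n) i = 0" if "n > 0" "i \<le> k" for n i
    using that
  proof (induction n arbitrary: i)
    case (Suc n)
    show ?case using Suc.prems B0 by (auto simp: fps_mult_nth intro!: sum.neutral)
  qed simp
  hence Bp: "fps_nth (B ^ p) k = 0" using p by simp
  have Q: "fps_nth Q k = fps_nth (fps_stretch p A) k"
  proof -
    have "fps_nth Q k = (\<Sum>i<Suc k. if k = p * i then fps_nth A i else 0)"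
      by (simp add: Q_def fps_sum_nth if_distrib[of "\<lambda>x. _ * x"] cong: if_cong del: sum.lessThan_Suc)
    also have "\<dots> = (\<Sum>i\<in>(if p dvd k then {k div p} else {}). fps_nth A i)"
      using p by (intro sum.mono_neutral_cong_right)
        (auto split: if_splits simp: less_Suc_eq_le)
    finally show ?thesis by (simp add: fps_stretch_nth)
  qed
  have "A ^ p - Q = ((P + B) ^ p - P ^ p - B ^ p) + (P ^ p - Q) + B ^ p"
    by (simp add: B_def)
  hence "fps_nth (A ^ p - Q) k = fps_nth (((P + B) ^ p - P ^ p - B ^ p) + (P ^ p - Q)) k"
    using Bp by simp
  also have "\<dots> \<in> I"
    using add_IF[OF frobenius_add[OF P B] frobenius_poly[OF A, of "\<lambda>i. i" "Suc k"]]
    unfolding P_def [symmetric] Q_def [symmetric] IF_def by blast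
  finally show "fps_nth (A ^ p - fps_stretch p A) k \<in> I"
    using Q by simp
qed

lemma stretch_IF: "A \<in> IF \<Longrightarrow> fps_stretch m A \<in> IF"
  and stretch_RF: "A \<in> RF \<Longrightarrow> fps_stretch m A \<in> RF"
  by (auto simp: IF_def RF_def fps_stretch_nth zero_I zero_R)

lemma fps_stretch_diff: "fps_stretch m (A - B) = fps_stretch m A - fps_stretch m (B :: 'a fps)"
  by (auto simp: fps_eq_iff fps_stretch_nth)

lemma frobenius_iterated:
  assumes "A \<in> RF"
  shows "A ^ (p ^ k) - fps_stretch (p ^ k) A \<in> IF"
proof (induction k)
  case 0
  show ?case by (simp add: zero_IF)
next
  case (Suc k)
  have p: "p > 0" using prime_p by (simp add: prime_gt_0_nat)
  have "A ^ p ^ Suc k - fps_stretch (p ^ Suc k) A =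
      ((A ^ p ^ k) ^ p - fps_stretch p (A ^ p ^ k)) + fps_stretch p (A ^ p ^ k - fps_stretch (p ^ k) A)"
    using p by (simp add: fps_stretch_diff fps_stretch_stretch power_mult [symmetric] mult.commute)
  also have "\<dots> \<in> IF"
    by (intro add_IF frobenius power_RF assms stretch_IF Suc.IH)
  finally show ?case .
qed

text \<open>Because \<open>s\<close> starts with \<open>x\<close>, composition with \<open>s\<close>
  acts on coefficients by a unitriangular matrix. Back substitution recovers the coefficients of
  \<open>A\<close> from those of \<open>A oo s\<close> without division, which is how conditions on
  \<open>q\<close>-expansions are pulled back to series in \<open>t\<close>.\<close>

lemma compose_nth_split:
  fixes s :: "'a fps"
  assumes "fps_nth s 0 = 0" "fps_nth s 1 = 1"
  shows "fps_nth (A oo s) n = fps_nth A n + (\<Sum>i<n. fps_nth A i * fps_nth (s ^ i) n)"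
proof -
  have "fps_nth (s ^ n) n = 1"
    using startsby_zero_power_nth_same[OF assms(1), of n] assms(2) by simp
  moreover have "{0..n} = insert n {..<n}" by auto
  ultimately show ?thesis by (simp add: fps_compose_nth)
qed

lemma compose_imp_RF:
  assumes "fps_nth s 0 = 0" "fps_nth s 1 = 1" "s \<in> RF" "A oo s \<in> RF"
  shows "A \<in> RF"
proof -
  have "fps_nth A n \<in> R" for n
  proof (induction n rule: less_induct)
    case (less n)
    have "fps_nth A n = fps_nth (A oo s) n - (\<Sum>i<n. fps_nth A i * fps_nth (s ^ i) n)"
      using compose_nth_split[OF assms(1,2), of A n] by simp
    also have "\<dots> \<in> R"
      using assms power_RF[OF assms(3)] less
      by (intro diff_R sum_R mult_R) (auto simp: RF_def)
    finally show ?case .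
  qed
  thus ?thesis by (simp add: RF_def)
qed

lemma compose_imp_IF:
  assumes "fps_nth s 0 = 0" "fps_nth s 1 = 1" "s \<in> RF" "A oo s \<in> IF"
  shows "A \<in> IF"
proof -
  have "fps_nth A n \<in> I" for n
  proof (induction n rule: less_induct)
    case (less n)
    have "fps_nth A n = fps_nth (A oo s) n - (\<Sum>i<n. fps_nth A i * fps_nth (s ^ i) n)"
      using compose_nth_split[OF assms(1,2), of A n] by simp
    also have "\<dots> \<in> I"
      using assms power_RF[OF assms(3)] less
      by (intro diff_I sum_I mult_I) (auto simp: RF_def IF_def)
    finally show ?case .
  qed
  thus ?thesis by (simp add: IF_def)
qed

text \<open>Division by a series with constant term 1 requires no division of coefficients.\<close>

lemma mult_imp_RF:
  assumes "G \<in> RF" "fps_nth G 0 = 1" "H * G \<in> RF"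
  shows "H \<in> RF"
proof -
  have "fps_nth H n \<in> R" for n
  proof (induction n rule: less_induct)
    case (less n)
    have "{0..n} = insert n {..<n}" by auto
    hence "fps_nth H n = fps_nth (H * G) n - (\<Sum>i<n. fps_nth H i * fps_nth G (n - i))"
      using assms(2) by (simp add: fps_mult_nth)
    also have "\<dots> \<in> R"
      using assms less by (intro diff_R sum_R mult_R) (auto simp: RF_def)
    finally show ?case .
  qed
  thus ?thesis by (simp add: RF_def)
qed

section \<open>From a congruence of power series to Lucas congruences\<close>

lemma lucas_step:
  fixes h F :: "'a fps" and m :: nat
  defines "q \<equiv> p ^ m"
  assumes F: "F \<in> RF" "fps_nth F 0 = 1"
    and h: "h \<in> RF" "\<And>n. n > (p - 1) * q \<Longrightarrow> fps_nth h n = 0"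
    and hF: "h * F ^ ((p - 1) * q) - 1 \<in> IF"
  shows "fps_nth F n - fps_nth F (n mod p) * fps_nth F (n div p) \<in> I"
proof -
  have p: "p > 0" "p > 1" using prime_p prime_gt_1_nat by (auto simp: prime_gt_0_nat)
  have q: "q > 0" using p by (simp add: q_def)
  have pq: "(p - 1) * q + q = p ^ Suc m" using p by (cases p) (auto simp: q_def algebra_simps)
  have Fpq: "F ^ (p ^ Suc m) = F ^ ((p - 1) * q) * F ^ q"
    unfolding pq [symmetric] power_add ..
  \<comment> \<open>This is \<open>h * F(x^(pq)) - F(x^q)\<close>. The rewriting uses
    \<open>F^(pq) = F^((p-1)q) * F^q\<close>, so that each term contains the hypothesis or an
    iterated Frobenius congruence.\<close>
  have "h * fps_stretch (p ^ Suc m) F - fps_stretch q F =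
     (h * F ^ ((p - 1) * q) - 1) * F ^ q + (F ^ q - fps_stretch q F)
       - h * (F ^ (p ^ Suc m) - fps_stretch (p ^ Suc m) F)"
    unfolding Fpq by (simp add: algebra_simps)
  also have "\<dots> \<in> IF"
    unfolding q_def
    by (intro diff_IF add_IF mult_IF[OF hF[unfolded q_def]] power_RF F mult_IF'[OF h(1)]
          frobenius_iterated)
  finally have main: "h * fps_stretch (p ^ Suc m) F - fps_stretch q F \<in> IF" .
  have step: "fps_nth h (q * (n mod p)) * fps_nth F (n div p) - fps_nth F n \<in> I" for n
  proof -
    let ?G = "fps_stretch (p ^ Suc m) F"
    have *: "p * q * (n div p) + q * (n mod p) = q * n"
      by (metis distrib_left mult.assoc mult.commute mult_div_mod_eq)
    have "fps_nth (h * ?G) (q * n) = (\<Sum>i=0..q*n. fps_nth h i * fps_nth ?G (q * n - i))"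
      by (simp add: fps_mult_nth)
    also have "\<dots> = (\<Sum>i\<in>{q * (n mod p)}. fps_nth h i * fps_nth ?G (q * n - i))"
    \<comment> \<open>A nonzero term needs \<open>pq\<close> to divide \<open>qn - i\<close> and
      \<open>i\<close> to be at most \<open>(p-1)q\<close>. Then \<open>i = q * j\<close> with
      \<open>j < p\<close> and \<open>j\<close> congruent to \<open>n\<close> modulo
      \<open>p\<close>, so \<open>j = n mod p\<close>. This is the point where the degree bound on
      \<open>h\<close> decides.\<close>
    proof (rule sum.mono_neutral_right; (intro ballI)?)
      fix i assume i: "i \<in> {0..q * n} - {q * (n mod p)}"
      show "fps_nth h i * fps_nth ?G (q * n - i) = 0"
      proof (cases "p * q dvd q * n - i \<and> i \<le> (p - 1) * q")
        case True
        then obtain l where l: "q * n - i = p * q * l" by blast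
        hence i': "i = q * n - p * q * l" "q * n = p * q * l + i" using i by auto
        have "q * (p * l) \<le> q * n" using i'(2) by (simp add: mult_ac)
        hence le: "p * l \<le> n" using q by simp
        have "i = q * (n - p * l)" using i' by (simp add: right_diff_distrib' mult_ac)
        with le have n: "n = p * l + (n - p * l)" "i = q * (n - p * l)" by simp_all
        have "n - p * l \<le> p - 1" using True n(2) q by (simp add: mult.commute)
        hence "n - p * l < p" using p by simp
        hence "n mod p = n - p * l" using n(1)
          by (metis mod_less mod_mult_self4)
        hence False using n(2) i by simp
        thus ?thesis ..
      next
        case False
        thus ?thesis using h(2)[of i] by (auto simp: fps_stretch_nth q_def)
      qed
    qed (auto simp: q)
    also have "\<dots> = fps_nth h (q * (n mod p)) * fps_nth F (n div p)"
    proof -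
      have "q * n - q * (n mod p) = p ^ Suc m * (n div p)"
        using * by (simp add: q_def)
      thus ?thesis using p by (simp add: fps_stretch_nth)
    qed
    finally show ?thesis
      using main q by (auto simp: IF_def fps_stretch_nth dest!: spec[of _ "q * n"])
  qed
  have R: "fps_nth F k \<in> R" for k using F by (auto simp: RF_def)
  have "fps_nth F n - fps_nth F (n mod p) * fps_nth F (n div p) =
     (fps_nth h (q * (n mod p)) - fps_nth F (n mod p)) * fps_nth F (n div p) -
     (fps_nth h (q * (n mod p)) * fps_nth F (n div p) - fps_nth F n)"
    by (simp add: algebra_simps)
  also have "\<dots> \<in> I"
    \<comment> \<open>For the index \<open>n mod p\<close> the quotient by \<open>p\<close> is 0 and
      \<open>F\<close> has constant term 1, so that instance identifies the coefficient of
      \<open>h\<close> with that of \<open>F\<close>.\<close>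
    using step[of "n mod p"] step[of n] F(2) p by (auto intro: diff_I[OF mult_I[OF _ R]])
  finally show ?thesis .
qed

text \<open>The lowest digit is split off; what remains is the quotient by \<open>p\<close>, to
  which the induction hypothesis applies.\<close>

lemma lucas_product:
  assumes R: "\<And>n. T n \<in> R"
    and step: "\<And>n. T n - T (n mod p) * T (n div p) \<in> I"
    and d: "\<And>i. i \<le> s \<Longrightarrow> d i < p"
  shows "T (\<Sum>i\<le>s. d i * p ^ i) - (\<Prod>i\<le>s. T (d i)) \<in> I"
  using d
proof (induction s arbitrary: d)
  case 0
  show ?case by (simp add: zero_I)
next
  case (Suc s)
  have p: "p > 0" using prime_p by (simp add: prime_gt_0_nat)
  define n where "n = (\<Sum>i\<le>s. d (Suc i) * p ^ i)"
  have eq: "(\<Sum>i\<le>Suc s. d i * p ^ i) = d 0 + p * n"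
    by (subst sum.atMost_Suc_shift) (simp add: n_def sum_distrib_left mult_ac)
  have d0: "d 0 < p" using Suc.prems by auto
  have IH: "T n - (\<Prod>i\<le>s. T (d (Suc i))) \<in> I"
    unfolding n_def by (rule Suc.IH) (use Suc.prems in auto)
  have "T (\<Sum>i\<le>Suc s. d i * p ^ i) - (\<Prod>i\<le>Suc s. T (d i)) =
     (T (d 0 + p * n) - T (d 0) * T n) + T (d 0) * (T n - (\<Prod>i\<le>s. T (d (Suc i))))"
    unfolding eq by (subst prod.atMost_Suc_shift) (simp add: algebra_simps)
  also have "\<dots> \<in> I"
    using step[of "d 0 + p * n"] d0 p IH by (intro add_I mult_I' R) auto
  finally show ?case .
qed

text \<open>\<open>P\<close> is not assumed to have coefficients in \<open>R\<close>. Pulling the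
  congruence for \<open>D * A\<close> back along \<open>s\<close> shows that
  \<open>D * P * F^M\<close> is congruent to \<open>D\<close>; dividing by the unit
  \<open>F^M\<close> puts \<open>D * P\<close> into \<open>RF\<close>, and multiplication by
  \<open>x\<close>, the inverse of \<open>D\<close> modulo \<open>I\<close>, gives the
  \<open>h\<close> of \<open>lucas_step\<close>.\<close>

lemma lucas_from_polynomial:
  fixes s F A P :: "'a fps" and m :: nat and D x :: 'a
  defines "M \<equiv> (p - 1) * p ^ m"
  assumes s: "fps_nth s 0 = 0" "fps_nth s 1 = 1" "s \<in> RF"
    and F: "F oo s \<in> RF" "fps_nth F 0 = 1"
    and P: "\<And>n. n > M \<Longrightarrow> fps_nth P n = 0"
    and A: "A = (P oo s) * (F oo s) ^ M"
    and D: "D \<in> R" "x \<in> R" "D * x - 1 \<in> I" "fps_const D * (A - 1) \<in> IF"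
  shows "fps_nth F n \<in> R" "fps_nth F n - fps_nth F (n mod p) * fps_nth F (n div p) \<in> I"
proof -
  note s' = fps_compose_mult_distrib[OF s(1)]
  have FR: "F \<in> RF" by (rule compose_imp_RF[OF s F(1)])
  thus "fps_nth F n \<in> R" by (simp add: RF_def)
  define H where "H = fps_const D * P"
  have one: "(1 oo s) = 1" "fps_const D oo s = fps_const D" by simp_all
  have pw: "(F ^ k) oo s = (F oo s) ^ k" for k
    by (induction k) (simp_all add: s')
  have D': "fps_const D \<in> RF" using D by (auto simp: RF_def zero_R)
  have "(H * F ^ M - fps_const D) oo s = fps_const D * (P oo s) * (F oo s) ^ M - fps_const D"
    by (simp only: H_def s' pw one fps_compose_sub_distrib)
  also have "\<dots> = fps_const D * (A - 1)"
    unfolding A right_diff_distrib mult_1_right mult.assoc ..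
  finally have "(H * F ^ M - fps_const D) oo s = fps_const D * (A - 1)" .
  hence "H * F ^ M - fps_const D \<in> IF"
    using D(4) by (metis compose_imp_IF[OF s])
  note HF = this
  have "H * F ^ M \<in> RF"
    using add_RF[OF IF_subset[OF HF] D'] unfolding diff_add_cancel .
  hence HR: "H \<in> RF"
    by (rule mult_imp_RF[OF power_RF[OF FR], rotated]) (simp add: fps_power_zeroth F(2))
  define h where "h = fps_const x * H"
  have x': "fps_const x \<in> RF" using D by (auto simp: RF_def zero_R)
  have hR: "h \<in> RF" unfolding h_def by (intro mult_RF x' HR)
  have "h * F ^ M - 1 = fps_const x * (H * F ^ M - fps_const D) + fps_const (D * x - 1)"
    by (simp add: h_def right_diff_distrib mult.assoc mult.commute flip: fps_const_sub)
  also have "\<dots> \<in> IF" using D HF x' by (intro add_IF mult_IF') (auto simp: IF_def zero_I)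
  finally have hF: "h * F ^ M - 1 \<in> IF" .
  show "fps_nth F n - fps_nth F (n mod p) * fps_nth F (n div p) \<in> I"
    by (rule lucas_step[OF FR F(2) hR _ hF[unfolded M_def]])
      (use P in \<open>simp add: h_def H_def M_def\<close>)
qed

end

section \<open>The Lipschitz formula\<close>

text \<open>For \<open>n > 0\<close>, multiplied by \<open>(-1)^(n+1) / n!\<close>, this is the sum
  of \<open>1/(z+j)^(n+1)\<close> over all nonzero integers \<open>j\<close>. Leaving out
  \<open>j = 0\<close> keeps it regular at 0, where it yields zeta values, and the sign makes each
  function the derivative of the previous one.\<close>

definition Polygamma_diff :: "nat \<Rightarrow> complex \<Rightarrow> complex" where
  "Polygamma_diff n z = Polygamma n (1 + z) - (-1) ^ n * Polygamma n (1 - z)"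

lemma summable_norm_inverse_shift:
  fixes z :: complex
  assumes "n \<ge> 2"
  shows "summable (\<lambda>k. norm (inverse ((z + of_nat k) ^ n)))"
proof (rule summable_comparison_test_ev)
  show "summable (\<lambda>k. 2 ^ n * inverse (real k ^ n))"
    by (intro summable_mult) (use inverse_power_summable[of n, where 'a = real] assms in simp)
  have "eventually (\<lambda>k. real k > 2 * norm z) sequentially"
    by real_asymp
  thus "eventually (\<lambda>k. norm (norm (inverse ((z + of_nat k) ^ n))) \<le> 2 ^ n * inverse (real k ^ n)) sequentially"
  proof eventually_elim
    case (elim k)
    have "real k / 2 \<le> real k - norm z" using elim by simp
    also have "\<dots> \<le> norm (of_nat k + z)"
      using norm_diff_ineq[of "of_nat k" z] by simp
    finally have le: "real k / 2 \<le> norm (z + of_nat k)" by (simp add: add.commute)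
    have "0 < real k" using elim norm_ge_zero[of z] by linarith
    hence "inverse (norm (z + of_nat k) ^ n) \<le> inverse ((real k / 2) ^ n)"
      using le by (intro le_imp_inverse_le power_mono) auto
    also have "\<dots> = 2 ^ n * inverse (real k ^ n)"
      by (simp add: power_divide divide_simps)
    finally show ?case by (simp add: norm_inverse norm_power)
  qed
qed

lemma Polygamma_has_sum:
  fixes z :: complex
  assumes "n > 0"
  shows "((\<lambda>k::nat. inverse ((z + of_nat k) ^ Suc n)) has_sum
           ((-1) ^ Suc n / fact n * Polygamma n z)) UNIV"
proof -
  have "summable (\<lambda>k. norm (inverse ((z + of_nat k) ^ Suc n)))"
    using assms by (intro summable_norm_inverse_shift) auto
  moreover from this have "(\<lambda>k. inverse ((z + of_nat k) ^ Suc n)) sums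
      (suminf (\<lambda>k. inverse ((z + of_nat k) ^ Suc n)))"
    by (rule summable_sums[OF summable_norm_cancel])
  moreover have "(suminf (\<lambda>k. inverse ((z + of_nat k) ^ Suc n))) = (-1) ^ Suc n / fact n * Polygamma n z"
  proof -
    have "((-1) ^ Suc n * (-1) ^ Suc n :: complex) = 1" by (simp flip: power_mult_distrib)
    thus ?thesis using assms by (simp add: Polygamma_def del: power_Suc)
  qed
  ultimately show ?thesis using norm_summable_imp_has_sum by metis
qed

lemma Polygamma_diff_has_sum:
  assumes "n > 0"
  shows "((\<lambda>j::int. inverse ((z + of_int j) ^ Suc n)) has_sum
           ((-1) ^ Suc n / fact n * Polygamma_diff n z)) (- {0})"
proof -
  have 1: "((\<lambda>j::int. inverse ((z + of_int j) ^ Suc n)) has_sum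
           ((-1) ^ Suc n / fact n * Polygamma n (1 + z))) {0<..}"
    by (rule has_sum_reindex_bij_witness[of _ "\<lambda>k. int k + 1" "\<lambda>j. nat (j - 1)",
          THEN iffD2, OF _ _ _ _ _ _ Polygamma_has_sum[OF assms, of "1 + z"]])
       (auto simp: add_ac)
  have "((\<lambda>j::int. (-1) ^ Suc n * inverse ((z + of_int j) ^ Suc n)) has_sum
           ((-1) ^ Suc n / fact n * Polygamma n (1 - z))) {..<0}"
  proof (rule has_sum_reindex_bij_witness[of _ "\<lambda>k. - int k - 1" "\<lambda>j. nat (- j - 1)",
          THEN iffD2, OF _ _ _ _ _ _ Polygamma_has_sum[OF assms, of "1 - z"]])
    fix j :: int assume "j \<in> {..<0}"
    then obtain k where k: "j = - int k - 1" "nat (- j - 1) = k"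
      by (intro that[of "nat (- j - 1)"]) auto
    have "1 - z + of_nat k = - (z + of_int (- int k - 1))" by simp
    hence "(1 - z + of_nat k) ^ Suc n = (-1) ^ Suc n * (z + of_int (- int k - 1)) ^ Suc n"
      by (metis power_minus)
    hence "inverse ((1 - z + of_nat k) ^ Suc n) = inverse ((-1) ^ Suc n) * inverse ((z + of_int j) ^ Suc n)"
      unfolding k(1) by (simp only: inverse_mult_distrib)
    also have "inverse ((-1) ^ Suc n) = ((-1) ^ Suc n :: complex)"
      by (simp only: flip: power_inverse) simp
    finally show "inverse ((1 - z + of_nat (nat (- j - 1))) ^ Suc n) = (-1) ^ Suc n * inverse ((z + of_int j) ^ Suc n)"
      unfolding k(2) .
  qed auto
  from has_sum_cmult_right[OF this, of "(-1) ^ Suc n"]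
  have 2: "((\<lambda>j::int. inverse ((z + of_int j) ^ Suc n)) has_sum
           ((-1) ^ Suc n * ((-1) ^ Suc n / fact n * Polygamma n (1 - z)))) {..<0}"
    by (simp flip: mult.assoc power_mult_distrib)
  have "{0<..} \<union> {..<0} = - {0::int}" by auto
  moreover have "((-1) ^ Suc n * ((-1) ^ Suc n / fact n * Polygamma n (1 - z))) =
      (-1) ^ Suc n / fact n * (- ((-1) ^ n * Polygamma n (1 - z)))"
    by simp
  moreover have "{0<..} \<inter> {..<0} = ({} :: int set)" by auto
  ultimately show ?thesis
    using has_sum_Un_disjoint[OF 1 2] unfolding Polygamma_diff_def
    by (simp only: distrib_left [symmetric] diff_conv_add_uminus)
qed

lemma Polygamma_diff_deriv:
  assumes "1 + z \<notin> \<int>\<^sub>\<le>\<^sub>0" "1 - z \<notin> \<int>\<^sub>\<le>\<^sub>0"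
  shows "(Polygamma_diff n has_field_derivative Polygamma_diff (Suc n) z) (at z)"
  unfolding Polygamma_diff_def using assms
  by (auto intro!: derivative_eq_intros simp: algebra_simps)

text \<open>Differentiating the reflection formula for \<open>rGamma\<close> gives
  \<open>Digamma (1 - z) - Digamma z = pi cot(pi z)\<close>; the cotangent is then written in terms
  of \<open>exp(2 pi \<i> z)\<close>.\<close>

lemma Polygamma_diff_0:
  assumes z: "z \<notin> \<int>"
  shows "Polygamma_diff 0 z = 1 / z - pi * \<i> - 2 * pi * \<i> / (exp (2 * pi * \<i> * z) - 1)"
proof -
  have "1 - z \<notin> \<int>"
  proof
    assume "1 - z \<in> \<int>"
    from Ints_diff[OF Ints_1 this] show False using z by simp
  qed
  hence z': "z \<notin> \<int>\<^sub>\<le>\<^sub>0" "1 - z \<notin> \<int>\<^sub>\<le>\<^sub>0" "z \<noteq> 0"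
    using z nonpos_Ints_Int by auto
  have "((\<lambda>z. rGamma z * rGamma (1 - z)) has_field_derivative
          (- rGamma z * Digamma z) * rGamma (1 - z) + rGamma z * (rGamma (1 - z) * Digamma (1 - z))) (at z)"
    using z' by (auto intro!: derivative_eq_intros simp: algebra_simps)
  moreover have "((\<lambda>z. rGamma z * rGamma (1 - z)) has_field_derivative cos (pi * z)) (at z)"
    unfolding rGamma_reflection_complex by (auto intro!: derivative_eq_intros)
  ultimately have "(- rGamma z * Digamma z) * rGamma (1 - z) + rGamma z * (rGamma (1 - z) * Digamma (1 - z)) = cos (pi * z)"
    by (rule DERIV_unique)
  hence "(rGamma z * rGamma (1 - z)) * (Digamma (1 - z) - Digamma z) = cos (pi * z)"
    by (simp add: algebra_simps)
  hence *: "sin (pi * z) * (Digamma (1 - z) - Digamma z) = pi * cos (pi * z)"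
    unfolding rGamma_reflection_complex by (simp add: field_simps)
  define e where "e = exp (\<i> * (pi * z))"
  have e0: "e \<noteq> 0" by (simp add: e_def)
  have s: "sin (pi * z) = (e - 1 / e) / (2 * \<i>)" "cos (pi * z) = (e + 1 / e) / 2"
    unfolding sin_exp_eq cos_exp_eq exp_minus e_def [symmetric] inverse_eq_divide by (rule refl)+
  have e2: "exp (2 * pi * \<i> * z) = e ^ 2"
    using exp_double[of "\<i> * (pi * z)"] unfolding e_def by (simp only: of_real_mult of_real_numeral mult_ac)
  have "e ^ 2 \<noteq> 1"
  proof
    assume "e ^ 2 = 1"
    hence "exp (2 * pi * \<i> * z) = 1" using e2 by simp
    then obtain n :: int where "Im (2 * pi * \<i> * z) = of_int (2 * n) * pi" "Re (2 * pi * \<i> * z) = 0"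
      unfolding exp_eq_1 by blast
    hence "z = of_int n" by (simp add: complex_eq_iff)
    thus False using z by simp
  qed
  hence ne: "e ^ 2 - 1 \<noteq> 0" by simp
  define d where "d = Digamma (1 - z) - Digamma z"
  have "2 * \<i> * e * ((e - 1 / e) / (2 * \<i>) * d) = 2 * \<i> * e * (pi * ((e + 1 / e) / 2))"
    using * unfolding s d_def by (rule arg_cong)
  also have "2 * \<i> * e * ((e - 1 / e) / (2 * \<i>) * d) = (e ^ 2 - 1) * d"
    using e0 by (simp add: field_simps power2_eq_square)
  also have "2 * \<i> * e * (pi * ((e + 1 / e) / 2)) = \<i> * pi * (e ^ 2 + 1)"
  proof -
    have "e * (e + 1 / e) = e ^ 2 + 1"
      using e0 by (simp add: distrib_left power2_eq_square)
    moreover have "2 * \<i> * a * (b * (x / 2)) = \<i> * b * (a * x)" for a b x :: complex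
      by simp
    ultimately show ?thesis by metis
  qed
  finally have "d = \<i> * pi * (e ^ 2 + 1) / (e ^ 2 - 1)"
    using ne by (simp add: eq_divide_eq mult.commute)
  hence "Digamma z - Digamma (1 - z) = - \<i> * pi * (e ^ 2 + 1) / (e ^ 2 - 1)"
    unfolding d_def by (metis minus_diff_eq minus_divide_left minus_mult_left)
  also have "\<dots> = - pi * \<i> - 2 * pi * \<i> / (e ^ 2 - 1)"
    using ne by (simp add: divide_simps) (simp add: algebra_simps)
  finally have "Digamma z - Digamma (1 - z) = - pi * \<i> - 2 * pi * \<i> / (e ^ 2 - 1)" .
  moreover have "Digamma (1 + z) = Digamma z + 1 / z"
    using Digamma_plus1[OF z'(3)] by (simp add: add.commute)
  ultimately show ?thesis
    unfolding Polygamma_diff_def e2 by simp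
qed

text \<open>With \<open>q = exp(2 pi \<i> z)\<close> this is the expansion of the
  \<open>n\<close>-th derivative of \<open>-pi cot(pi z)\<close> on the upper half plane; only
  \<open>n = 0\<close> has a constant term.\<close>

definition lipschitz_fps :: "nat \<Rightarrow> complex fps" where
  "lipschitz_fps n = Abs_fps (\<lambda>m. if m = 0 then (if n = 0 then pi * \<i> else 0)
      else (2 * pi * \<i>) ^ Suc n * of_nat m ^ n)"

text \<open>Differentiation in \<open>z\<close> acts on expansions as
  \<open>2 pi \<i> q d/dq\<close>.\<close>

lemma lipschitz_fps_Suc:
  "lipschitz_fps (Suc n) = fps_const (2 * pi * \<i>) * fps_X * fps_deriv (lipschitz_fps n)"
proof (rule fps_ext)
  fix m
  show "fps_nth (lipschitz_fps (Suc n)) m =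
     fps_nth (fps_const (2 * pi * \<i>) * fps_X * fps_deriv (lipschitz_fps n)) m"
    by (cases m) (simp_all add: lipschitz_fps_def mult.assoc)
qed

lemma lipschitz_fps_0_sums:
  assumes "norm q < 1"
  shows "(\<lambda>m. fps_nth (lipschitz_fps 0) m * q ^ m) sums (- pi * \<i> - 2 * pi * \<i> / (q - 1))"
proof -
  have q: "q - 1 \<noteq> 0" using assms by auto
  have "(\<lambda>m. 2 * pi * \<i> * q ^ m) sums (2 * pi * \<i> * (1 / (1 - q)))"
    by (intro sums_mult geometric_sums assms)
  hence "(\<lambda>m. (if m = 0 then - pi * \<i> else 0) + 2 * pi * \<i> * q ^ m) sums
      (- pi * \<i> + 2 * pi * \<i> * (1 / (1 - q)))"
    by (intro sums_add) (use sums_single[of 0 "\<lambda>_. - pi * \<i>"] in simp_all)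
  also have "(\<lambda>m. (if m = 0 then - pi * \<i> else 0) + 2 * pi * \<i> * q ^ m) =
     (\<lambda>m. fps_nth (lipschitz_fps 0) m * q ^ m)"
    by (auto simp: lipschitz_fps_def fun_eq_iff)
  also have "(- pi * \<i> + 2 * pi * \<i> * (1 / (1 - q))) = - pi * \<i> - 2 * pi * \<i> / (q - 1)"
    using q by (simp add: field_simps)
  finally show ?thesis .
qed

lemma fps_conv_radius_geI:
  fixes A :: "complex fps"
  assumes "\<And>r. 0 < r \<Longrightarrow> r < 1 \<Longrightarrow> summable (\<lambda>m. fps_nth A m * of_real r ^ m)"
  shows "fps_conv_radius A \<ge> 1"
  unfolding fps_conv_radius_def
proof (rule conv_radius_geI_ex)
  fix r :: real assume "0 < r" "ereal r < 1"
  thus "\<exists>z. norm z = r \<and> summable (\<lambda>n. fps_nth A n * z ^ n)"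
    using assms[of r] by (intro exI[of _ "of_real r"]) auto
qed

lemma lipschitz_fps_radius: "fps_conv_radius (lipschitz_fps n) \<ge> 1"
proof (induction n)
  case 0
  show ?case
    by (intro fps_conv_radius_geI sums_summable[OF lipschitz_fps_0_sums]) auto
next
  case (Suc n)
  have "1 \<le> fps_conv_radius (fps_deriv (lipschitz_fps n))"
    using Suc fps_conv_radius_deriv order_trans by blast
  also have "\<dots> \<le> fps_conv_radius (fps_const (2 * pi * \<i>) * fps_X * fps_deriv (lipschitz_fps n))"
    by (rule order_trans[OF _ fps_conv_radius_mult])
       (use fps_conv_radius_mult[of "fps_const (2 * pi * \<i>)" "fps_X :: complex fps"] in simp)
  finally show ?case by (simp add: lipschitz_fps_Suc)
qed

lemma eval_fps_const_X_mult:
  fixes A :: "complex fps"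
  assumes "norm q < fps_conv_radius A"
  shows "eval_fps (fps_const c * fps_X * A) q = c * q * eval_fps A q"
proof -
  have "eval_fps (fps_const c * (fps_X * A)) q = c * eval_fps (fps_X * A) q"
    by (subst eval_fps_mult)
       (use assms fps_conv_radius_mult[of "fps_X :: complex fps" A] in \<open>auto intro: less_le_trans\<close>)
  also have "eval_fps (fps_X * A) q = q * eval_fps A q"
    by (subst eval_fps_mult) (use assms in auto)
  finally show ?thesis by (simp add: mult.assoc)
qed

lemma norm_q_less_1: "Im z > 0 \<Longrightarrow> norm (exp (2 * pi * \<i> * z)) < 1"
  by (simp add: norm_exp_eq_Re)

lemma upper_half_not_Ints: "Im z > 0 \<Longrightarrow> z \<notin> \<int>"
  by (auto elim!: Ints_cases)

text \<open>The case \<open>n = 0\<close> is the cotangent identity, and the others follow by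
  differentiating it on the open upper half plane. The polar term is the \<open>n\<close>-th
  derivative of \<open>1/z\<close>.\<close>

lemma Polygamma_diff_upper_half:
  assumes "Im z > 0"
  shows "Polygamma_diff n z = (-1) ^ n * fact n / z ^ Suc n + eval_fps (lipschitz_fps n) (exp (2 * pi * \<i> * z))"
  using assms
proof (induction n arbitrary: z)
  case 0
  have "eval_fps (lipschitz_fps 0) (exp (2 * pi * \<i> * z)) = - pi * \<i> - 2 * pi * \<i> / (exp (2 * pi * \<i> * z) - 1)"
    using lipschitz_fps_0_sums[OF norm_q_less_1[OF 0]] by (simp add: eval_fps_def sums_iff)
  thus ?case using Polygamma_diff_0[OF upper_half_not_Ints[OF 0]] by simp
next
  case (Suc n)
  have z: "1 + z \<notin> \<int>\<^sub>\<le>\<^sub>0" "1 - z \<notin> \<int>\<^sub>\<le>\<^sub>0" "z \<noteq> 0"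
    using Suc.prems by (auto elim!: nonpos_Ints_cases simp: complex_eq_iff)
  have r: "exp (2 * pi * \<i> * z) \<in> eball 0 (fps_conv_radius (lipschitz_fps n))"
    "exp (2 * pi * \<i> * z) \<in> eball 0 (fps_conv_radius (fps_deriv (lipschitz_fps n)))"
  proof -
    have "ereal (norm (exp (2 * pi * \<i> * z))) < 1"
      using norm_q_less_1[OF Suc.prems] by simp
    moreover have "1 \<le> fps_conv_radius (fps_deriv (lipschitz_fps n))"
      using lipschitz_fps_radius[of n] fps_conv_radius_deriv[of "lipschitz_fps n"] by (rule order_trans)
    ultimately show "exp (2 * pi * \<i> * z) \<in> eball 0 (fps_conv_radius (lipschitz_fps n))"
      "exp (2 * pi * \<i> * z) \<in> eball 0 (fps_conv_radius (fps_deriv (lipschitz_fps n)))"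
      using lipschitz_fps_radius[of n] unfolding in_eball_iff dist_0_norm by (metis less_le_trans)+
  qed
  have "((\<lambda>z. (-1) ^ n * fact n * inverse (z ^ Suc n) + eval_fps (lipschitz_fps n) (exp (2 * pi * \<i> * z)))
      has_field_derivative
        (-1) ^ Suc n * fact (Suc n) / z ^ Suc (Suc n) +
        eval_fps (fps_deriv (lipschitz_fps n)) (exp (2 * pi * \<i> * z)) * (2 * pi * \<i> * exp (2 * pi * \<i> * z))) (at z)"
  proof (rule DERIV_add)
    show "((\<lambda>z. (-1) ^ n * fact n * inverse (z ^ Suc n)) has_field_derivative
        (-1) ^ Suc n * fact (Suc n) / z ^ Suc (Suc n)) (at z)"
    proof -
      have "((\<lambda>z. inverse (z ^ Suc n)) has_field_derivative
          - (inverse (z ^ Suc n) * (of_nat (Suc n) * z ^ n) * inverse (z ^ Suc n))) (at z)"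
        using DERIV_inverse'[OF DERIV_power_Suc[OF DERIV_ident, of n], of z UNIV] z
        by (simp del: power_Suc add: algebra_simps)
      from DERIV_cmult[OF this, of "(-1) ^ n * fact n"] show ?thesis
        using z by (simp add: divide_simps mult_ac)
    qed
    show "((\<lambda>z. eval_fps (lipschitz_fps n) (exp (2 * pi * \<i> * z))) has_field_derivative
       eval_fps (fps_deriv (lipschitz_fps n)) (exp (2 * pi * \<i> * z)) * (2 * pi * \<i> * exp (2 * pi * \<i> * z))) (at z)"
      by (rule DERIV_chain2[OF has_field_derivative_eval_fps])
        (use r in \<open>auto intro!: derivative_eq_intros\<close>)
  qed
  also have "eval_fps (fps_deriv (lipschitz_fps n)) (exp (2 * pi * \<i> * z)) * (2 * pi * \<i> * exp (2 * pi * \<i> * z)) =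
      eval_fps (lipschitz_fps (Suc n)) (exp (2 * pi * \<i> * z))"
    unfolding lipschitz_fps_Suc using r by (subst eval_fps_const_X_mult) (simp_all add: in_eball_iff)
  finally have D: "((\<lambda>z. (-1) ^ n * fact n * inverse (z ^ Suc n) + eval_fps (lipschitz_fps n) (exp (2 * pi * \<i> * z)))
      has_field_derivative (-1) ^ Suc n * fact (Suc n) / z ^ Suc (Suc n) +
        eval_fps (lipschitz_fps (Suc n)) (exp (2 * pi * \<i> * z))) (at z)" .
  have "eventually (\<lambda>w. w \<in> {w. Im w > 0}) (nhds z)"
    using Suc.prems by (intro eventually_nhds_in_open) (auto simp: open_halfspace_Im_gt)
  hence "eventually (\<lambda>w. (-1) ^ n * fact n * inverse (w ^ Suc n) + eval_fps (lipschitz_fps n) (exp (2 * pi * \<i> * w)) = Polygamma_diff n w) (nhds z)"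
    by eventually_elim (use Suc.IH in \<open>simp add: divide_inverse\<close>)
  from D this have "(Polygamma_diff n has_field_derivative (-1) ^ Suc n * fact (Suc n) / z ^ Suc (Suc n) +
        eval_fps (lipschitz_fps (Suc n)) (exp (2 * pi * \<i> * z))) (at z)"
    by (subst (asm) DERIV_cong_ev) auto
  from DERIV_unique[OF Polygamma_diff_deriv[OF z(1,2)] this] show ?case .
qed

theorem lipschitz_formula:
  assumes "Im z > 0" "n > 0"
  shows "((\<lambda>j::int. inverse ((z + of_int j) ^ Suc n)) has_sum
     ((-1) ^ Suc n / fact n * eval_fps (lipschitz_fps n) (exp (2 * pi * \<i> * z)))) UNIV"
proof -
  have z: "z \<noteq> 0" using assms by auto
  have "((\<lambda>j::int. inverse ((z + of_int j) ^ Suc n)) has_sum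
     ((-1) ^ Suc n / fact n * Polygamma_diff n z + inverse (z ^ Suc n))) (- {0} \<union> {0})"
    by (rule has_sum_Un_disjoint[OF Polygamma_diff_has_sum[OF assms(2)]])
       (auto intro!: has_sum_finiteI)
  also have "- {0} \<union> {0::int} = UNIV" by auto
  \<comment> \<open>The summand \<open>j = 0\<close> cancels the polar term of
    \<open>Polygamma_diff_upper_half\<close>.\<close>
  also have "(-1) ^ Suc n / fact n * Polygamma_diff n z + inverse (z ^ Suc n) =
      (-1) ^ Suc n / fact n * eval_fps (lipschitz_fps n) (exp (2 * pi * \<i> * z))"
  proof -
    have "(-1) ^ Suc n / fact n * Polygamma_diff n z =
      ((-1) ^ Suc n * (-1) ^ n) / z ^ Suc n + (-1) ^ Suc n / fact n * eval_fps (lipschitz_fps n) (exp (2 * pi * \<i> * z))"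
      unfolding Polygamma_diff_upper_half[OF assms(1)] by (simp add: algebra_simps)
    also have "((-1) ^ Suc n * (-1) ^ n :: complex) = -1" by (simp flip: power_mult_distrib)
    finally show ?thesis by (simp add: divide_inverse)
  qed
  finally show ?thesis .
qed

section \<open>Bernoulli numbers\<close>

text \<open>The shifted exponential is \<open>(e^x - 1)/x\<close>, with constant term 1, so this is
  \<open>x/(e^x - 1)\<close>. In this convention the first Bernoulli number is -1/2.\<close>

definition bernoulli_fps :: "complex fps" where
  "bernoulli_fps = inverse (fps_shift 1 (fps_exp 1))"

definition bernoulli :: "nat \<Rightarrow> complex" where
  "bernoulli n = fact n * fps_nth bernoulli_fps n"

lemma bernoulli_fps_mult: "bernoulli_fps * fps_shift 1 (fps_exp 1) = 1"
  unfolding bernoulli_fps_def by (rule inverse_mult_eq_1) simp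

lemma bernoulli_fps_mult': "bernoulli_fps * (fps_exp 1 - 1) = fps_X"
proof -
  have "fps_exp 1 - 1 = fps_shift 1 (fps_exp 1) * (fps_X :: complex fps)"
    by (rule fps_ext) (simp add: fps_X_mult_right_nth)
  thus ?thesis by (metis bernoulli_fps_mult mult.assoc mult_1)
qed

lemma Polygamma_diff_higher_deriv:
  assumes "norm z < 1"
  shows "(deriv ^^ n) (Polygamma_diff 0) z = Polygamma_diff n z"
  using assms
proof (induction n arbitrary: z)
  case (Suc n)
  have z: "1 + z \<notin> \<int>\<^sub>\<le>\<^sub>0" "1 - z \<notin> \<int>\<^sub>\<le>\<^sub>0"
  proof -
    have "Re z > -1" "Re z < 1" using Suc.prems abs_Re_le_cmod[of z] by auto
    thus "1 + z \<notin> \<int>\<^sub>\<le>\<^sub>0" "1 - z \<notin> \<int>\<^sub>\<le>\<^sub>0"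
      by (auto elim!: nonpos_Ints_cases simp: complex_eq_iff)
  qed
  have "eventually (\<lambda>w. w \<in> ball 0 1) (nhds z)"
    using Suc.prems by (intro eventually_nhds_in_open) auto
  hence "eventually (\<lambda>w. (deriv ^^ n) (Polygamma_diff 0) w = Polygamma_diff n w) (nhds z)"
    by eventually_elim (use Suc.IH in auto)
  hence "deriv ((deriv ^^ n) (Polygamma_diff 0)) z = deriv (Polygamma_diff n) z"
    by (intro deriv_cong_ev) auto
  also have "\<dots> = Polygamma_diff (Suc n) z"
    by (intro DERIV_imp_deriv Polygamma_diff_deriv z)
  finally show ?case by simp
qed auto

text \<open>Euler's formula for zeta values. The cotangent identity is multiplied by
  \<open>z * (exp(c z) - 1)\<close>, which removes the singularities at 0, and the resulting power
  series are compared with \<open>x/(e^x - 1)\<close> at \<open>x = c z\<close>.\<close>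

lemma Polygamma_diff_at_0:
  "Polygamma_diff (Suc n) 0 = - ((2 * pi * \<i>) ^ (n + 2)) * fps_nth bernoulli_fps (n + 2) * fact (Suc n)"
proof -
  define c where "c = 2 * pi * \<i>"
  define F where "F = fps_expansion (Polygamma_diff 0) 0"
  define W where "W = fps_exp c - 1"
  define B where "B = bernoulli_fps oo (fps_const c * fps_X)"
  have c0: "c \<noteq> 0" by (simp add: c_def)
  have ball: "1 + z \<notin> \<int>\<^sub>\<le>\<^sub>0" "1 - z \<notin> \<int>\<^sub>\<le>\<^sub>0" if "norm z < 1" for z :: complex
  proof -
    have "Re z > -1" "Re z < 1" using that abs_Re_le_cmod[of z] by auto
    thus "1 + z \<notin> \<int>\<^sub>\<le>\<^sub>0" "1 - z \<notin> \<int>\<^sub>\<le>\<^sub>0"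
      by (auto elim!: nonpos_Ints_cases simp: complex_eq_iff)
  qed
  have "Polygamma_diff 0 holomorphic_on ball 0 1"
  proof (rule holomorphic_onI)
    fix z :: complex assume "z \<in> ball 0 1"
    hence "(Polygamma_diff 0 has_field_derivative Polygamma_diff (Suc 0) z) (at z)"
      by (intro Polygamma_diff_deriv ball) auto
    thus "Polygamma_diff 0 field_differentiable at z within ball 0 1"
      using field_differentiable_at_within field_differentiable_def by blast
  qed
  hence F: "Polygamma_diff 0 has_fps_expansion F"
    unfolding F_def by (intro has_fps_expansion_fps_expansion[of "ball 0 1"]) auto
  have Fn: "fps_nth F n = Polygamma_diff n 0 / fact n" for n
    unfolding fps_nth_fps_expansion[OF F] by (subst Polygamma_diff_higher_deriv) auto
  have ez: "(\<lambda>z. exp (c * z)) has_fps_expansion fps_exp c"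
    by (rule has_fps_expansion_exp)
  have L: "(\<lambda>z. Polygamma_diff 0 z * z * (exp (c * z) - 1)) has_fps_expansion F * fps_X * W"
    unfolding W_def by (intro has_fps_expansion_mult F has_fps_expansion_fps_X has_fps_expansion_diff ez has_fps_expansion_1)
  have R: "(\<lambda>z. (1 - pi * \<i> * z) * (exp (c * z) - 1) - c * z) has_fps_expansion
      (1 - fps_const (pi * \<i>) * fps_X) * W - fps_const c * fps_X"
    unfolding W_def by (intro has_fps_expansion_mult has_fps_expansion_fps_X has_fps_expansion_diff ez
        has_fps_expansion_1 has_fps_expansion_const)
  have "eventually (\<lambda>z::complex. z \<in> ball 0 1) (nhds 0)"
    by (intro eventually_nhds_in_open) auto
  hence "eventually (\<lambda>z. Polygamma_diff 0 z * z * (exp (c * z) - 1) = (1 - pi * \<i> * z) * (exp (c * z) - 1) - c * z) (nhds 0)"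
  proof eventually_elim
    case (elim z)
    show ?case
    proof (cases "z = 0")
      case False
      have "z \<notin> \<int>"
      proof
        assume "z \<in> \<int>"
        then obtain m where "z = of_int m" by (auto elim: Ints_cases)
        thus False using elim False by simp
      qed
      moreover from this have "exp (c * z) - 1 \<noteq> 0"
      proof -
        have "exp (c * z) \<noteq> 1"
        proof
          assume "exp (c * z) = 1"
          then obtain m :: int where "Im (c * z) = of_int (2 * m) * pi" "Re (c * z) = 0"
            unfolding exp_eq_1 by blast
          hence "z = of_int m" by (simp add: complex_eq_iff c_def)
          thus False using \<open>z \<notin> \<int>\<close> by simp
        qed
        thus ?thesis by simp
      qed
      ultimately show ?thesis
        using Polygamma_diff_0[of z] False unfolding c_def [symmetric]
        by (simp add: divide_simps) (simp add: algebra_simps)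
    qed auto
  qed
  with L have "(\<lambda>z. (1 - pi * \<i> * z) * (exp (c * z) - 1) - c * z) has_fps_expansion F * fps_X * W"
    by (subst (asm) has_fps_expansion_cong) auto
  from fps_expansion_unique_complex[OF this R]
  have 1: "F * fps_X * W = (1 - fps_const (pi * \<i>) * fps_X) * W - fps_const c * fps_X" .
  have W': "W = (fps_exp 1 - 1) oo (fps_const c * fps_X)"
    by (simp add: W_def fps_compose_sub_distrib)
  have "B * W = (bernoulli_fps * (fps_exp 1 - 1)) oo (fps_const c * fps_X)"
    unfolding B_def W' by (subst fps_compose_mult_distrib) auto
  hence BW: "B * W = fps_const c * fps_X"
    by (simp add: bernoulli_fps_mult')
  have "W \<noteq> 0" using c0 by (auto simp: W_def fps_eq_iff intro!: exI[of _ 1])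
  moreover have "(F * fps_X - (1 - fps_const (pi * \<i>) * fps_X - B)) * W = 0"
    using 1 BW by (simp add: left_diff_distrib)
  ultimately have "F * fps_X = 1 - fps_const (pi * \<i>) * fps_X - B" by simp
  \<comment> \<open>From degree 2 on, the polynomial part \<open>1 - pi \<i> x\<close> does not
    contribute.\<close>
  hence "fps_nth (F * fps_X) (n + 2) = fps_nth (1 - fps_const (pi * \<i>) * fps_X - B) (n + 2)" by simp
  hence "fps_nth F (Suc n) = - (c ^ (n + 2)) * fps_nth bernoulli_fps (n + 2)"
    by (simp add: B_def fps_compose_linear fps_X_mult_right_nth)
  moreover have "Polygamma_diff (Suc n) 0 = fps_nth F (Suc n) * fact (Suc n)"
    unfolding Fn by (simp del: fact_Suc)
  ultimately show ?thesis unfolding c_def by simp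
qed

lemma bernoulli_0 [simp]: "bernoulli 0 = 1"
  by (simp add: bernoulli_def bernoulli_fps_def)

text \<open>Compares the coefficients of \<open>x^n\<close> in the product of
  \<open>x/(e^x - 1)\<close> and \<open>(e^x - 1)/x\<close>.\<close>

lemma bernoulli_recurrence:
  assumes "n > 0"
  shows "(\<Sum>i\<le>n. of_nat (Suc n choose i) * bernoulli i) = 0"
proof -
  have "(\<Sum>i\<le>n. of_nat (Suc n choose i) * bernoulli i) =
      fact (Suc n) * (\<Sum>i\<le>n. fps_nth bernoulli_fps i / fact (Suc n - i))"
    unfolding sum_distrib_left
  proof (rule sum.cong)
    fix i assume "i \<in> {..n}"
    hence "(of_nat (Suc n choose i) :: complex) = fact (Suc n) / (fact i * fact (Suc n - i))"
      by (intro binomial_fact) auto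
    thus "of_nat (Suc n choose i) * bernoulli i = fact (Suc n) * (fps_nth bernoulli_fps i / fact (Suc n - i))"
      by (simp add: bernoulli_def)
  qed auto
  also have "(\<Sum>i\<le>n. fps_nth bernoulli_fps i / fact (Suc n - i)) =
      fps_nth (bernoulli_fps * fps_shift 1 (fps_exp 1)) n"
    by (auto simp: fps_mult_nth atLeast0AtMost Suc_diff_le simp del: fact_Suc intro!: sum.cong)
  also have "\<dots> = 0" using assms by (simp add: bernoulli_fps_mult del: One_nat_def)
  finally show ?thesis by simp
qed

text \<open>For \<open>p = 2\<close> and \<open>p = 3\<close> the weight \<open>p - 1\<close> is too
  small for an Eisenstein series, and weight 4 takes its place.\<close>

lemma bernoulli_4: "bernoulli 4 = -1/30"
proof -
  have 1: "bernoulli (Suc 0) = -1/2"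
    using bernoulli_recurrence[of 1] by (simp add: field_simps eval_nat_numeral add_eq_0_iff)
  have 2: "bernoulli (Suc (Suc 0)) = 1/6"
    using bernoulli_recurrence[of 2] by (simp add: 1 eval_nat_numeral eq_divide_eq mult.commute)
  have 3: "bernoulli (Suc (Suc (Suc 0))) = 0"
    using bernoulli_recurrence[of 3] by (simp add: 1 2 eval_nat_numeral)
  have "5 * bernoulli 4 = - (1 / 6)"
    using bernoulli_recurrence[of 4] by (simp add: 1 2 3 eval_nat_numeral add_eq_0_iff)
  moreover have "bernoulli 4 = (5 * bernoulli 4) / 5" by simp
  ultimately show ?thesis by simp
qed

text \<open>Membership in the localisation of the integers at \<open>p\<close>, expressed inside the
  complex numbers.\<close>

definition p_integral :: "nat \<Rightarrow> complex \<Rightarrow> bool" where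
  "p_integral p x \<longleftrightarrow> (\<exists>d u :: int. coprime d (int p) \<and> of_int d * x = of_int u)"

lemma p_integral_of_int: "p_integral p (of_int k)"
  unfolding p_integral_def by (rule exI[of _ 1]) auto

lemma p_integral_add:
  assumes "p_integral p x" "p_integral p y"
  shows "p_integral p (x + y)"
proof -
  from assms obtain d u e v :: int where "coprime d (int p)" "of_int d * x = of_int u"
    "coprime e (int p)" "of_int e * y = of_int v" unfolding p_integral_def by blast
  moreover from this have "of_int (d * e) * (x + y) = of_int (e * u + d * v)"
    by (simp add: algebra_simps flip: mult.assoc)
  ultimately show ?thesis unfolding p_integral_def by (metis coprime_mult_left_iff)
qed

lemma p_integral_mult_int:
  assumes "p_integral p x"
  shows "p_integral p (of_int k * x)"
proof -
  from assms obtain d u :: int where "coprime d (int p)" "of_int d * x = of_int u"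
    unfolding p_integral_def by blast
  moreover from this have "of_int d * (of_int k * x) = of_int (k * u)"
    by (metis mult.left_commute of_int_mult)
  ultimately show ?thesis unfolding p_integral_def by blast
qed

lemma p_integral_sum:
  "(\<And>i. i \<in> Y \<Longrightarrow> p_integral p (f i)) \<Longrightarrow> p_integral p (sum f Y)"
proof (induction Y rule: infinite_finite_induct)
  case (insert x F)
  thus ?case by (simp add: p_integral_add)
qed (use p_integral_of_int[of p 0] in auto)

lemma p_integral_cancel:
  assumes "p_integral p (of_int k * x)" "coprime k (int p)"
  shows "p_integral p x"
proof -
  from assms obtain d u :: int where "coprime d (int p)" "of_int d * (of_int k * x) = of_int u"
    unfolding p_integral_def by blast
  thus ?thesis using assms(2) unfolding p_integral_def
    by (intro exI[of _ "d * k"] exI[of _ u]) (simp add: mult.assoc)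
qed

text \<open>The recurrence for the \<open>n\<close>-th number divides only by \<open>n + 1\<close>,
  which is less than \<open>p\<close>.\<close>

lemma p_integral_bernoulli:
  assumes "Factorial_Ring.prime p" "n < p - 1"
  shows "p_integral p (bernoulli n)"
  using assms(2)
proof (induction n rule: less_induct)
  case (less n)
  show ?case
  proof (cases "n = 0")
    case True
    thus ?thesis using p_integral_of_int[of p 1] by simp
  next
    case False
    have "(\<Sum>i<n. of_nat (Suc n choose i) * bernoulli i) + of_nat (Suc n) * bernoulli n = 0"
      using bernoulli_recurrence[of n] False by (simp add: lessThan_Suc_atMost [symmetric])
    hence "of_int (int (Suc n)) * bernoulli n = (\<Sum>i<n. of_int (- int (Suc n choose i)) * bernoulli i)"
      by (simp add: sum_negf add_eq_0_iff)
    also have "p_integral p \<dots>"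
      using less by (intro p_integral_sum p_integral_mult_int) auto
    finally have "p_integral p (of_int (int (Suc n)) * bernoulli n)" .
    moreover have "coprime (int (Suc n)) (int p)"
    proof -
      have "\<not> p dvd Suc n" using less.prems by (auto dest: dvd_imp_le)
      hence "coprime p (Suc n)" using assms(1) prime_imp_coprime by blast
      thus ?thesis by (metis coprime_commute coprime_int_iff)
    qed
    ultimately show ?thesis by (rule p_integral_cancel)
  qed
qed

text \<open>A case of the von Staudt--Clausen theorem. In the recurrence of length \<open>p\<close>
  the inner binomial coefficients are divisible by \<open>p\<close> and the earlier numbers are
  \<open>p\<close>-integral, so \<open>p * bernoulli (p - 1)\<close> is -1 modulo \<open>p\<close>.
  Thus \<open>p\<close> sits in the denominator of \<open>bernoulli (p - 1)\<close> and in the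
  numerator of its reciprocal.\<close>

lemma bernoulli_prime_minus_1:
  assumes p: "Factorial_Ring.prime p" "p \<ge> 3"
  shows "bernoulli (p - 1) \<noteq> 0"
    "\<exists>D u :: int. coprime D (int p) \<and> of_int D * (of_nat (2 * (p - 1)) / bernoulli (p - 1)) = of_int (int p * u)"
proof -
  define y where "y = (\<Sum>i\<in>{1..<p - 1}. of_nat ((p choose i) div p) * bernoulli i)"
  have "p_integral p (\<Sum>i\<in>{1..<p - 1}. of_int (int ((p choose i) div p)) * bernoulli i)"
    by (intro p_integral_sum p_integral_mult_int p_integral_bernoulli p) auto
  hence "p_integral p y" by (simp add: y_def)
  then obtain d u :: int where d: "coprime d (int p)" "of_int d * y = of_int u"
    unfolding p_integral_def by blast
  have "(\<Sum>i\<le>p - 1. of_nat (Suc (p - 1) choose i) * bernoulli i) = 0"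
    using p by (intro bernoulli_recurrence) auto
  also have "{..p - 1} = insert 0 (insert (p - 1) {1..<p - 1})" using p by auto
  also have "(\<Sum>i\<in>\<dots>. of_nat (Suc (p - 1) choose i) * bernoulli i) =
      1 + (of_nat p * bernoulli (p - 1) + (\<Sum>i\<in>{1..<p - 1}. of_nat (p choose i) * bernoulli i))"
  proof -
    have "p choose (p - 1) = p" using p binomial_symmetric[of "p - 1" p] by simp
    thus ?thesis using p by (subst sum.insert; simp)
  qed
  also have "(\<Sum>i\<in>{1..<p - 1}. of_nat (p choose i) * bernoulli i) = of_nat p * y"
    unfolding y_def sum_distrib_left
  proof (rule sum.cong)
    fix i assume "i \<in> {1..<p - 1}"
    hence "p dvd (p choose i)" using p by (intro dvd_choose_prime) auto
    hence "p choose i = p * ((p choose i) div p)" by simp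
    thus "of_nat (p choose i) * bernoulli i = of_nat p * (of_nat ((p choose i) div p) * bernoulli i)"
      by (metis mult.assoc of_nat_mult)
  qed auto
  finally have *: "of_nat p * bernoulli (p - 1) = - (1 + of_nat p * y)"
    by (simp add: eq_neg_iff_add_eq_0 algebra_simps)
  define v where "v = d + int p * u"
  have "of_int d * (of_nat p * bernoulli (p - 1)) = - (of_int d + of_nat p * (of_int d * y))"
    unfolding * by (simp add: algebra_simps)
  also have "\<dots> = - of_int v" unfolding d(2) v_def by simp
  finally have v: "of_int d * (of_nat p * bernoulli (p - 1)) = - of_int v" .
  have cop: "coprime v (int p)" unfolding v_def using d(1)
    by (metis coprime_iff_gcd_eq_1 gcd.commute gcd_add_mult mult.commute add.commute)
  have "v \<noteq> 0" using cop p by auto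
  thus B0: "bernoulli (p - 1) \<noteq> 0" using v by auto
  have "of_int (- v) * (of_nat (2 * (p - 1)) / bernoulli (p - 1)) = of_int (int p * (d * int (2 * (p - 1))))"
    using B0 unfolding of_int_minus v [symmetric] by (simp add: field_simps)
  moreover have "coprime (- v) (int p)" using cop by simp
  ultimately show "\<exists>D u :: int. coprime D (int p) \<and>
      of_int D * (of_nat (2 * (p - 1)) / bernoulli (p - 1)) = of_int (int p * u)" by blast
qed

section \<open>Eisenstein series of level one\<close>

lemma summable_on_int_inverse_square:
  "(\<lambda>j::int. 1 / (1 + of_int j ^ 2) :: real) summable_on UNIV"
proof -
  have "(\<lambda>j::int. inverse ((0 + of_int j :: complex) ^ Suc 1)) summable_on (- {0})"
    by (rule has_sum_imp_summable[OF Polygamma_diff_has_sum]) simp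
  hence "(\<lambda>j::int. norm (inverse ((0 + of_int j :: complex) ^ Suc 1))) summable_on (- {0})"
    by (rule summable_on_iff_abs_summable_on_complex[THEN iffD1])
  hence "(\<lambda>j::int. norm (1 / (1 + of_int j ^ 2) :: real)) summable_on (- {0})"
  proof (rule Infinite_Sum.abs_summable_on_comparison_test')
    fix j :: int assume "j \<in> - {0}"
    hence "1 / (1 + real_of_int j ^ 2) \<le> 1 / real_of_int j ^ 2"
      by (intro divide_left_mono) (auto intro!: mult_pos_pos add_pos_nonneg)
    also have "\<dots> = norm (inverse ((0 + of_int j :: complex) ^ Suc 1))"
      by (simp add: norm_inverse norm_mult power2_eq_square inverse_eq_divide norm_divide flip: abs_mult)
    finally show "norm (1 / (1 + of_int j ^ 2) :: real) \<le> norm (inverse ((0 + of_int j :: complex) ^ Suc 1))"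
      by simp
  qed
  hence "(\<lambda>j::int. 1 / (1 + of_int j ^ 2) :: real) summable_on (insert 0 (- {0}))"
    by (subst summable_on_insert_iff) simp
  also have "insert 0 (- {0::int}) = UNIV" by auto
  finally show ?thesis .
qed

text \<open>This majorant takes the place of counting lattice points in annuli: over pairs it
  factors into two sums over the integers.\<close>

lemma summable_on_lattice_majorant:
  "(\<lambda>(c, d). 1 / ((1 + of_int c ^ 2) * (1 + of_int d ^ 2)) :: real) summable_on (UNIV :: (int \<times> int) set)"
proof -
  define f where "f = (\<lambda>j::int. 1 / (1 + of_int j ^ 2) :: real)"
  have "(\<lambda>(c, d). f c * f d) summable_on (UNIV \<times> UNIV)"
  proof (rule summable_on_SigmaI)
    fix c :: int
    have "(f has_sum infsum f UNIV) UNIV"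
      using summable_on_int_inverse_square unfolding f_def by (rule has_sum_infsum)
    from has_sum_cmult_right[OF this, of "f c"]
    show "((\<lambda>d. case (c, d) of (c, d) \<Rightarrow> f c * f d) has_sum (f c * infsum f UNIV)) UNIV" by simp
  next
    show "(\<lambda>c. f c * infsum f UNIV) summable_on UNIV"
      using summable_on_int_inverse_square unfolding f_def by (rule summable_on_cmult_left)
  qed (auto simp: f_def)
  thus ?thesis by (simp add: f_def)
qed

text \<open>\<open>K * |c \<tau> + d|\<close> bounds \<open>|c|\<close> through the imaginary part,
  \<open>|d|\<close> through the triangle inequality, and 1 because one of \<open>c\<close>,
  \<open>d\<close> is a nonzero integer. The two quadratic factors together cost a fourth power,
  whence \<open>k \<ge> 4\<close>. For \<open>c = d = 0\<close> the left side is 0, as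
  \<open>inverse 0 = 0\<close>.\<close>

lemma lattice_term_bound:
  fixes \<tau> :: complex and c d :: int
  assumes "Im \<tau> > 0" "k \<ge> 4"
  defines "K \<equiv> 1 + (1 + norm \<tau>) / Im \<tau>"
  shows "norm (inverse ((of_int c * \<tau> + of_int d) ^ k)) \<le>
     4 * K ^ k * (1 / ((1 + of_int c ^ 2) * (1 + of_int d ^ 2)))"
proof (cases "c = 0 \<and> d = 0")
  case True
  have "K \<ge> 0" using assms by (simp add: K_def)
  moreover have "(of_int c * \<tau> + of_int d) ^ k = 0" using True assms by simp
  ultimately show ?thesis by (simp only: inverse_zero norm_zero) simp
next
  case False
  define w where "w = of_int c * \<tau> + of_int d"
  have K1: "1 / Im \<tau> \<le> K" "K > 0" "1 + norm \<tau> / Im \<tau> \<le> K"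
    using assms(1) unfolding K_def by (auto simp: field_simps intro: add_pos_nonneg)
  have Imw: "\<bar>of_int c\<bar> * Im \<tau> \<le> norm w"
    using abs_Im_le_cmod[of w] assms(1) by (simp add: w_def abs_mult)
  hence c1: "\<bar>of_int c\<bar> \<le> norm w / Im \<tau>"
    using assms(1) by (simp add: field_simps)
  also have "\<dots> = (1 / Im \<tau>) * norm w" by simp
  also have "\<dots> \<le> K * norm w" by (intro mult_right_mono K1) auto
  finally have c: "\<bar>real_of_int c\<bar> \<le> K * norm w" .
  have "\<bar>real_of_int d\<bar> = norm (w - of_int c * \<tau>)" by (simp add: w_def norm_of_int)
  also have "\<dots> \<le> norm w + \<bar>of_int c\<bar> * norm \<tau>"
    using norm_triangle_ineq4[of w "of_int c * \<tau>"] by (simp add: norm_mult)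
  also have "\<dots> \<le> norm w + norm w / Im \<tau> * norm \<tau>"
    by (intro add_left_mono mult_right_mono c1) auto
  also have "\<dots> = (1 + norm \<tau> / Im \<tau>) * norm w" by (simp add: algebra_simps)
  also have "\<dots> \<le> K * norm w" by (intro mult_right_mono K1) auto
  finally have d: "\<bar>real_of_int d\<bar> \<le> K * norm w" .
  have one: "1 \<le> K * norm w"
  proof (cases "c = 0")
    case True
    hence "1 \<le> \<bar>real_of_int d\<bar>" using False by auto
    thus ?thesis using d by simp
  next
    case False
    hence "1 \<le> \<bar>real_of_int c\<bar>" by auto
    thus ?thesis using c by simp
  qed
  have sq: "1 + of_int c ^ 2 \<le> 2 * (K * norm w) ^ 2" "1 + of_int d ^ 2 \<le> 2 * (K * norm w) ^ 2"
    using power_mono[OF c, of 2] power_mono[OF d, of 2] power_mono[OF one, of 2] by auto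
  have "(1 + of_int c ^ 2) * (1 + of_int d ^ 2) \<le> (2 * (K * norm w) ^ 2) * (2 * (K * norm w) ^ 2)"
    by (intro mult_mono sq) auto
  also have "\<dots> = 4 * (K * norm w) ^ 4" by (simp add: power2_eq_square power4_eq_xxxx)
  also have "\<dots> \<le> 4 * (K * norm w) ^ k"
    using power_increasing[OF assms(2) one] by simp
  finally have le: "(1 + of_int c ^ 2) * (1 + of_int d ^ 2) \<le> 4 * K ^ k * norm w ^ k"
    by (simp add: power_mult_distrib)
  have w0: "norm w > 0" using one K1 by (cases "w = 0") auto
  have "norm (inverse (w ^ k)) = 1 / norm w ^ k" by (simp add: norm_inverse norm_power divide_inverse)
  also have "\<dots> \<le> 4 * K ^ k / ((1 + of_int c ^ 2) * (1 + of_int d ^ 2))"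
    using le w0 by (simp add: divide_simps add_pos_nonneg mult_ac)
  finally show ?thesis unfolding w_def by simp
qed

text \<open>The sum runs over all pairs: for \<open>k > 0\<close> the pair \<open>(0, 0)\<close>
  contributes 0 because \<open>inverse 0 = 0\<close>. The index set is then invariant under all
  integral changes of basis.\<close>

definition eisenstein_G :: "nat \<Rightarrow> complex \<Rightarrow> complex" where
  "eisenstein_G k \<tau> = infsum (\<lambda>(c, d). inverse ((of_int c * \<tau> + of_int d) ^ k)) (UNIV :: (int \<times> int) set)"

lemma eisenstein_G_has_sum:
  assumes "Im \<tau> > 0" "k \<ge> 4"
  shows "((\<lambda>(c, d). inverse ((of_int c * \<tau> + of_int d) ^ k)) has_sum eisenstein_G k \<tau>) (UNIV :: (int \<times> int) set)"
proof -
  define K where "K = 1 + (1 + norm \<tau>) / Im \<tau>"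
  have "(\<lambda>x. norm (case x of (c, d) \<Rightarrow> inverse ((of_int c * \<tau> + of_int d) ^ k))) summable_on (UNIV :: (int \<times> int) set)"
  proof (rule Infinite_Sum.abs_summable_on_comparison_test')
    show "(\<lambda>x. 4 * K ^ k * (case x of (c, d) \<Rightarrow> 1 / ((1 + of_int c ^ 2) * (1 + of_int d ^ 2)))) summable_on (UNIV :: (int \<times> int) set)"
      by (intro summable_on_cmult_right summable_on_lattice_majorant)
  qed (use lattice_term_bound[OF assms] in \<open>auto simp: K_def\<close>)
  hence "(\<lambda>(c, d). inverse ((of_int c * \<tau> + of_int d) ^ k)) summable_on (UNIV :: (int \<times> int) set)"
    by (rule abs_summable_summable)
  thus ?thesis unfolding eisenstein_G_def by (rule has_sum_infsum)
qed

text \<open>The pairs are permuted by right multiplication with a matrix of determinant 1, and the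
  series is summed unconditionally.\<close>

lemma eisenstein_G_modular:
  fixes a b c d :: int
  assumes \<tau>: "Im \<tau> > 0" and k: "k \<ge> 4" and det: "a * d - b * c = 1"
  shows "eisenstein_G k ((of_int a * \<tau> + of_int b) / (of_int c * \<tau> + of_int d)) =
     (of_int c * \<tau> + of_int d) ^ k * eisenstein_G k \<tau>"
proof -
  define J where "J = of_int c * \<tau> + of_int d"
  have J: "J \<noteq> 0"
  proof
    assume "J = 0"
    hence "of_int c * Im \<tau> = 0" "Re J = 0" by (simp_all add: J_def complex_eq_iff)
    hence "c = 0" "d = 0" using \<tau> by (auto simp: J_def)
    thus False using det by simp
  qed
  have "((\<lambda>(m, n). inverse ((of_int m * ((of_int a * \<tau> + of_int b) / J) + of_int n) ^ k))
          has_sum (J ^ k * eisenstein_G k \<tau>)) (UNIV :: (int \<times> int) set)"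
  proof (rule has_sum_reindex_bij_witness[of _ "\<lambda>(u, v). (u * d - v * c, v * a - u * b)"
        "\<lambda>(m, n). (m * a + n * c, m * b + n * d)", THEN iffD2,
        OF _ _ _ _ _ refl has_sum_cmult_right[OF eisenstein_G_has_sum[OF \<tau> k], of "J ^ k"]])
    fix x :: "int \<times> int"
    have "(m * a + n * c) * d - (m * b + n * d) * c = m * (a * d - b * c)"
      "(m * b + n * d) * a - (m * a + n * c) * b = n * (a * d - b * c)"
      "(m * d - n * c) * a + (n * a - m * b) * c = m * (a * d - b * c)"
      "(m * d - n * c) * b + (n * a - m * b) * d = n * (a * d - b * c)" for m n
      by (simp_all add: algebra_simps)
    thus "(case (case x of (m, n) \<Rightarrow> (m * a + n * c, m * b + n * d)) of (u, v) \<Rightarrow> (u * d - v * c, v * a - u * b)) = x"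
      "(case (case x of (u, v) \<Rightarrow> (u * d - v * c, v * a - u * b)) of (m, n) \<Rightarrow> (m * a + n * c, m * b + n * d)) = x"
      using det by (auto split: prod.splits)
  next
    fix x :: "int \<times> int"
    obtain m n where x: "x = (m, n)" by force
    have "of_int m * ((of_int a * \<tau> + of_int b) / J) + of_int n =
       (of_int m * (of_int a * \<tau> + of_int b) + of_int n * J) / J"
      using J by (simp add: add_divide_distrib ring_distribs)
    also have "of_int m * (of_int a * \<tau> + of_int b) + of_int n * J =
       of_int (m * a + n * c) * \<tau> + of_int (m * b + n * d)"
      by (simp add: J_def algebra_simps)
    finally have "of_int m * ((of_int a * \<tau> + of_int b) / J) + of_int n =
       (of_int (m * a + n * c) * \<tau> + of_int (m * b + n * d)) / J" .
    thus "J ^ k * (case (case x of (m, n) \<Rightarrow> (m * a + n * c, m * b + n * d)) of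
              (c, d) \<Rightarrow> inverse ((of_int c * \<tau> + of_int d) ^ k)) =
       (case x of (m, n) \<Rightarrow> inverse ((of_int m * ((of_int a * \<tau> + of_int b) / J) + of_int n) ^ k))"
      by (simp only: x prod.case power_divide inverse_divide) (rule divide_inverse [symmetric])
  qed auto
  thus ?thesis unfolding eisenstein_G_def J_def [symmetric] by (simp add: infsumI eisenstein_G_def)
qed

text \<open>\<open>S\<close> is the double series of \<open>m^n * q^(c m)\<close> over
  \<open>c, m \<ge> 1\<close>, read once along the rows \<open>c\<close> and once along the products
  \<open>l = c m\<close>. Absolute convergence comes from summing first over \<open>c\<close>, which
  is a geometric series.\<close>

lemma divisor_series:
  fixes q :: complex
  assumes q: "norm q < 1"
  obtains S where
    "((\<lambda>c. infsum (\<lambda>m. of_nat m ^ n * q ^ (c * m)) {1..}) has_sum S) {1::nat..}"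
    "((\<lambda>l. of_nat (\<Sum>m | m dvd l. m ^ n) * q ^ l) has_sum S) {1::nat..}"
    "\<And>c. c \<ge> 1 \<Longrightarrow> (\<lambda>m. of_nat m ^ n * q ^ (c * m)) summable_on {1::nat..}"
proof -
  define r where "r = norm q"
  have r: "0 \<le> r" "r < 1" using q by (auto simp: r_def)
  have rm: "r ^ m \<le> r" "norm (r ^ m) < 1" if "m \<ge> 1" for m
    using r that power_decreasing[of 1 m r] by (auto simp: power_abs)
  \<comment> \<open>Up to a constant the factors \<open>m^n\<close> are the coefficients of
    \<open>lipschitz_fps n\<close>, whose radius of convergence provides the majorant.\<close>
  have "ereal (norm (of_real r :: complex)) < fps_conv_radius (lipschitz_fps n)"
    by (rule less_le_trans[OF _ lipschitz_fps_radius]) (use r in auto)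
  hence "summable (\<lambda>m. norm (fps_nth (lipschitz_fps n) m * of_real r ^ m))"
    unfolding fps_conv_radius_def by (rule abs_summable_in_conv_radius)
  hence "summable (\<lambda>m. norm (fps_nth (lipschitz_fps n) m * of_real r ^ m) / (2 * pi) ^ Suc n / (1 - r))"
    by (intro summable_divide)
  hence "(\<lambda>m. norm (fps_nth (lipschitz_fps n) m * of_real r ^ m) / (2 * pi) ^ Suc n / (1 - r)) summable_on UNIV"
    using r by (subst summable_on_UNIV_nonneg_real_iff) auto
  hence "(\<lambda>m. norm (fps_nth (lipschitz_fps n) m * of_real r ^ m) / (2 * pi) ^ Suc n / (1 - r)) summable_on {1..}"
    by (rule summable_on_subset_banach) auto
  hence "(\<lambda>m. norm (real m ^ n * (r ^ m / (1 - r ^ m)))) summable_on {1..}"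
  proof (rule Infinite_Sum.abs_summable_on_comparison_test')
    fix m :: nat assume m: "m \<in> {1..}"
    have "norm (fps_nth (lipschitz_fps n) m * of_real r ^ m) / (2 * pi) ^ Suc n / (1 - r) =
        real m ^ n * (r ^ m / (1 - r))"
      using m r by (simp add: lipschitz_fps_def norm_mult norm_power power_mult_distrib)
    moreover have "r ^ m / (1 - r ^ m) \<le> r ^ m / (1 - r)"
      using rm[of m] r m by (intro divide_left_mono) (auto intro!: mult_pos_pos)
    moreover have "norm (real m ^ n * (r ^ m / (1 - r ^ m))) = real m ^ n * (r ^ m / (1 - r ^ m))"
      using rm[of m] r m by simp
    ultimately show "norm (real m ^ n * (r ^ m / (1 - r ^ m))) \<le>
        norm (fps_nth (lipschitz_fps n) m * of_real r ^ m) / (2 * pi) ^ Suc n / (1 - r)"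
      by (simp only: mult_left_mono zero_le_power of_nat_0_le_iff)
  qed
  hence g: "(\<lambda>m. real m ^ n * (r ^ m / (1 - r ^ m))) summable_on {1..}"
    by (rule abs_summable_summable)
  have "(\<lambda>(m, c). real m ^ n * r ^ (c * m)) summable_on ({1..} \<times> {1..})"
  proof (rule summable_on_SigmaI[OF _ g])
    fix m :: nat assume m: "m \<in> {1..}"
    have "((\<lambda>c. (r ^ m) ^ c) has_sum (r ^ m / (1 - r ^ m))) {1..}"
      using rm[of m] m by (intro has_sum_geometric_from_1) auto
    from has_sum_cmult_right[OF this, of "real m ^ n"]
    show "((\<lambda>c. case (m, c) of (m, c) \<Rightarrow> real m ^ n * r ^ (c * m)) has_sum
            (real m ^ n * (r ^ m / (1 - r ^ m)))) {1..}"
      by (simp add: mult.commute flip: power_mult)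
  qed (use r in auto)
  hence "(\<lambda>x. norm (case x of (m, c) \<Rightarrow> of_nat m ^ n * q ^ (c * m))) summable_on ({1..} \<times> {1..})"
    by (rule Infinite_Sum.abs_summable_on_comparison_test') (auto simp: norm_mult norm_power r_def)
  hence "(\<lambda>(m, c). of_nat m ^ n * q ^ (c * m)) summable_on ({1..} \<times> {1..})"
    by (rule abs_summable_summable)
  then obtain S where S: "((\<lambda>(m, c). of_nat m ^ n * q ^ (c * m)) has_sum S) ({1::nat..} \<times> {1::nat..})"
    unfolding summable_on_def by blast
  have S': "((\<lambda>(c, m). of_nat m ^ n * q ^ (c * m)) has_sum S) ({1::nat..} \<times> {1::nat..})"
    by (rule has_sum_reindex_bij_witness[of _ prod.swap prod.swap, THEN iffD2, OF _ _ _ _ _ refl S]) auto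
  have row: "(\<lambda>m. of_nat m ^ n * q ^ (c * m)) summable_on {1::nat..}" if "c \<ge> 1" for c
    using summable_on_SigmaD1[OF has_sum_imp_summable[OF S'], of c] that by simp
  have 1: "((\<lambda>c. infsum (\<lambda>m. of_nat m ^ n * q ^ (c * m)) {1..}) has_sum S) {1::nat..}"
    by (rule has_sum_SigmaD[OF S']) (use row in \<open>auto intro!: has_sum_infsum\<close>)
  have "((\<lambda>(l, m). of_nat m ^ n * q ^ l) has_sum S) (Sigma {1::nat..} (\<lambda>l. {m. m dvd l}))"
  proof (rule has_sum_reindex_bij_witness[of _ "\<lambda>(m, c). (m * c, m)" "\<lambda>(l, m). (m, l div m)",
          THEN iffD2, OF _ _ _ _ _ refl S])
    fix x :: "nat \<times> nat" assume "x \<in> Sigma {1..} (\<lambda>l. {m. m dvd l})"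
    then obtain l m where lm: "x = (l, m)" "l \<ge> 1" "m dvd l" by auto
    then obtain c where "l = m * c" by blast
    with lm have x: "x = (m * c, m)" "m > 0" "c > 0" by (auto intro!: Nat.gr0I)
    show "(case (case x of (l, m) \<Rightarrow> (m, l div m)) of (m, c) \<Rightarrow> (m * c, m)) = x"
      "(case x of (l, m) \<Rightarrow> (m, l div m)) \<in> {1..} \<times> {1..}"
      "(case (case x of (l, m) \<Rightarrow> (m, l div m)) of (m, c) \<Rightarrow> of_nat m ^ n * q ^ (c * m)) =
         (case x of (l, m) \<Rightarrow> of_nat m ^ n * q ^ l)"
      using x by (auto simp: mult.commute)
  next
    fix x :: "nat \<times> nat" assume "x \<in> {1..} \<times> {1..}"
    then obtain m c where x: "x = (m, c)" "m > 0" "c > 0" by (cases x) auto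
    show "(case (case x of (m, c) \<Rightarrow> (m * c, m)) of (l, m) \<Rightarrow> (m, l div m)) = x"
      "(case x of (m, c) \<Rightarrow> (m * c, m)) \<in> Sigma {1..} (\<lambda>l. {m. m dvd l})"
      using x by (auto simp: Suc_le_eq)
  qed
  hence 2: "((\<lambda>l. \<Sum>m | m dvd l. of_nat m ^ n * q ^ l) has_sum S) {1::nat..}"
    by (rule has_sum_SigmaD) (auto intro!: has_sum_finiteI)
  show ?thesis
    by (rule that[OF 1 _ row]) (use 2 in \<open>simp_all add: sum_distrib_right\<close>)
qed

definition eisenstein_fps :: "nat \<Rightarrow> complex fps" where
  "eisenstein_fps k = Abs_fps (\<lambda>l. if l = 0 then 1
     else - (of_nat (2 * k) / bernoulli k) * of_nat (\<Sum>m | m dvd l. m ^ (k - 1)))"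

text \<open>For even \<open>k \<ge> 4\<close> the divisor is \<open>2 * zeta(k)\<close>, the
  contribution of the row \<open>c = 0\<close>, so that the constant term becomes 1.\<close>

definition eisenstein_E :: "nat \<Rightarrow> complex \<Rightarrow> complex" where
  "eisenstein_E k \<tau> = eisenstein_G k \<tau> / (Polygamma_diff (k - 1) 0 / fact (k - 1))"

text \<open>The lattice sum is taken row by row: row \<open>c > 0\<close> is the Lipschitz formula
  at \<open>c \<tau>\<close>, row \<open>-c\<close> agrees with it since \<open>k\<close> is even,
  and row 0 is the zeta value. Euler's formula turns the ratio of the constants into
  \<open>-2k / bernoulli k\<close>.\<close>

theorem eisenstein_E_sums:
  assumes \<tau>: "Im \<tau> > 0" and k: "k \<ge> 4" "even k" and B: "bernoulli k \<noteq> 0"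
  shows "(\<lambda>l. fps_nth (eisenstein_fps k) l * exp (2 * pi * \<i> * \<tau>) ^ l) sums eisenstein_E k \<tau>"
proof -
  define n where "n = k - 1"
  have n: "n > 0" "k = Suc n" "(-1) ^ Suc n = (1 :: complex)" using k by (auto simp: n_def)
  define q where "q = exp (2 * pi * \<i> * \<tau>)"
  have q: "norm q < 1" unfolding q_def by (rule norm_q_less_1[OF \<tau>])
  define a where "a = (2 * pi * \<i>) ^ k / fact n"
  define z0 where "z0 = Polygamma_diff n 0 / fact n"
  define h where "h = (\<lambda>c. infsum (\<lambda>m. of_nat m ^ n * q ^ (c * m)) {1::nat..})"
  obtain S where S: "(h has_sum S) {1::nat..}"
    "((\<lambda>l. of_nat (\<Sum>m | m dvd l. m ^ n) * q ^ l) has_sum S) {1::nat..}"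
    "\<And>c. c \<ge> 1 \<Longrightarrow> (\<lambda>m. of_nat m ^ n * q ^ (c * m)) summable_on {1::nat..}"
    unfolding h_def using divisor_series[OF q] by blast
  have z0: "z0 = - a * bernoulli k / of_nat k"
  proof -
    have "z0 = - ((2 * pi * \<i>) ^ k) * fps_nth bernoulli_fps k"
      using Polygamma_diff_at_0[of "n - 1"] n by (simp add: z0_def)
    thus ?thesis by (simp add: a_def bernoulli_def n(2) del: power_Suc of_nat_Suc)
  qed
  have pos: "((\<lambda>d::int. inverse ((of_nat c * \<tau> + of_int d) ^ k)) has_sum (a * h c)) UNIV" if c: "c \<ge> 1" for c :: nat
  proof -
    have Im: "Im (of_nat c * \<tau>) > 0" using c \<tau> by simp
    have qc: "exp (2 * pi * \<i> * (of_nat c * \<tau>)) = q ^ c"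
      unfolding q_def by (subst exp_of_nat_mult [symmetric]) (simp add: mult_ac)
    have "((\<lambda>m. of_nat m ^ n * q ^ (c * m)) has_sum h c) {1::nat..}"
      unfolding h_def by (rule has_sum_infsum[OF S(3)[OF c]])
    from has_sum_cmult_right[OF this, of "(2 * pi * \<i>) ^ k"]
    have "((\<lambda>m. fps_nth (lipschitz_fps n) m * (q ^ c) ^ m) has_sum ((2 * pi * \<i>) ^ k * h c)) UNIV"
      by (subst (asm) has_sum_cong_neutral[where T = UNIV and g = "\<lambda>m. fps_nth (lipschitz_fps n) m * (q ^ c) ^ m"])
         (use n in \<open>auto simp: lipschitz_fps_def mult.assoc simp del: power_Suc simp flip: power_mult\<close>)
    hence "eval_fps (lipschitz_fps n) (q ^ c) = (2 * pi * \<i>) ^ k * h c"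
      unfolding eval_fps_def using has_sum_imp_sums sums_unique by metis
    moreover have "1 / fact n * ((2 * pi * \<i>) ^ k * h c) = a * h c"
      by (simp add: a_def)
    ultimately show ?thesis
      using lipschitz_formula[OF Im n(1)] unfolding qc n(3) n(2) [symmetric] n(3)[folded n(2)] by (simp only:)
  qed
  define \<rho> where "\<rho> = (\<lambda>c::int. if c = 0 then z0 else a * h (nat \<bar>c\<bar>))"
  have row: "((\<lambda>d::int. inverse ((of_int c * \<tau> + of_int d) ^ k)) has_sum \<rho> c) UNIV" for c :: int
  proof (cases c "0 :: int" rule: linorder_cases)
    case equal
    have "((\<lambda>j::int. inverse ((0 + of_int j) ^ Suc n)) has_sum z0) (- {0})"
      using Polygamma_diff_has_sum[OF n(1), of 0] unfolding n(3) z0_def by (simp only: times_divide_eq_left mult_1)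
    hence "((\<lambda>d::int. inverse ((of_int c * \<tau> + of_int d) ^ k)) has_sum z0) UNIV"
      by (subst (asm) has_sum_cong_neutral[where T = UNIV and g = "\<lambda>d::int. inverse ((of_int c * \<tau> + of_int d) ^ k)"])
         (use equal n in auto)
    thus ?thesis using equal by (simp add: \<rho>_def)
  next
    case greater
    thus ?thesis using pos[of "nat c"] by (simp add: \<rho>_def)
  next
    case less
    show ?thesis
    proof (rule has_sum_reindex_bij_witness[of _ uminus uminus, THEN iffD2, OF _ _ _ _ _ _ pos[of "nat (- c)"]])
      fix d :: int
      have "of_nat (nat (- c)) * \<tau> + of_int (- d) = - (of_int c * \<tau> + of_int d)"
        using less by simp
      hence "(of_nat (nat (- c)) * \<tau> + of_int (- d)) ^ k = (of_int c * \<tau> + of_int d) ^ k"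
        using k(2) by (simp only: power_minus_even)
      thus "inverse ((of_nat (nat (- c)) * \<tau> + of_int (- d)) ^ k) = inverse ((of_int c * \<tau> + of_int d) ^ k)"
        by simp
    qed (use less in \<open>auto simp: \<rho>_def\<close>)
  qed
  have "(\<rho> has_sum eisenstein_G k \<tau>) UNIV"
    by (rule has_sum_SigmaD[where B = "\<lambda>_. UNIV"])
       (use eisenstein_G_has_sum[OF \<tau> k(1)] row in auto)
  moreover have "(\<rho> has_sum (a * S + (a * S + z0))) ({0<..} \<union> ({..<0} \<union> {0}))"
  proof (rule has_sum_Un_disjoint; (rule has_sum_Un_disjoint)?)
    note S' = has_sum_cmult_right[OF S(1), of a]
    show "(\<rho> has_sum (a * S)) {0<..}"
      by (rule has_sum_reindex_bij_witness[of _ int nat, THEN iffD2, OF _ _ _ _ _ refl S'])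
         (auto simp: \<rho>_def)
    show "(\<rho> has_sum (a * S)) {..<0}"
      by (rule has_sum_reindex_bij_witness[of _ "\<lambda>c. - int c" "\<lambda>c. nat (- c)", THEN iffD2, OF _ _ _ _ _ refl S'])
         (auto simp: \<rho>_def)
    show "(\<rho> has_sum z0) {0}" by (intro has_sum_finiteI) (auto simp: \<rho>_def)
  qed auto
  moreover have "{0<..} \<union> ({..<0} \<union> {0}) = (UNIV :: int set)" by auto
  ultimately have G: "eisenstein_G k \<tau> = z0 + 2 * a * S"
    using has_sum_unique[of \<rho> UNIV "eisenstein_G k \<tau>" "a * S + (a * S + z0)"] by simp
  have a0: "a \<noteq> 0" by (simp add: a_def)
  have z00: "z0 \<noteq> 0" using a0 B k by (simp add: z0)
  have E: "eisenstein_E k \<tau> = 1 + - (of_nat (2 * k) / bernoulli k) * S"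
  proof -
    have "eisenstein_E k \<tau> = 1 + (2 * a / z0) * S"
      unfolding eisenstein_E_def G n_def [symmetric] z0_def [symmetric]
      using z00 by (simp add: add_divide_distrib)
    also have "2 * a / z0 = - (of_nat (2 * k) / bernoulli k)"
    proof -
      have "of_nat k \<noteq> (0 :: complex)" using k by simp
      thus ?thesis using a0 B unfolding z0 by (simp add: divide_simps)
    qed
    finally show ?thesis .
  qed
  have "((\<lambda>l. fps_nth (eisenstein_fps k) l * q ^ l) has_sum eisenstein_E k \<tau>) ({0} \<union> {1..})"
    unfolding E
  proof (rule has_sum_Un_disjoint)
    show "((\<lambda>l. fps_nth (eisenstein_fps k) l * q ^ l) has_sum 1) {0}"
      by (intro has_sum_finiteI) (auto simp: eisenstein_fps_def)
    from has_sum_cmult_right[OF S(2), of "- (of_nat (2 * k) / bernoulli k)"]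
    show "((\<lambda>l. fps_nth (eisenstein_fps k) l * q ^ l) has_sum (- (of_nat (2 * k) / bernoulli k) * S)) {1..}"
      by (rule has_sum_cong[THEN iffD1, rotated]) (simp add: eisenstein_fps_def n_def)
  qed auto
  also have "{0} \<union> {1..} = (UNIV :: nat set)" by auto
  finally show ?thesis unfolding q_def by (rule has_sum_imp_sums)
qed

lemma eisenstein_fps_radius:
  assumes k: "k \<ge> 4" "even k" and B: "bernoulli k \<noteq> 0"
  shows "fps_conv_radius (eisenstein_fps k) \<ge> 1"
proof (rule fps_conv_radius_geI)
  fix r :: real assume r: "0 < r" "r < 1"
  \<comment> \<open>The point of the imaginary axis whose \<open>q\<close> is \<open>r\<close>;
    convergence for every such \<open>q\<close> gives the radius.\<close>
  define \<tau> where "\<tau> = \<i> * of_real (- ln r / (2 * pi))"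
  have "Im \<tau> > 0" using r by (simp add: \<tau>_def divide_neg_pos)
  moreover have "exp (2 * pi * \<i> * \<tau>) = of_real r"
  proof -
    have "2 * pi * \<i> * \<tau> = of_real (ln r)"
      by (simp add: \<tau>_def complex_eq_iff)
    hence "exp (2 * pi * \<i> * \<tau>) = exp (of_real (ln r))" by (rule arg_cong)
    also have "\<dots> = of_real r" using r by (simp add: exp_of_real)
    finally show ?thesis .
  qed
  ultimately show "summable (\<lambda>l. fps_nth (eisenstein_fps k) l * of_real r ^ l)"
    using eisenstein_E_sums[OF _ k B, of \<tau>] by (simp add: sums_iff)
qed

lemma eisenstein_E_modular:
  fixes a b c d :: int
  assumes "Im \<tau> > 0" "k \<ge> 4" "a * d - b * c = 1"
  shows "eisenstein_E k ((of_int a * \<tau> + of_int b) / (of_int c * \<tau> + of_int d)) =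
     (of_int c * \<tau> + of_int d) ^ k * eisenstein_E k \<tau>"
  using eisenstein_G_modular[OF assms] by (simp add: eisenstein_E_def)

text \<open>For \<open>p \<ge> 5\<close> the square of the series of weight \<open>p - 1\<close> is
  taken. For \<open>p = 2\<close> and \<open>p = 3\<close> weight 4 itself has the form
  \<open>2 * (p - 1) * p^i\<close>, with \<open>i = 1\<close> and \<open>i = 0\<close>, and
  \<open>8 / bernoulli 4 = -240\<close> is divisible by \<open>p\<close>.\<close>

lemma eisenstein_weight_choice:
  assumes p: "Factorial_Ring.prime p"
  obtains k m i :: nat and D u :: int where
    "k \<ge> 4" "even k" "bernoulli k \<noteq> 0" "coprime D (int p)"
    "of_int D * (of_nat (2 * k) / bernoulli k) = of_int (int p * u)"
    "k * m = 2 * (p - 1) * p ^ i"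
proof (cases "p \<ge> 5")
  case True
  hence "odd p" using p prime_odd_nat by auto
  moreover obtain D u :: int where "coprime D (int p)"
    "of_int D * (of_nat (2 * (p - 1)) / bernoulli (p - 1)) = of_int (int p * u)"
    using bernoulli_prime_minus_1(2)[OF p] True by auto
  ultimately show ?thesis
    using that[of "p - 1" D u 2 0] bernoulli_prime_minus_1(1)[OF p] True by auto
next
  case False
  have "p \<noteq> 4"
  proof
    assume "p = 4"
    moreover have "(2::nat) dvd 4" by simp
    ultimately show False using p prime_nat_iff[of p] by auto
  qed
  hence "p = 2 \<or> p = 3" using False prime_gt_1_nat[OF p] by auto
  thus ?thesis
  proof
    assume "p = 2"
    thus ?thesis using that[of 4 1 "-120" 1 1] by (simp add: bernoulli_4)
  next
    assume "p = 3"
    thus ?thesis using that[of 4 1 "-80" 1 0] by (simp add: bernoulli_4)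
  qed
qed

section \<open>Congruences sharpened by raising to powers of p\<close>

lemma power_prime_congruence:
  fixes x y :: "'a::comm_ring_1"
  assumes "of_nat p ^ s dvd x - y" "s > 0"
  shows "of_nat p ^ Suc s dvd x ^ p - y ^ p"
proof -
  have p1: "of_nat p dvd x - y"
    using assms by (meson dvd_power dvd_trans)
  have cong: "of_nat p dvd x ^ i - y ^ i" for i
    using p1 by (metis dvd_trans power_diff_sumr2 dvd_triv_left)
  \<comment> \<open>The cofactor of \<open>x - y\<close> in \<open>x^p - y^p\<close> is congruent to
    \<open>p * y^(p-1)\<close> modulo \<open>p\<close>, so it supplies one more factor
    \<open>p\<close>.\<close>
  have "(\<Sum>i<p. y ^ (p - Suc i) * x ^ i) =
      (\<Sum>i<p. y ^ (p - Suc i) * (x ^ i - y ^ i)) + of_nat p * y ^ (p - 1)"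
  proof -
    have "(\<Sum>i<p. y ^ (p - Suc i) * y ^ i) = (\<Sum>i<p. y ^ (p - 1))"
      by (intro sum.cong) (auto simp flip: power_add)
    thus ?thesis by (simp add: right_diff_distrib sum_subtractf)
  qed
  also have "of_nat p dvd \<dots>"
    by (rule dvd_add, intro dvd_sum dvd_mult cong) (rule dvd_triv_left)
  finally have "of_nat p dvd (\<Sum>i<p. y ^ (p - Suc i) * x ^ i)" .
  with assms(1) have "of_nat p ^ s * of_nat p dvd (x - y) * (\<Sum>i<p. y ^ (p - Suc i) * x ^ i)"
    by (rule mult_dvd_mono)
  thus ?thesis by (simp add: power_diff_sumr2 mult.commute)
qed

lemma power_prime_congruence_iterated:
  fixes x y :: "'a::comm_ring_1"
  assumes "of_nat p dvd x - y"
  shows "of_nat p ^ Suc j dvd x ^ (p ^ j) - y ^ (p ^ j)"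
proof (induction j)
  case (Suc j)
  have "z ^ p ^ Suc j = (z ^ p ^ j) ^ p" for z :: 'a
    by (simp add: mult.commute flip: power_mult)
  with power_prime_congruence[OF Suc] show ?case by simp
qed (use assms in simp)

definition fps_of_int_fps :: "int fps \<Rightarrow> complex fps" where
  "fps_of_int_fps V = Abs_fps (\<lambda>n. of_int (fps_nth V n))"

lemma fps_of_int_fps_mult: "fps_of_int_fps (V * W) = fps_of_int_fps V * fps_of_int_fps W"
  by (simp add: fps_of_int_fps_def fps_eq_iff fps_mult_nth)

lemma fps_of_int_fps_power: "fps_of_int_fps (V ^ n) = fps_of_int_fps V ^ n"
proof (induction n)
  case 0
  show ?case by (simp add: fps_of_int_fps_def fps_eq_iff)
qed (simp add: fps_of_int_fps_mult)

lemma fps_dvd_imp_nth_dvd: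
  fixes W :: "int fps"
  assumes "of_nat p ^ s dvd W"
  shows "int p ^ s dvd fps_nth W n"
proof -
  obtain W' where "W = of_nat p ^ s * W'" using assms by blast
  also have "of_nat p ^ s = fps_const (int p ^ s)"
    by (simp flip: fps_of_nat)
  finally show ?thesis by simp
qed

text \<open>Multiplying the Eisenstein series by \<open>D\<close> gives an integral series
  \<open>U\<close> congruent to a constant modulo \<open>p\<close>, and the \<open>p^j\<close>-th
  power raises the precision to \<open>p^(j+1)\<close>. The price is a factor \<open>p^j\<close> in
  the weight, hence \<open>i \<ge> j\<close>.\<close>

theorem level_one_form_exists:
  assumes p: "Factorial_Ring.prime p"
  obtains E :: "complex \<Rightarrow> complex" and A :: "complex fps" and D :: int and i :: nat where
    "\<And>a b c d :: int. \<And>z. a * d - b * c = 1 \<Longrightarrow> Im z > 0 \<Longrightarrow>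
        E ((of_int a * z + of_int b) / (of_int c * z + of_int d)) =
          (of_int c * z + of_int d) ^ (2 * ((p - 1) * p ^ i)) * E z"
    "fps_conv_radius A \<ge> 1"
    "\<And>z. Im z > 0 \<Longrightarrow> E z = eval_fps A (exp (2 * pi * \<i> * z))"
    "fps_nth A 0 = 1" "coprime D (int p)" "i \<ge> j"
    "\<And>n. n > 0 \<Longrightarrow> \<exists>u::int. of_int D * fps_nth A n = of_int (int p ^ Suc j * u)"
proof -
  obtain k m i :: nat and D u :: int where
    k: "k \<ge> 4" "even k" "bernoulli k \<noteq> 0" and D: "coprime D (int p)"
    "of_int D * (of_nat (2 * k) / bernoulli k) = of_int (int p * u)"
    and km: "k * m = 2 * (p - 1) * p ^ i"
    using eisenstein_weight_choice[OF p] by metis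
  define M where "M = m * p ^ j"
  define A where "A = eisenstein_fps k"
  define V where "V = Abs_fps (\<lambda>l. if l = 0 then 0 else - u * int (\<Sum>m | m dvd l. m ^ (k - 1)))"
  define U where "U = fps_const D + of_nat p * V"
  have A0: "fps_nth A 0 = 1" by (simp add: A_def eisenstein_fps_def)
  have U: "fps_const (of_int D) * A = fps_of_int_fps U"
  proof (rule fps_ext)
    fix l
    have *: "fps_nth (of_nat p * V) l = int p * fps_nth V l"
      by (simp flip: fps_of_nat)
    show "fps_nth (fps_const (of_int D) * A) l = fps_nth (fps_of_int_fps U) l"
    proof (cases "l = 0")
      case True
      thus ?thesis using * by (simp add: fps_of_int_fps_def U_def A0 V_def)
    next
      case False
      have "of_int D * fps_nth A l = - (of_int D * (of_nat (2 * k) / bernoulli k)) * of_nat (\<Sum>m | m dvd l. m ^ (k - 1))"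
        using False by (simp add: A_def eisenstein_fps_def)
      thus ?thesis using False * unfolding D(2) by (simp add: fps_of_int_fps_def U_def V_def)
    qed
  qed
  have r: "fps_conv_radius A \<ge> 1" unfolding A_def by (rule eisenstein_fps_radius[OF k])
  have r': "fps_conv_radius (A ^ M) \<ge> 1"
    using r fps_conv_radius_power order_trans by blast
  show ?thesis
  proof (rule that[of "\<lambda>z. eisenstein_E k z ^ M" "i + j" "A ^ M" "D ^ M"])
    fix a b c d :: int and z :: complex
    assume *: "a * d - b * c = 1" "Im z > 0"
    have "k * M = 2 * ((p - 1) * p ^ (i + j))"
      using km by (simp add: M_def power_add)
    thus "eisenstein_E k ((of_int a * z + of_int b) / (of_int c * z + of_int d)) ^ M =
          (of_int c * z + of_int d) ^ (2 * ((p - 1) * p ^ (i + j))) * eisenstein_E k z ^ M"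
      using eisenstein_E_modular[OF *(2) k(1) *(1)] by (simp add: power_mult_distrib flip: power_mult)
  next
    show "fps_conv_radius (A ^ M) \<ge> 1" by (rule r')
  next
    fix z :: complex assume z: "Im z > 0"
    have "ereal (norm (exp (2 * pi * \<i> * z))) < fps_conv_radius A"
      by (rule less_le_trans[OF _ r]) (use norm_q_less_1[OF z] in simp)
    moreover have "eisenstein_E k z = eval_fps A (exp (2 * pi * \<i> * z))"
      using eisenstein_E_sums[OF z k] by (simp add: eval_fps_def A_def sums_iff)
    ultimately show "eisenstein_E k z ^ M = eval_fps (A ^ M) (exp (2 * pi * \<i> * z))"
      by (simp only: eval_fps_power)
  next
    show "fps_nth (A ^ M) 0 = 1" using A0 by (simp add: fps_power_zeroth)
    show "coprime (D ^ M) (int p)" using D(1) by simp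
  next
    fix n :: nat assume n: "n > 0"
    have "of_nat p dvd U - fps_const D" by (simp add: U_def)
    hence "of_nat p dvd U ^ m - fps_const D ^ m"
      by (metis dvd_trans power_diff_sumr2 dvd_triv_left)
    from power_prime_congruence_iterated[OF this, of j]
    have "int p ^ Suc j dvd fps_nth (U ^ M - fps_const (D ^ M)) n"
      by (intro fps_dvd_imp_nth_dvd) (simp add: M_def power_mult flip: fps_const_power)
    hence "int p ^ Suc j dvd fps_nth (U ^ M) n" using n by simp
    then obtain v where v: "fps_nth (U ^ M) n = int p ^ Suc j * v" by blast
    have "fps_const (of_int (D ^ M)) * A ^ M = (fps_const (of_int D) * A) ^ M"
      by (simp add: power_mult_distrib fps_const_power)
    also have "\<dots> = fps_of_int_fps (U ^ M)" unfolding U by (simp add: fps_of_int_fps_power)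
    finally have "fps_nth (fps_const (of_int (D ^ M)) * A ^ M) n = of_int (int p ^ Suc j * v)"
      using v by (simp add: fps_of_int_fps_def)
    thus "\<exists>u::int. of_int (D ^ M) * fps_nth (A ^ M) n = of_int (int p ^ Suc j * u)" by auto
  qed auto
qed

section \<open>Moebius transformations and the slash operator\<close>

lemma mat2_nth [simp]:
  "mat2 a b c d $ 1 $ 1 = a" "mat2 a b c d $ 1 $ 2 = b"
  "mat2 a b c d $ 2 $ 1 = c" "mat2 a b c d $ 2 $ 2 = d"
  by (simp_all add: mat2_def)

lemma mat2_eqI:
  fixes A :: "real^2^2"
  assumes "A $ 1 $ 1 = a" "A $ 1 $ 2 = b" "A $ 2 $ 1 = c" "A $ 2 $ 2 = d"
  shows "A = mat2 a b c d"
  using assms by (simp add: vec_eq_iff forall_2)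

lemma mat2_cases:
  obtains a b c d where "A = mat2 a b c d"
  by (rule that[OF mat2_eqI]) auto

lemma mat2_inject [simp]:
  "mat2 a b c d = mat2 a' b' c' d' \<longleftrightarrow> a = a' \<and> b = b' \<and> c = c' \<and> d = d'"
  by (metis mat2_nth)

lemma mat2_mult: "mat2 a b c d ** mat2 a' b' c' d' =
    mat2 (a * a' + b * c') (a * b' + b * d') (c * a' + d * c') (c * b' + d * d')"
  by (rule mat2_eqI) (simp_all add: matrix_matrix_mult_def sum_2)

lemma det_mat2 [simp]: "det (mat2 a b c d) = a * d - b * c"
  by (simp add: det_2)

lemma mat_1_eq_mat2: "mat 1 = mat2 1 0 0 1"
  by (rule mat2_eqI) (simp_all add: mat_def)

lemma cocycle_mat2 [simp]: "cocycle (mat2 a b c d) z = of_real c * z + of_real d"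
  by (simp add: cocycle_def)

lemma moebius_mat2: "moebius (mat2 a b c d) z = (of_real a * z + of_real b) / (of_real c * z + of_real d)"
  by (simp add: moebius_def)

lemma moebius_1 [simp]: "moebius (mat 1) z = z"
  by (simp add: mat_1_eq_mat2 moebius_mat2)

lemma cocycle_nonzero:
  assumes "det A \<noteq> 0" "z \<in> upper_half"
  shows "cocycle A z \<noteq> 0"
proof -
  obtain a b c d where A: "A = mat2 a b c d" by (rule mat2_cases)
  show ?thesis
  proof
    assume "cocycle A z = 0"
    hence "c * Im z = 0" "c * Re z + d = 0" by (simp_all add: A complex_eq_iff)
    hence "c = 0" "d = 0" using assms(2) by (auto simp: upper_half_def)
    thus False using assms(1) by (simp add: A)
  qed
qed

lemma moebius_mult:
  assumes "cocycle B z \<noteq> 0"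
  shows "moebius (A ** B) z = moebius A (moebius B z)"
    "cocycle (A ** B) z = cocycle A (moebius B z) * cocycle B z"
proof -
  obtain a b c d where A: "A = mat2 a b c d" by (rule mat2_cases)
  obtain a' b' c' d' where B: "B = mat2 a' b' c' d'" by (rule mat2_cases)
  define J where "J = of_real c' * z + of_real d'"
  have J: "J \<noteq> 0" using assms by (simp add: B J_def)
  have 1: "x * ((of_real a' * z + of_real b') / J) + y =
      ((x * of_real a' + y * of_real c') * z + (x * of_real b' + y * of_real d')) / J" for x y :: complex
  proof -
    have "x * ((of_real a' * z + of_real b') / J) + y = (x * (of_real a' * z + of_real b') + y * J) / J"
      using J by (simp add: add_divide_distrib ring_distribs)
    also have "x * (of_real a' * z + of_real b') + y * J =
        (x * of_real a' + y * of_real c') * z + (x * of_real b' + y * of_real d')"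
      by (simp add: J_def algebra_simps)
    finally show ?thesis .
  qed
  show "cocycle (A ** B) z = cocycle A (moebius B z) * cocycle B z"
    using J unfolding A B mat2_mult cocycle_mat2 moebius_mat2 J_def [symmetric] 1 by simp
  show "moebius (A ** B) z = moebius A (moebius B z)"
    using J unfolding A B mat2_mult moebius_mat2 J_def [symmetric] 1 by simp
qed

lemma Im_moebius:
  assumes "cocycle A z \<noteq> 0"
  shows "Im (moebius A z) = det A * Im z / norm (cocycle A z) ^ 2"
proof -
  obtain a b c d where A: "A = mat2 a b c d" by (rule mat2_cases)
  have "Im (moebius A z) = Im ((of_real a * z + of_real b) * cnj (of_real c * z + of_real d)) / norm (cocycle A z) ^ 2"
    unfolding A moebius_mat2 cocycle_mat2
    by (subst complex_div_cnj) (simp flip: of_real_power)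
  also have "Im ((of_real a * z + of_real b) * cnj (of_real c * z + of_real d)) = det A * Im z"
    by (simp add: A algebra_simps)
  finally show ?thesis .
qed

lemma moebius_upper_half:
  assumes "det A > 0" "z \<in> upper_half"
  shows "moebius A z \<in> upper_half"
proof -
  have "cocycle A z \<noteq> 0" using assms by (intro cocycle_nonzero) auto
  thus ?thesis using assms by (simp add: upper_half_def Im_moebius)
qed

lemma moebius_mult_upper_half:
  assumes "det B > 0" "z \<in> upper_half"
  shows "moebius (A ** B) z = moebius A (moebius B z)"
  using assms by (intro moebius_mult cocycle_nonzero) auto

lemma slash_even:
  assumes "det A > 0"
  shows "slash (2 * int m) F A z = of_real (det A) ^ m / cocycle A z ^ (2 * m) * F (moebius A z)"
proof -
  have "det A powr (of_int (2 * int m) / 2) = det A ^ m"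
    using assms by (simp add: powr_realpow)
  moreover have "cocycle A z powi - (2 * int m) = inverse (cocycle A z ^ (2 * m))"
    by (simp add: power_int_minus flip: power_int_of_nat)
  ultimately show ?thesis unfolding slash_def by (simp only: divide_inverse of_real_power)
qed

lemma slash_0:
  assumes "det A > 0"
  shows "slash 0 F A z = F (moebius A z)"
  using slash_even[OF assms, of 0] by simp

lemma slash_2:
  assumes "det A > 0"
  shows "slash 2 F A z = of_real (det A) / cocycle A z ^ 2 * F (moebius A z)"
  using slash_even[OF assms, of 1] by simp

lemma slash_slash:
  assumes "det A > 0" "det B > 0" "z \<in> upper_half"
  shows "slash (2 * int m) (slash (2 * int m) F A) B z = slash (2 * int m) F (A ** B) z"
proof -
  have B: "cocycle B z \<noteq> 0" using assms by (intro cocycle_nonzero) auto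
  have "det (A ** B) > 0" using assms by (simp add: det_mul)
  thus ?thesis
    unfolding slash_even[OF assms(1)] slash_even[OF assms(2)] slash_even[OF \<open>det (A ** B) > 0\<close>]
      moebius_mult[OF B] det_mul
    by (simp add: power_mult_distrib mult_ac)
qed

lemma open_upper_half: "open upper_half"
  by (simp add: upper_half_def open_halfspace_Im_gt)

section \<open>Neighbourhoods of i infinity\<close>

lemma eventually_at_ioo: "eventually P at_ioo \<longleftrightarrow> (\<exists>M. \<forall>z. Im z > M \<longrightarrow> P z)"
proof
  assume "eventually P at_ioo"
  then obtain Q where Q: "eventually Q at_top" "\<And>z. Q (Im z) \<Longrightarrow> P z"
    unfolding at_ioo_def eventually_filtercomap by auto
  then obtain M where "\<And>x. x > M \<Longrightarrow> Q x" unfolding eventually_at_top_dense by auto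
  thus "\<exists>M. \<forall>z. Im z > M \<longrightarrow> P z" using Q(2) by blast
next
  assume "\<exists>M. \<forall>z. Im z > M \<longrightarrow> P z"
  then obtain M where "\<And>z. Im z > M \<Longrightarrow> P z" by blast
  thus "eventually P at_ioo"
    unfolding at_ioo_def eventually_filtercomap
    by (intro exI[of _ "\<lambda>x. x > M"]) (auto simp: eventually_gt_at_top)
qed

lemma at_ioo_not_bot [simp]: "at_ioo \<noteq> bot"
proof
  assume "at_ioo = bot"
  hence "eventually (\<lambda>_. False) at_ioo" by simp
  then obtain M where "\<And>z. Im z > M \<Longrightarrow> False" unfolding eventually_at_ioo by blast
  from this[of "Complex 0 (M + 1)"] show False by simp
qed

lemma filterlim_Im_at_ioo: "filterlim Im at_top at_ioo"
  unfolding at_ioo_def by (rule filterlim_filtercomap)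

lemma filterlim_at_ioo_iff: "filterlim f at_ioo F \<longleftrightarrow> filterlim (\<lambda>x. Im (f x)) at_top F"
  unfolding at_ioo_def by (simp add: filterlim_filtercomap_iff o_def)

lemma eventually_upper_half_at_ioo: "eventually (\<lambda>z. z \<in> upper_half) at_ioo"
  unfolding eventually_at_ioo upper_half_def by (intro exI[of _ 0]) auto

lemma q_tendsto_0:
  assumes "h > 0"
  shows "((\<lambda>z. exp (2 * pi * \<i> * z / of_real h)) \<longlongrightarrow> 0) at_ioo"
proof (rule tendsto_norm_zero_cancel)
  have "norm (exp (2 * pi * \<i> * z / of_real h)) = exp (- (2 * pi / h * Im z))" for z :: complex
    by (simp add: norm_exp_eq_Re Re_divide_of_real)
  moreover have "((\<lambda>z. exp (- (2 * pi / h * Im z))) \<longlongrightarrow> 0) at_ioo"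
    by (rule filterlim_compose[OF _ filterlim_Im_at_ioo]) (use assms in real_asymp)
  ultimately show "((\<lambda>z. norm (exp (2 * pi * \<i> * z / of_real h))) \<longlongrightarrow> 0) at_ioo" by simp
qed

section \<open>Atkin--Lehner groups\<close>

text \<open>The scalar \<open>l\<close> makes this set closed under products. The determinant condition already forces
  \<open>e\<close> to be a Hall divisor of \<open>N\<close>.\<close>

definition scaled_AL :: "nat \<Rightarrow> (real^2^2) set" where
  "scaled_AL N = {mat2 (l * of_int (e * a)) (l * of_int b) (l * of_int (c * int N)) (l * of_int (e * d)) | l e a b c d.
     l \<noteq> 0 \<and> e > 0 \<and> e dvd int N \<and> (e * a) * (e * d) - b * (c * int N) = e}"

lemma scaled_AL_I:
  fixes e a b c d :: int and l :: real
  assumes "l \<noteq> 0" "e > 0" "e dvd int N" "(e * a) * (e * d) - b * (c * int N) = e"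
  shows "mat2 (l * of_int (e * a)) (l * of_int b) (l * of_int (c * int N)) (l * of_int (e * d)) \<in> scaled_AL N"
  using assms unfolding scaled_AL_def by blast

lemma scaled_AL_det:
  assumes "A \<in> scaled_AL N"
  shows "det A > 0"
proof -
  obtain l e a b c d where A: "A = mat2 (l * of_int (e * a)) (l * of_int b) (l * of_int (c * int N)) (l * of_int (e * d))"
    "l \<noteq> 0" "e > 0" "(e * a) * (e * d) - b * (c * int N) = e"
    using assms unfolding scaled_AL_def by blast
  have "det A = l ^ 2 * of_int ((e * a) * (e * d) - b * (c * int N))"
    by (simp add: A(1) algebra_simps power2_eq_square)
  thus ?thesis using A(2,3) unfolding A(4) by simp
qed

text \<open>With \<open>g = gcd e f\<close> the product of matrices of types \<open>e\<close> and
  \<open>f\<close> has the common factor \<open>g\<close>; pulled out as a scalar, it leaves a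
  matrix of type \<open>(e/g) * (f/g)\<close>. This type divides \<open>N\<close> because
  \<open>lcm e f\<close> does.\<close>

lemma scaled_AL_mult:
  assumes "N > 0" "A \<in> scaled_AL N" "B \<in> scaled_AL N"
  shows "A ** B \<in> scaled_AL N"
proof -
  obtain l e a b c d where A: "A = mat2 (l * of_int (e * a)) (l * of_int b) (l * of_int (c * int N)) (l * of_int (e * d))"
    "l \<noteq> 0" "e > 0" "e dvd int N" "(e * a) * (e * d) - b * (c * int N) = e"
    using assms(2) unfolding scaled_AL_def by blast
  obtain l' f a' b' c' d' where B: "B = mat2 (l' * of_int (f * a')) (l' * of_int b') (l' * of_int (c' * int N)) (l' * of_int (f * d'))"
    "l' \<noteq> 0" "f > 0" "f dvd int N" "(f * a') * (f * d') - b' * (c' * int N) = f"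
    using assms(3) unfolding scaled_AL_def by blast
  define g where "g = gcd e f"
  have g: "g > 0" using A(3) by (simp add: g_def)
  obtain e1 f1 where ef: "e = g * e1" "f = g * f1" "coprime e1 f1"
    using gcd_coprime_exists[of e f] A(3) unfolding g_def by (metis gcd_pos_int less_irrefl mult.commute order_less_irrefl)
  have e1f1: "e1 > 0" "f1 > 0" using A(3) B(3) g ef by (auto simp: zero_less_mult_iff)
  have "lcm e f dvd int N" using A(4) B(4) by (rule lcm_least)
  moreover have "lcm e f = g * e1 * f1"
  proof -
    have "lcm e f * g = e * f" using lcm_mult_gcd[of e f] A(3) B(3) by (simp add: g_def abs_mult)
    hence "lcm e f * g = (g * e1 * f1) * g" by (simp add: ef mult_ac)
    thus ?thesis using g by simp
  qed
  ultimately obtain n where n: "int N = g * e1 * f1 * n" by (metis dvdE)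
  have eq: "A ** B = mat2 ((l * l' * of_int g) * of_int ((e1 * f1) * (g * a * a' + b * c' * n)))
     ((l * l' * of_int g) * of_int (e1 * a * b' + b * f1 * d'))
     ((l * l' * of_int g) * of_int ((c * f1 * a' + e1 * d * c') * int N))
     ((l * l' * of_int g) * of_int ((e1 * f1) * (n * c * b' + g * d * d')))"
    unfolding A(1) B(1) mat2_mult mat2_inject n by (simp add: ef algebra_simps)
  \<comment> \<open>Multiplicativity of the determinant before the scalar \<open>g\<close> is
    removed.\<close>
  have "g ^ 2 * (((e1 * f1) * (g * a * a' + b * c' * n)) * ((e1 * f1) * (n * c * b' + g * d * d'))
      - (e1 * a * b' + b * f1 * d') * ((c * f1 * a' + e1 * d * c') * int N)) =
     ((e * a) * (e * d) - b * (c * int N)) * ((f * a') * (f * d') - b' * (c' * int N))"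
    unfolding n ef by (simp add: algebra_simps power2_eq_square)
  also have "\<dots> = g ^ 2 * (e1 * f1)" unfolding A(5) B(5) by (simp add: ef power2_eq_square)
  finally have det: "((e1 * f1) * (g * a * a' + b * c' * n)) * ((e1 * f1) * (n * c * b' + g * d * d'))
      - (e1 * a * b' + b * f1 * d') * ((c * f1 * a' + e1 * d * c') * int N) = e1 * f1"
    using g by simp
  have "e1 * f1 dvd int N" unfolding n by (metis dvd_triv_left dvd_triv_right dvd_trans mult.assoc)
  thus ?thesis unfolding eq using A(2) B(2) g e1f1 det by (intro scaled_AL_I) auto
qed

lemma scaled_AL_inverse:
  assumes "A \<in> scaled_AL N"
  obtains B where "B \<in> scaled_AL N" "B ** A = mat 1"
proof -
  obtain l e a b c d where A: "A = mat2 (l * of_int (e * a)) (l * of_int b) (l * of_int (c * int N)) (l * of_int (e * d))"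
    "l \<noteq> 0" "e > 0" "e dvd int N" "(e * a) * (e * d) - b * (c * int N) = e"
    using assms unfolding scaled_AL_def by blast
  \<comment> \<open>The inverse is the adjugate over the determinant \<open>l^2 e\<close>; one
    factor \<open>l\<close> cancels against the adjugate.\<close>
  define m where "m = 1 / (l * of_int e)"
  have m: "m \<noteq> 0" "m * (l * of_int e) = 1" using A(2,3) by (auto simp: m_def)
  have "of_int ((e * a) * (e * d) - b * (c * int N)) = (of_int e :: real)" using A(5) by simp
  hence det: "of_int (e * a) * of_int (e * d) - of_int b * of_int (c * int N) = (of_int e :: real)" by simp
  have "mat2 (m * of_int (e * d)) (m * of_int (- b)) (m * of_int (- c * int N)) (m * of_int (e * a)) ** A = mat 1"
  proof -
    have "m * of_int (e * d) * (l * of_int (e * a)) + m * of_int (- b) * (l * of_int (c * int N)) =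
       m * l * (of_int (e * a) * of_int (e * d) - of_int b * of_int (c * int N))"
      by (simp add: algebra_simps)
    moreover have "m * of_int (- c * int N) * (l * of_int b) + m * of_int (e * a) * (l * of_int (e * d)) =
       m * l * (of_int (e * a) * of_int (e * d) - of_int b * of_int (c * int N))"
      by (simp add: algebra_simps)
    ultimately show ?thesis
      unfolding A(1) mat2_mult mat_1_eq_mat2 mat2_inject det using m(2) by (simp add: algebra_simps)
  qed
  moreover have "mat2 (m * of_int (e * d)) (m * of_int (- b)) (m * of_int (- c * int N)) (m * of_int (e * a)) \<in> scaled_AL N"
    using m A by (intro scaled_AL_I) (auto simp: algebra_simps)
  ultimately show ?thesis using that by blast
qed

lemma mat_1_in_scaled_AL: "mat 1 \<in> scaled_AL N"
  using scaled_AL_I[of 1 1 N 1 1 0 0] by (simp add: mat_1_eq_mat2)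

lemma Gamma0_subset_scaled_AL: "Gamma0 N \<subseteq> scaled_AL N"
proof
  fix A assume "A \<in> Gamma0 N"
  then obtain a b c d where "A = mat2 (of_int a) (of_int b) (of_int (c * int N)) (of_int d)"
    "a * d - b * (c * int N) = 1" unfolding Gamma0_def by blast
  thus "A \<in> scaled_AL N" using scaled_AL_I[of 1 1 N a d b c] by simp
qed

lemma AL_matrices_subset_scaled_AL:
  assumes "e dvd N" "N > 0"
  shows "AL_matrices N e \<subseteq> scaled_AL N"
proof
  fix A assume "A \<in> AL_matrices N e"
  then obtain a b c d where A: "A = mat2 (of_int a) (of_int b) (of_int (c * int N)) (of_int d)"
    "int e dvd a" "int e dvd d" "a * d - b * (c * int N) = int e" unfolding AL_matrices_def by blast
  then obtain a' d' where "a = int e * a'" "d = int e * d'" by (auto elim!: dvdE)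
  moreover have "e > 0" using assms by (auto intro: Nat.gr0I)
  ultimately show "A \<in> scaled_AL N" using A assms scaled_AL_I[of 1 "int e" N a' d' b c] by simp
qed

locale AL_group =
  fixes N :: nat and S :: "nat set"
  assumes N: "N \<ge> 1" and S: "\<forall>e\<in>S. hall_divisor e N"
begin

definition \<Gamma> where "\<Gamma> = AL_extension N S"

lemma generators: "Gamma0 N \<union> (\<Union>e\<in>S. AL_matrices N e) \<subseteq> scaled_AL N"
  using S N by (intro Un_least UN_least Gamma0_subset_scaled_AL AL_matrices_subset_scaled_AL)
    (auto simp: hall_divisor_def)

lemma generators_GL2pos: "Gamma0 N \<union> (\<Union>e\<in>S. AL_matrices N e) \<subseteq> carrier GL2pos"
  using generators scaled_AL_det by (auto simp: GL2pos_def)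

lemma subgroup: "subgroup \<Gamma> GL2pos"
  unfolding \<Gamma>_def AL_extension_def
  by (rule group.generate_is_subgroup[OF group_GL2pos generators_GL2pos])

lemma mult_closed: "A \<in> \<Gamma> \<Longrightarrow> B \<in> \<Gamma> \<Longrightarrow> A ** B \<in> \<Gamma>"
  using subgroup.m_closed[OF subgroup, of A B] by (simp add: GL2pos_def)

lemma one_closed: "mat 1 \<in> \<Gamma>"
  using subgroup.one_closed[OF subgroup] by (simp add: GL2pos_def)

lemma det_pos: "A \<in> \<Gamma> \<Longrightarrow> det A > 0"
  using subgroup.subset[OF subgroup] by (auto simp: GL2pos_def)

lemma inverse_exists:
  assumes "A \<in> \<Gamma>"
  obtains B where "B \<in> \<Gamma>" "B ** A = mat 1" "A ** B = mat 1"
proof -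
  have A: "A \<in> carrier GL2pos" using det_pos[OF assms] by (simp add: GL2pos_def)
  have "inv\<^bsub>GL2pos\<^esub> A \<in> \<Gamma>" by (rule subgroup.m_inv_closed[OF subgroup assms])
  moreover have "inv\<^bsub>GL2pos\<^esub> A ** A = mat 1" "A ** inv\<^bsub>GL2pos\<^esub> A = mat 1"
    using group.l_inv[OF group_GL2pos A] group.r_inv[OF group_GL2pos A] by (simp_all add: GL2pos_def)
  ultimately show ?thesis using that by blast
qed

lemma Gamma0_subset: "Gamma0 N \<subseteq> \<Gamma>"
  unfolding \<Gamma>_def AL_extension_def by (auto intro: generate.incl)

lemma \<Gamma>_subset_scaled_AL: "\<Gamma> \<subseteq> scaled_AL N"
proof
  fix A assume "A \<in> \<Gamma>"
  thus "A \<in> scaled_AL N" unfolding \<Gamma>_def AL_extension_def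
  proof (induction rule: generate.induct)
    case one
    show ?case using mat_1_in_scaled_AL by (simp add: GL2pos_def)
  next
    case (incl h)
    thus ?case using generators by blast
  next
    case (inv h)
    hence h: "h \<in> scaled_AL N" using generators by blast
    obtain B where B: "B \<in> scaled_AL N" "B ** h = mat 1" by (rule scaled_AL_inverse[OF h])
    have "inv\<^bsub>GL2pos\<^esub> h = B"
      using B scaled_AL_det[OF h] scaled_AL_det[OF B(1)]
      by (intro group.inv_equality[OF group_GL2pos]) (auto simp: GL2pos_def)
    thus ?case using B by simp
  next
    case (eng h1 h2)
    thus ?case using scaled_AL_mult[of N h1 h2] N by (simp add: GL2pos_def)
  qed
qed

end

section \<open>An invariant form congruent to 1\<close>

lemma summable_fps_stretch:
  fixes A :: "complex fps"
  assumes e: "e > 0" and s: "norm (q ^ e) < fps_conv_radius A"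
  shows "(\<lambda>n. fps_nth (fps_stretch e A) n * q ^ n) sums eval_fps A (q ^ e)"
proof -
  have "(\<lambda>n. fps_nth A n * (q ^ e) ^ n) sums eval_fps A (q ^ e)"
    by (rule sums_eval_fps) (use s in simp)
  also have "(\<lambda>n. fps_nth A n * (q ^ e) ^ n) = (\<lambda>n. (\<lambda>m. fps_nth (fps_stretch e A) m * q ^ m) (e * n))"
    using e by (simp add: fps_stretch_nth power_mult)
  also have "\<dots> sums eval_fps A (q ^ e) \<longleftrightarrow> ?thesis"
  proof (rule sums_mono_reindex)
    show "strict_mono (\<lambda>n. e * n)" using e by (simp add: strict_mono_def)
    show "fps_nth (fps_stretch e A) m * q ^ m = 0" if "m \<notin> range (\<lambda>n. e * n)" for m
    proof -
      have "\<not> e dvd m" using that by (auto simp: dvd_def)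
      thus ?thesis by (simp add: fps_stretch_nth)
    qed
  qed
  finally show ?thesis .
qed

lemma fps_stretch_radius:
  fixes A :: "complex fps"
  assumes "e > 0" "fps_conv_radius A \<ge> 1"
  shows "fps_conv_radius (fps_stretch e A) \<ge> 1"
proof (rule fps_conv_radius_geI)
  fix r :: real assume r: "0 < r" "r < 1"
  have "ereal (norm ((of_real r :: complex) ^ e)) < fps_conv_radius A"
    by (rule less_le_trans[OF _ assms(2)]) (use r assms(1) in \<open>simp add: norm_power power_less_one_iff\<close>)
  from summable_fps_stretch[OF assms(1) this]
  show "summable (\<lambda>n. fps_nth (fps_stretch e A) n * of_real r ^ n)"
    by (rule sums_summable)
qed

lemma eval_fps_stretch:
  fixes A :: "complex fps"
  assumes "e > 0" "norm (q ^ e) < fps_conv_radius A"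
  shows "eval_fps (fps_stretch e A) q = eval_fps A (q ^ e)"
  using summable_fps_stretch[OF assms] by (simp add: eval_fps_def sums_iff)

lemma has_q_expansion_tendsto:
  assumes "has_q_expansion f A"
  shows "(f \<longlongrightarrow> fps_nth A 0) at_ioo"
proof -
  have "0 < fps_conv_radius A" using assms by (simp add: has_q_expansion_def)
  hence "isCont (eval_fps A) 0"
    by (intro continuous_eval_fps) (auto simp: zero_ereal_def)
  hence "(eval_fps A \<longlongrightarrow> eval_fps A 0) (nhds 0)"
    by (simp add: isCont_def tendsto_nhds_iff)
  moreover have "filterlim (\<lambda>z. exp (2 * pi * \<i> * z)) (nhds 0) at_ioo"
    using q_tendsto_0[of 1] by simp
  ultimately have "((\<lambda>z. eval_fps A (exp (2 * pi * \<i> * z))) \<longlongrightarrow> eval_fps A 0) at_ioo"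
    by (rule filterlim_compose)
  moreover have "eventually (\<lambda>z. f z = eval_fps A (exp (2 * pi * \<i> * z))) at_ioo"
    using assms by (simp add: has_q_expansion_def)
  ultimately show ?thesis by (simp only: tendsto_cong eval_fps_at_0)
qed

lemma q_expansion_upper_half_tendsto:
  fixes A :: "complex fps"
  assumes "\<And>z. Im z > 0 \<Longrightarrow> E z = eval_fps A (exp (2 * pi * \<i> * z))" "fps_conv_radius A \<ge> 1"
  shows "(E \<longlongrightarrow> fps_nth A 0) at_ioo"
proof (rule has_q_expansion_tendsto)
  have "fps_conv_radius A > 0" using assms(2) by (rule less_le_trans[rotated]) simp
  thus "has_q_expansion E A"
    unfolding has_q_expansion_def using eventually_upper_half_at_ioo
    by (auto elim!: eventually_mono simp: upper_half_def assms(1))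
qed

lemma Im_divide_of_int: "Im (z / of_int k) = Im z / of_int k"
  by (metis Im_divide_of_real of_real_of_int_eq)

text \<open>Factorises the diagonal matrix \<open>(e, 1)\<close> times the given one into a matrix
  of determinant 1 and an upper triangular one with diagonal \<open>g, D\<close>. This is what moves
  \<open>z \<mapsto> e z\<close> past an element of \<open>SL2Z\<close>.\<close>

lemma hermite_normal_form:
  fixes a b c d e :: int
  assumes "a * d - b * c = 1" "e > 0"
  obtains x y u v g B D where "x * v - y * u = (1::int)" "g > 0" "D > 0"
    "e * a = x * g" "c = u * g" "e * b = x * B + y * D" "d = u * B + v * D"
proof -
  define g where "g = gcd (e * a) c"
  have "e * a * d - e * b * c = e * (a * d - b * c)" by (simp add: algebra_simps)
  hence det: "e * a * d - e * b * c = e" using assms by simp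
  have "\<not> (e * a = 0 \<and> c = 0)" using det assms(2) by auto
  hence g: "g > 0" unfolding g_def by (metis gcd_eq_0_iff gcd_ge_0_int order_le_less)
  obtain x u where xu: "e * a = x * g" "c = u * g" "coprime x u"
    using gcd_coprime_exists[of "e * a" c] g unfolding g_def by auto
  obtain s t where st: "s * x + t * u = 1"
    using xu(3) bezout_int[of x u] by (metis coprime_iff_gcd_eq_1)
  define B where "B = s * (e * b) + t * d"
  define D where "D = x * d - u * (e * b)"
  have gD: "g * D = e" using det unfolding D_def xu(1) xu(2) by (simp add: algebra_simps xu)
  have "D > 0" using gD g assms(2) by (metis zero_less_mult_pos)
  moreover have "x * B + (- t) * D = (s * x + t * u) * (e * b)"
    unfolding B_def D_def by (simp add: algebra_simps)
  moreover have "u * B + s * D = (s * x + t * u) * d"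
    unfolding B_def D_def by (simp add: algebra_simps)
  moreover have "x * s - (- t) * u = 1" using st by (simp add: algebra_simps)
  ultimately show ?thesis using that[of x s "- t" u g D B] g xu st by simp
qed

text \<open>By the normal form \<open>e * \<sigma> z\<close> is the image of
  \<open>w = (g z + B)/D\<close> under \<open>SL2Z\<close>, so the slashed function is
  \<open>E(w)\<close> up to a constant, and \<open>w\<close> tends to i infinity with
  \<open>z\<close>.\<close>

lemma level_one_cusp_limit:
  fixes E :: "complex \<Rightarrow> complex"
  assumes mod: "\<And>a b c d :: int. \<And>z. a * d - b * c = 1 \<Longrightarrow> Im z > 0 \<Longrightarrow>
        E ((of_int a * z + of_int b) / (of_int c * z + of_int d)) = (of_int c * z + of_int d) ^ (2 * M) * E z"
    and lim: "(E \<longlongrightarrow> L) at_ioo" and e: "e > 0" and \<sigma>: "\<sigma> \<in> SL2Z"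
  shows "\<exists>L'. (slash (2 * int M) (\<lambda>z. E (of_nat e * z)) \<sigma> \<longlongrightarrow> L') at_ioo"
proof -
  obtain a b c d :: int where s: "\<sigma> = mat2 (of_int a) (of_int b) (of_int c) (of_int d)" "a * d - b * c = 1"
    using \<sigma> unfolding SL2Z_def by blast
  have det: "det \<sigma> = 1"
  proof -
    have "det \<sigma> = of_int (a * d - b * c)" by (simp add: s(1))
    thus ?thesis unfolding s(2) by simp
  qed
  have "int e > 0" using e by simp
  then obtain x y u v g B D where h: "x * v - y * u = (1::int)" "g > 0" "D > 0"
    "int e * a = x * g" "c = u * g" "int e * b = x * B + y * D" "d = u * B + v * D"
    by (rule hermite_normal_form[OF s(2)])
  define w where "w = (\<lambda>z::complex. (of_int g * z + of_int B) / of_int D)"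
  have D0: "of_int D \<noteq> (0::complex)" using h by simp
  have slash: "slash (2 * int M) (\<lambda>z. E (of_nat e * z)) \<sigma> z = E (w z) / of_int D ^ (2 * M)" if z: "z \<in> upper_half" for z
  proof -
    define J where "J = of_int c * z + of_int d"
    have J: "J \<noteq> 0" using cocycle_nonzero[of \<sigma> z] det z by (simp add: s(1) J_def)
    have wz: "Im (w z) > 0"
      using z h by (simp add: w_def upper_half_def Im_divide_of_int)
    have w1: "of_int x * w z + of_int y = (of_nat e * (of_int a * z + of_int b)) / of_int D"
    proof -
      have "of_int x * w z + of_int y = ((of_int x * of_int g) * z + (of_int x * of_int B + of_int y * of_int D)) / of_int D"
        using D0 by (simp add: w_def add_divide_distrib ring_distribs)
      also have "of_int x * of_int g = (of_int (int e * a) :: complex)" unfolding h by simp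
      also have "of_int x * of_int B + of_int y * of_int D = (of_int (int e * b) :: complex)" unfolding h by simp
      finally show ?thesis by (simp add: algebra_simps)
    qed
    have w2: "of_int u * w z + of_int v = J / of_int D"
    proof -
      have "of_int u * w z + of_int v = ((of_int u * of_int g) * z + (of_int u * of_int B + of_int v * of_int D)) / of_int D"
        using D0 by (simp add: w_def add_divide_distrib ring_distribs)
      also have "of_int u * of_int g = (of_int c :: complex)" unfolding h by simp
      also have "of_int u * of_int B + of_int v * of_int D = (of_int d :: complex)" unfolding h by simp
      finally show ?thesis by (simp add: J_def)
    qed
    have "of_nat e * moebius \<sigma> z = (of_int x * w z + of_int y) / (of_int u * w z + of_int v)"
      using D0 J unfolding w1 w2 s(1) moebius_mat2 by (simp add: J_def)
    hence "E (of_nat e * moebius \<sigma> z) = (J / of_int D) ^ (2 * M) * E (w z)"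
      using mod[OF h(1) wz] by (simp add: w2)
    moreover have "slash (2 * int M) (\<lambda>z. E (of_nat e * z)) \<sigma> z = 1 / J ^ (2 * M) * E (of_nat e * moebius \<sigma> z)"
      using det by (subst slash_even) (simp_all add: s(1) J_def)
    ultimately show ?thesis using J by (simp add: power_divide)
  qed
  have "filterlim (\<lambda>z. real_of_int g / real_of_int D * Im z + 0) at_top at_ioo"
    by (rule filterlim_compose[OF _ filterlim_Im_at_ioo]) (use h in real_asymp)
  hence "filterlim w at_ioo at_ioo"
    unfolding filterlim_at_ioo_iff using h by (simp add: w_def Im_divide_of_int)
  from filterlim_compose[OF lim this]
  have "((\<lambda>z. E (w z) / of_int D ^ (2 * M)) \<longlongrightarrow> L / of_int D ^ (2 * M)) at_ioo"
    by (intro tendsto_divide tendsto_const) (use D0 in auto)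
  moreover have "eventually (\<lambda>z. E (w z) / of_int D ^ (2 * M) = slash (2 * int M) (\<lambda>z. E (of_nat e * z)) \<sigma> z) at_ioo"
    using eventually_upper_half_at_ioo by eventually_elim (simp add: slash)
  ultimately show ?thesis by (blast intro: Lim_transform_eventually)
qed

text \<open>A matrix of type \<open>e\<close> is a scalar times an element of \<open>SL2Z\<close>
  times the diagonal matrix \<open>(e, 1)\<close>. The scalar disappears in the normalised slash
  operator, the second factor by level one invariance, and the last contributes
  \<open>e^M * E(e z)\<close>.\<close>

lemma level_one_slash_scaled_AL:
  fixes E :: "complex \<Rightarrow> complex"
  assumes mod: "\<And>a b c d :: int. \<And>z. a * d - b * c = 1 \<Longrightarrow> Im z > 0 \<Longrightarrow>
        E ((of_int a * z + of_int b) / (of_int c * z + of_int d)) = (of_int c * z + of_int d) ^ (2 * M) * E z"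
    and A: "A \<in> scaled_AL N" and N: "N > 0"
  shows "\<exists>e. e > 0 \<and> e dvd N \<and> (\<forall>z\<in>upper_half. slash (2 * int M) E A z = of_nat e ^ M * E (of_nat e * z))"
proof -
  obtain l e a b c d where A': "A = mat2 (l * of_int (e * a)) (l * of_int b) (l * of_int (c * int N)) (l * of_int (e * d))"
    "l \<noteq> 0" "e > 0" "e dvd int N" "(e * a) * (e * d) - b * (c * int N) = e"
    using A unfolding scaled_AL_def by blast
  obtain n where n: "int N = e * n" using A'(4) by blast
  have "e * (a * (e * d) - b * (c * n)) = e * 1" using A'(5) unfolding n by (simp add: algebra_simps)
  hence det1: "a * (e * d) - b * (c * n) = 1" using A'(3) by (metis mult_cancel_left less_irrefl)
  have "det A = l ^ 2 * of_int ((e * a) * (e * d) - b * (c * int N))"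
    by (simp add: A'(1) algebra_simps power2_eq_square)
  hence detA: "det A = l ^ 2 * of_int e" unfolding A'(5) .
  have "slash (2 * int M) E A z = of_nat (nat e) ^ M * E (of_nat (nat e) * z)" if z: "z \<in> upper_half" for z
  proof -
    define J where "J = of_int (c * int N) * z + of_int (e * d)"
    have coc: "cocycle A z = of_real l * J"
      by (simp add: A'(1) J_def algebra_simps)
    have J: "J \<noteq> 0" using cocycle_nonzero[of A z] z A'(2,3) unfolding coc detA by auto
    have "moebius A z = (of_int (e * a) * z + of_int b) / J"
      using A'(2) J unfolding A'(1) moebius_mat2 J_def
      by (simp add: mult.assoc flip: distrib_left)
    also have "\<dots> = (of_int a * (of_int e * z) + of_int b) / (of_int (c * n) * (of_int e * z) + of_int (e * d))"
      unfolding J_def n by (simp add: mult_ac)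
    finally have mz: "moebius A z = (of_int a * (of_int e * z) + of_int b) / (of_int (c * n) * (of_int e * z) + of_int (e * d))" .
    have "Im (of_int e * z) > 0" using z A'(3) by (simp add: upper_half_def)
    from mod[OF det1 this] have "E (moebius A z) = J ^ (2 * M) * E (of_int e * z)"
      unfolding mz by (simp add: J_def n mult_ac)
    moreover have "det A > 0" using A'(2,3) by (simp add: detA)
    ultimately show ?thesis
      using J A'(2,3) by (simp add: slash_even coc detA power_mult_distrib power_mult)
  qed
  moreover have "nat e dvd N" using A'(3,4) by (metis int_dvd_int_iff int_nat_eq order_less_imp_le)
  ultimately show ?thesis using A'(3) by (intro exI[of _ "nat e"]) auto
qed


text \<open>By Euler's theorem the sum is congruent modulo \<open>p ^ Suc N\<close> to the number of elements of \<open>H\<close> prime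
  to \<open>p\<close>, which lies between 1 and \<open>N\<close>.\<close>

lemma sum_prime_powers_valuation:
  fixes H :: "nat set"
  assumes p: "Factorial_Ring.prime p" and H: "finite H" "1 \<in> H" "card H \<le> N" "\<And>e. e \<in> H \<Longrightarrow> e > 0"
    and i: "i \<ge> N"
  obtains v u where "(\<Sum>e\<in>H. e ^ ((p - 1) * p ^ i)) = p ^ v * u" "\<not> p dvd u" "v \<le> N"
proof -
  define C where "C = (\<Sum>e\<in>H. e ^ ((p - 1) * p ^ i))"
  define P where "P = {e\<in>H. \<not> p dvd e}"
  have p1: "p > 1" using p prime_gt_1_nat by blast
  have C0: "C > 0" using H unfolding C_def by (intro sum_pos) auto
  have "int p ^ Suc N dvd int (e ^ ((p - 1) * p ^ i)) - (if p dvd e then 0 else 1)" for e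
  proof (cases "p dvd e")
    case True
    have "Suc i \<le> p ^ i" using p1 power_gt_expt[of p i] by simp
    also have "\<dots> \<le> (p - 1) * p ^ i" using p1 by simp
    finally have "Suc N \<le> (p - 1) * p ^ i" using i by simp
    hence "p ^ Suc N dvd p ^ ((p - 1) * p ^ i)" by (rule le_imp_power_dvd)
    also have "\<dots> dvd e ^ ((p - 1) * p ^ i)" using True by (rule dvd_power_same)
    finally have "int (p ^ Suc N) dvd int (e ^ ((p - 1) * p ^ i))" by (simp only: int_dvd_int_iff)
    thus ?thesis using True by simp
  next
    case False
    hence "[e ^ (p - 1) = 1] (mod p)" using p by (intro fermat_theorem)
    hence "[int (e ^ (p - 1)) = int 1] (mod int p)" by (simp only: cong_int_iff)
    hence "of_nat p dvd int e ^ (p - 1) - 1" by (simp add: cong_iff_dvd_diff)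
    from power_prime_congruence_iterated[OF this, of i]
    have "int p ^ Suc i dvd int (e ^ ((p - 1) * p ^ i)) - 1"
      by (simp add: power_mult)
    moreover have "int p ^ Suc N dvd int p ^ Suc i" using i by (intro le_imp_power_dvd) simp
    ultimately show ?thesis using False dvd_trans by auto
  qed
  hence "int p ^ Suc N dvd (\<Sum>e\<in>H. int (e ^ ((p - 1) * p ^ i)) - (if p dvd e then 0 else 1))"
    by (intro dvd_sum) auto
  also have "(\<Sum>e\<in>H. int (e ^ ((p - 1) * p ^ i)) - (if p dvd e then 0 else 1)) = int C - int (card P)"
  proof -
    have "(\<Sum>e\<in>H. (if p dvd e then 0 else 1 :: int)) = (\<Sum>e\<in>P. 1)"
      unfolding P_def by (rule sum.mono_neutral_cong_right) (use H in auto)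
    thus ?thesis by (simp add: sum_subtractf C_def)
  qed
  finally have cong: "int p ^ Suc N dvd int C - int (card P)" .
  have "1 \<in> P" using H p1 by (simp add: P_def)
  hence P0: "card P > 0" using H by (auto simp: P_def card_gt_0_iff)
  have "card P \<le> card H" using H by (intro card_mono) (auto simp: P_def)
  also have "\<dots> < p ^ Suc N" using H(3) p1 power_gt_expt[of p "Suc N"] by simp
  finally have P1: "card P < p ^ Suc N" .
  have nd: "\<not> p ^ Suc N dvd C"
  proof
    assume "p ^ Suc N dvd C"
    hence "int p ^ Suc N dvd int C" by (metis int_dvd_int_iff of_nat_power)
    hence "int p ^ Suc N dvd int (card P)" using cong by (metis dvd_diff diff_diff_eq2 add_diff_cancel_left')
    hence "p ^ Suc N dvd card P" by (metis int_dvd_int_iff of_nat_power)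
    thus False using P0 P1 by (auto dest: dvd_imp_le)
  qed
  obtain u where u: "C = p ^ multiplicity p C * u" "\<not> p dvd u"
    using multiplicity_decompose'[of C p] C0 p1 by auto
  have "multiplicity p C \<le> N"
  proof (rule ccontr)
    assume "\<not> multiplicity p C \<le> N"
    hence "p ^ Suc N dvd C" by (intro multiplicity_dvd') auto
    thus False using nd by simp
  qed
  thus ?thesis using that[of "multiplicity p C" u] u unfolding C_def by blast
qed

lemma tendsto_slash_sum:
  assumes "finite H" "\<And>e. e \<in> H \<Longrightarrow> \<exists>L. (slash k (f e) \<sigma> \<longlongrightarrow> L) at_ioo"
  shows "\<exists>L. (slash k (\<lambda>z. \<Sum>e\<in>H. c e * f e z) \<sigma> \<longlongrightarrow> L) at_ioo"
proof -
  obtain L where L: "\<And>e. e \<in> H \<Longrightarrow> (slash k (f e) \<sigma> \<longlongrightarrow> L e) at_ioo" using assms(2) by metis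
  have "((\<lambda>z. \<Sum>e\<in>H. c e * slash k (f e) \<sigma> z) \<longlongrightarrow> (\<Sum>e\<in>H. c e * L e)) at_ioo"
    by (intro tendsto_sum tendsto_mult tendsto_const L)
  also have "(\<lambda>z. \<Sum>e\<in>H. c e * slash k (f e) \<sigma> z) = slash k (\<lambda>z. \<Sum>e\<in>H. c e * f e z) \<sigma>"
    by (simp add: slash_def sum_distrib_left fun_eq_iff mult_ac)
  finally show ?thesis by blast
qed

context AL_group
begin

text \<open>\<open>H\<close> records which functions \<open>f e\<close> occur among the transforms
  of \<open>E\<close>. Slashing by an element of the group permutes these transforms, and different
  indices give different functions, so it permutes \<open>H\<close> and fixes the sum.\<close>

lemma level_one_permutation:
  fixes E :: "complex \<Rightarrow> complex"
  assumes mod: "\<And>a b c d :: int. \<And>z. a * d - b * c = 1 \<Longrightarrow> Im z > 0 \<Longrightarrow>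
        E ((of_int a * z + of_int b) / (of_int c * z + of_int d)) = (of_int c * z + of_int d) ^ (2 * M) * E z"
    and lim: "(E \<longlongrightarrow> 1) at_ioo" and M: "M > 0"
  defines "f \<equiv> \<lambda>e z. of_nat e ^ M * E (of_nat e * z)"
  defines "H \<equiv> {e\<in>{1..N}. e dvd N \<and> (\<exists>\<gamma>\<in>\<Gamma>. \<forall>z\<in>upper_half. slash (2 * int M) E \<gamma> z = f e z)}"
  shows "finite H" "1 \<in> H" "card H \<le> N"
    "\<gamma> \<in> \<Gamma> \<Longrightarrow> z \<in> upper_half \<Longrightarrow> slash (2 * int M) (\<lambda>z. \<Sum>e\<in>H. f e z) \<gamma> z = (\<Sum>e\<in>H. f e z)"
proof -
  show fin: "finite H" unfolding H_def by simp
  have "card H \<le> card {1..N}" unfolding H_def by (rule card_mono) auto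
  thus "card H \<le> N" by simp
  have det1: "det (mat 1 :: real^2^2) = 1" by simp
  have "slash (2 * int M) E (mat 1) z = f 1 z" for z
    using slash_even[of "mat 1" M E z] by (simp add: f_def) (simp add: mat_1_eq_mat2)
  thus "1 \<in> H" using N one_closed by (auto simp: H_def)
  \<comment> \<open>The limit of \<open>f e\<close> at i infinity is \<open>e^M\<close>, which
    determines \<open>e\<close>.\<close>
  have inj_f: "e = e'" if "e > 0" "e' > 0" "\<And>z. z \<in> upper_half \<Longrightarrow> f e z = f e' z" for e e' :: nat
  proof -
    have lim_f: "(f e \<longlongrightarrow> of_nat e ^ M * 1) at_ioo" if e: "e > 0" for e
    proof -
      have "filterlim (\<lambda>z. real e * Im z) at_top at_ioo"
        by (rule filterlim_compose[OF _ filterlim_Im_at_ioo]) (use e in real_asymp)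
      hence "filterlim (\<lambda>z. of_nat e * z) at_ioo at_ioo"
        unfolding filterlim_at_ioo_iff by simp
      from filterlim_compose[OF lim this] show ?thesis
        unfolding f_def by (intro tendsto_mult tendsto_const)
    qed
    have "eventually (\<lambda>z. f e z = f e' z) at_ioo"
      using eventually_upper_half_at_ioo by eventually_elim (rule that)
    hence "(f e' \<longlongrightarrow> of_nat e ^ M * 1) at_ioo"
      using lim_f[OF that(1)] by (simp only: tendsto_cong)
    hence "of_nat e ^ M * 1 = (of_nat e' ^ M * 1 :: complex)"
      using lim_f[OF that(2)] at_ioo_not_bot tendsto_unique by blast
    hence "of_nat (e ^ M) = (of_nat (e' ^ M) :: complex)" by simp
    hence "e ^ M = e' ^ M" by (simp only: of_nat_eq_iff)
    thus ?thesis using M by (simp add: power_eq_iff_eq_base)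
  qed
  assume \<gamma>: "\<gamma> \<in> \<Gamma>" and z: "z \<in> upper_half"
  have "\<exists>e'. e' \<in> H \<and> (\<forall>z\<in>upper_half. slash (2 * int M) (f e) \<gamma> z = f e' z)" if e: "e \<in> H" for e
  proof -
    obtain \<delta> where \<delta>: "\<delta> \<in> \<Gamma>" "\<And>z. z \<in> upper_half \<Longrightarrow> slash (2 * int M) E \<delta> z = f e z"
      using e unfolding H_def by blast
    have prod: "\<delta> ** \<gamma> \<in> \<Gamma>" using \<delta> \<gamma> by (intro mult_closed)
    obtain e' where e': "e' > 0" "e' dvd N" "\<And>z. z \<in> upper_half \<Longrightarrow> slash (2 * int M) E (\<delta> ** \<gamma>) z = f e' z"
      using level_one_slash_scaled_AL[OF mod, of "\<delta> ** \<gamma>" N] prod \<Gamma>_subset_scaled_AL N unfolding f_def by auto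
    have "slash (2 * int M) (f e) \<gamma> z = f e' z" if z: "z \<in> upper_half" for z
    proof -
      have "slash (2 * int M) (f e) \<gamma> z = slash (2 * int M) (slash (2 * int M) E \<delta>) \<gamma> z"
        unfolding slash_def[of _ _ \<gamma>] using \<delta>(2)[OF moebius_upper_half[OF det_pos[OF \<gamma>] z]] by simp
      also have "\<dots> = f e' z"
        using slash_slash[OF det_pos[OF \<delta>(1)] det_pos[OF \<gamma>] z] e'(3)[OF z] by simp
      finally show ?thesis .
    qed
    moreover have "e' \<le> N" using e'(2) N by (intro dvd_imp_le) auto
    ultimately show ?thesis using e' prod by (auto simp: H_def Suc_le_eq)
  qed
  then obtain \<pi> where \<pi>: "\<And>e. e \<in> H \<Longrightarrow> \<pi> e \<in> H"
    "\<And>e z. e \<in> H \<Longrightarrow> z \<in> upper_half \<Longrightarrow> slash (2 * int M) (f e) \<gamma> z = f (\<pi> e) z" by metis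
  have "inj_on \<pi> H"
  proof (rule inj_onI)
    fix e e' assume e: "e \<in> H" "e' \<in> H" "\<pi> e = \<pi> e'"
    show "e = e'"
    proof (rule inj_f)
      fix w assume w: "w \<in> upper_half"
      \<comment> \<open>Slashing by \<open>\<gamma>\<close> loses no information: the value at
        \<open>w\<close> is read off at the preimage of \<open>w\<close> under
        \<open>\<gamma>\<close>.\<close>
      obtain \<delta> where \<delta>: "\<delta> \<in> \<Gamma>" "\<gamma> ** \<delta> = mat 1" using inverse_exists[OF \<gamma>] by blast
      define z where "z = moebius \<delta> w"
      have z: "z \<in> upper_half" unfolding z_def by (intro moebius_upper_half det_pos \<delta> w)
      have wz: "moebius \<gamma> z = w"
        unfolding z_def using moebius_mult_upper_half[OF det_pos[OF \<delta>(1)] w, of \<gamma>] by (simp add: \<delta>(2))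
      have "slash (2 * int M) (f e) \<gamma> z = slash (2 * int M) (f e') \<gamma> z"
        using \<pi>(2)[OF e(1) z] \<pi>(2)[OF e(2) z] e(3) by simp
      moreover have "cocycle \<gamma> z \<noteq> 0" using det_pos[OF \<gamma>] z by (intro cocycle_nonzero) auto
      ultimately show "f e w = f e' w"
        using det_pos[OF \<gamma>] by (simp add: slash_even wz)
    qed (use e in \<open>auto simp: H_def\<close>)
  qed
  hence bij: "bij_betw \<pi> H H"
    using fin \<pi>(1) by (metis bij_betw_def endo_inj_surj image_subsetI)
  have "slash (2 * int M) (\<lambda>z. \<Sum>e\<in>H. f e z) \<gamma> z = (\<Sum>e\<in>H. slash (2 * int M) (f e) \<gamma> z)"
    by (simp add: slash_def sum_distrib_left)
  also have "\<dots> = (\<Sum>e\<in>H. f (\<pi> e) z)" using \<pi>(2)[OF _ z] by (intro sum.cong) auto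
  also have "\<dots> = (\<Sum>e\<in>H. f e z)" by (rule sum.reindex_bij_betw[OF bij])
  finally show "slash (2 * int M) (\<lambda>z. \<Sum>e\<in>H. f e z) \<gamma> z = (\<Sum>e\<in>H. f e z)" .
qed

theorem invariant_form_exists:
  assumes p: "Factorial_Ring.prime p"
  obtains M i :: nat and E :: "complex \<Rightarrow> complex" and A :: "complex fps" and D :: int where
    "M = (p - 1) * p ^ i" "even M"
    "E holomorphic_on upper_half"
    "\<And>\<gamma> z. \<gamma> \<in> \<Gamma> \<Longrightarrow> z \<in> upper_half \<Longrightarrow> slash (2 * int M) E \<gamma> z = E z"
    "\<And>\<sigma>. \<sigma> \<in> SL2Z \<Longrightarrow> \<exists>L. (slash (2 * int M) E \<sigma> \<longlongrightarrow> L) at_ioo"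
    "fps_conv_radius A \<ge> 1"
    "\<And>z. z \<in> upper_half \<Longrightarrow> E z = eval_fps A (exp (2 * pi * \<i> * z))"
    "fps_nth A 0 = 1" "coprime D (int p)"
    "\<And>n. n > 0 \<Longrightarrow> \<exists>u::int. of_int D * fps_nth A n = of_int (int p * u)"
proof -
  have p1: "p > 1" using p prime_gt_1_nat by blast
  obtain E :: "complex \<Rightarrow> complex" and A :: "complex fps" and D :: int and i :: nat where
    mod: "\<And>a b c d :: int. \<And>z. a * d - b * c = 1 \<Longrightarrow> Im z > 0 \<Longrightarrow>
        E ((of_int a * z + of_int b) / (of_int c * z + of_int d)) =
          (of_int c * z + of_int d) ^ (2 * ((p - 1) * p ^ i)) * E z"
    and r: "fps_conv_radius A \<ge> 1"
    and EA: "\<And>z. Im z > 0 \<Longrightarrow> E z = eval_fps A (exp (2 * pi * \<i> * z))"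
    and A0: "fps_nth A 0 = 1" and D: "coprime D (int p)" and i: "i \<ge> N"
    and DA: "\<And>n. n > 0 \<Longrightarrow> \<exists>u::int. of_int D * fps_nth A n = of_int (int p ^ Suc N * u)"
    using level_one_form_exists[OF p, of N] by metis
  define M where "M = (p - 1) * p ^ i"
  have M: "M > 0" "even M"
  proof -
    show "M > 0" using p1 by (simp add: M_def)
    show "even M"
    proof (cases "p = 2")
      case True
      \<comment> \<open>For \<open>p = 2\<close> the factor \<open>p - 1\<close> is odd, and
        \<open>i \<ge> N \<ge> 1\<close> provides the even factor.\<close>
      thus ?thesis using i N by (simp add: M_def)
    next
      case False
      hence "odd p" using p p1 by (intro prime_odd_nat) auto
      thus ?thesis by (simp add: M_def)
    qed
  qed
  note mod' = mod[folded M_def]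
  have lim: "(E \<longlongrightarrow> 1) at_ioo" using q_expansion_upper_half_tendsto[OF EA r] A0 by simp
  define f where "f = (\<lambda>e z. of_nat e ^ M * E (of_nat e * z))"
  define H where "H = {e\<in>{1..N}. e dvd N \<and> (\<exists>\<gamma>\<in>\<Gamma>. \<forall>z\<in>upper_half. slash (2 * int M) E \<gamma> z = f e z)}"
  note perm' = level_one_permutation[OF mod' lim M(1)]
  have perm: "finite H" "1 \<in> H" "card H \<le> N"
    "\<And>\<gamma> z. \<gamma> \<in> \<Gamma> \<Longrightarrow> z \<in> upper_half \<Longrightarrow> slash (2 * int M) (\<lambda>z. \<Sum>e\<in>H. f e z) \<gamma> z = (\<Sum>e\<in>H. f e z)"
  proof -
    show "finite H" unfolding H_def f_def by (rule perm'(1))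
    show "1 \<in> H" unfolding H_def f_def by (rule perm'(2))
    show "card H \<le> N" unfolding H_def f_def by (rule perm'(3))
    show "slash (2 * int M) (\<lambda>z. \<Sum>e\<in>H. f e z) \<gamma> z = (\<Sum>e\<in>H. f e z)"
      if "\<gamma> \<in> \<Gamma>" "z \<in> upper_half" for \<gamma> z
      unfolding H_def f_def by (rule level_one_permutation(4)[OF _ lim M(1) that]) (rule mod')
  qed
  have Hpos: "e > 0" if "e \<in> H" for e using that by (simp add: H_def)
  obtain v u where vu: "(\<Sum>e\<in>H. e ^ M) = p ^ v * u" "\<not> p dvd u" "v \<le> N"
    by (rule sum_prime_powers_valuation[OF p perm(1-3) Hpos i, folded M_def])
  define C where "C = (\<Sum>e\<in>H. e ^ M)"
  have C: "C > 0" using perm(1,2) Hpos unfolding C_def by (intro sum_pos) auto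
  define F where "F = (\<lambda>z. (\<Sum>e\<in>H. f e z) / of_nat C)"
  define B where "B = fps_const (1 / of_nat C) * (\<Sum>e\<in>H. fps_const (of_nat e ^ M) * fps_stretch e A)"
  have rsum: "fps_conv_radius (\<Sum>e\<in>H'. fps_const (of_nat e ^ M) * fps_stretch e A) \<ge> 1" if "H' \<subseteq> H" for H'
  proof -
    have "finite H'" using that perm(1) finite_subset by blast
    thus ?thesis using that
    proof (induction H')
      case (insert e H')
      have "1 \<le> fps_conv_radius (fps_const (of_nat e ^ M) * fps_stretch e A)"
        using fps_stretch_radius[OF Hpos r, of e] insert.prems
          fps_conv_radius_mult[of "fps_const (of_nat e ^ M)" "fps_stretch e A"] by (auto intro: order_trans)
      moreover have "1 \<le> fps_conv_radius (\<Sum>e\<in>H'. fps_const (of_nat e ^ M) * fps_stretch e A)"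
        using insert by auto
      ultimately show ?case using insert.hyps
        by (simp add: order_trans[OF _ fps_conv_radius_add])
    qed auto
  qed
  have rB: "fps_conv_radius B \<ge> 1"
    unfolding B_def using rsum[of H] fps_conv_radius_mult[of "fps_const (1 / of_nat C)"
        "\<Sum>e\<in>H. fps_const (of_nat e ^ M) * fps_stretch e A"] by (auto intro: order_trans)
  have FB: "F z = eval_fps B (exp (2 * pi * \<i> * z))" if z: "z \<in> upper_half" for z
  proof -
    define q where "q = exp (2 * pi * \<i> * z)"
    have q: "norm q < 1" using z unfolding q_def by (intro norm_q_less_1) (simp add: upper_half_def)
    hence q1: "ereal (norm q) < 1" by simp
    have fe: "f e z = eval_fps (fps_const (of_nat e ^ M) * fps_stretch e A) q" if e: "e \<in> H" for e
    proof -
      have "Im (of_nat e * z) > 0" using z Hpos[OF e] by (simp add: upper_half_def)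
      hence "E (of_nat e * z) = eval_fps A (exp (2 * pi * \<i> * (of_nat e * z)))" by (rule EA)
      also have "exp (2 * pi * \<i> * (of_nat e * z)) = q ^ e"
        unfolding q_def by (subst exp_of_nat_mult [symmetric]) (simp add: mult_ac)
      also have "eval_fps A (q ^ e) = eval_fps (fps_stretch e A) q"
        using q Hpos[OF e] r
        by (subst eval_fps_stretch) (auto simp: norm_power power_less_one_iff intro!: less_le_trans[OF _ r])
      finally show ?thesis unfolding f_def
        by (subst eval_fps_mult) (auto intro: less_le_trans[OF q1 fps_stretch_radius[OF Hpos[OF e] r]])
    qed
    have "(\<Sum>e\<in>H'. f e z) = eval_fps (\<Sum>e\<in>H'. fps_const (of_nat e ^ M) * fps_stretch e A) q" if "H' \<subseteq> H" for H'
    proof -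
      have "finite H'" using that perm(1) finite_subset by blast
      thus ?thesis using that
      proof (induction H')
        case (insert e H')
        have "1 \<le> fps_conv_radius (fps_const (of_nat e ^ M) * fps_stretch e A)"
          using rsum[of "{e}"] insert.prems by simp
        thus ?case using insert fe rsum[of H']
          by (simp add: eval_fps_add less_le_trans[OF q1])
      qed auto
    qed
    from this[of H] show ?thesis unfolding F_def B_def q_def [symmetric]
      by (subst eval_fps_mult) (auto intro: less_le_trans[OF q1 rsum])
  qed
  have nthB: "fps_nth B n = (\<Sum>e\<in>H. of_nat e ^ M * fps_nth (fps_stretch e A) n) / of_nat C" for n
    by (simp add: B_def fps_sum_nth)
  have hol: "(\<lambda>z. eval_fps B (exp (2 * pi * \<i> * z))) holomorphic_on upper_half"
  proof -
    have 1: "(\<lambda>z. exp (2 * pi * \<i> * z)) holomorphic_on upper_half" by (intro holomorphic_intros)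
    have "ball (0::complex) 1 \<subseteq> eball 0 (fps_conv_radius B)"
    proof
      fix x :: complex assume "x \<in> ball 0 1"
      hence "ereal (norm x) < 1" by simp
      from less_le_trans[OF this rB] show "x \<in> eball 0 (fps_conv_radius B)"
        by (simp add: in_eball_iff)
    qed
    hence 2: "eval_fps B holomorphic_on ball 0 1" by (rule holomorphic_on_eval_fps)
    have 3: "(\<lambda>z. exp (2 * pi * \<i> * z)) ` upper_half \<subseteq> ball 0 1"
      unfolding upper_half_def image_subset_iff mem_ball dist_0_norm
      by (intro ballI norm_q_less_1) simp
    show ?thesis using holomorphic_on_compose_gen[OF 1 2 3] unfolding o_def .
  qed
  show ?thesis
  \<comment> \<open>The part \<open>u\<close> of \<open>C\<close> prime to \<open>p\<close> joins
    the denominator; the part \<open>p^v\<close> is absorbed by the surplus precision.\<close>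
  proof (rule that[of M i F B "D * int u"])
    show "F holomorphic_on upper_half"
      by (rule holomorphic_transform[OF hol]) (simp add: FB)
    show "slash (2 * int M) F \<gamma> z = F z" if "\<gamma> \<in> \<Gamma>" "z \<in> upper_half" for \<gamma> z
      using perm(4)[OF that] by (simp add: F_def slash_def)
    show "\<exists>L. (slash (2 * int M) F \<sigma> \<longlongrightarrow> L) at_ioo" if "\<sigma> \<in> SL2Z" for \<sigma>
    proof -
      have "\<exists>L. (slash (2 * int M) (\<lambda>z. \<Sum>e\<in>H. (of_nat e ^ M / of_nat C) * E (of_nat e * z)) \<sigma> \<longlongrightarrow> L) at_ioo"
        by (rule tendsto_slash_sum[OF perm(1)]) (rule level_one_cusp_limit[OF mod' lim Hpos that])
      thus ?thesis by (simp add: F_def f_def sum_divide_distrib)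
    qed
    have "fps_nth B 0 = of_nat C / of_nat C"
      unfolding nthB by (simp add: fps_stretch_nth A0 C_def)
    thus "fps_nth B 0 = 1" using C by simp
    show "M = (p - 1) * p ^ i" by (rule M_def)
    show "even M" by (rule M(2))
    show "fps_conv_radius B \<ge> 1" by (rule rB)
    show "F z = eval_fps B (exp (2 * pi * \<i> * z))" if "z \<in> upper_half" for z by (rule FB[OF that])
    have "coprime (int u) (int p)"
      using vu(2) p by (metis coprime_commute coprime_int_iff prime_imp_coprime)
    thus "coprime (D * int u) (int p)" using D by simp
    fix n :: nat assume n: "n > 0"
    have "\<exists>w::int. of_int D * fps_nth (fps_stretch e A) n = of_int (int p ^ Suc N * w)" if "e \<in> H" for e
    proof (cases "e dvd n")
      case True
      hence "n div e > 0" using n Hpos[OF that] by (auto elim!: dvdE)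
      thus ?thesis using DA[of "n div e"] True by (simp add: fps_stretch_nth)
    qed (auto simp: fps_stretch_nth intro!: exI[of _ 0])
    then obtain w where w: "\<And>e. e \<in> H \<Longrightarrow> of_int D * fps_nth (fps_stretch e A) n = of_int (int p ^ Suc N * w e)"
      by metis
    define W where "W = (\<Sum>e\<in>H. int e ^ M * w e)"
    have "of_int D * (\<Sum>e\<in>H. of_nat e ^ M * fps_nth (fps_stretch e A) n) = of_int (int p ^ Suc N * W)"
    proof -
      have "of_int D * (\<Sum>e\<in>H. of_nat e ^ M * fps_nth (fps_stretch e A) n) =
         (\<Sum>e\<in>H. of_nat e ^ M * (of_int D * fps_nth (fps_stretch e A) n))"
        by (simp add: sum_distrib_left mult_ac)
      also have "\<dots> = (\<Sum>e\<in>H. of_nat e ^ M * of_int (int p ^ Suc N * w e))"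
        by (intro sum.cong) (simp_all only: w)
      finally show ?thesis by (simp add: W_def sum_distrib_left mult_ac)
    qed
    moreover have "(of_nat p ^ N :: complex) = of_nat p ^ v * of_nat p ^ (N - v)"
      using vu(3) by (simp flip: power_add)
    moreover have "(of_nat C :: complex) = of_nat p ^ v * of_nat u" using vu(1) by (simp add: C_def [symmetric])
    moreover have "u \<noteq> 0" "p \<noteq> 0" using vu(2) p1 by (auto intro: Nat.gr0I)
    ultimately have "of_int (D * int u) * fps_nth B n = of_int (int p * (int p ^ (N - v) * W))"
      unfolding nthB by (simp add: divide_simps mult_ac)
    thus "\<exists>w::int. of_int (D * int u) * fps_nth B n = of_int (int p * w)" by blast
  qed
qed

end

section \<open>Descent along local charts\<close>

text \<open>The derivative of a nonconstant function is not identically zero, so its zeros are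
  isolated; away from the centre \<open>u\<close> is then locally invertible.\<close>

lemma nonconstant_imp_deriv_nonzero_near:
  assumes u: "u holomorphic_on ball x0 r" and r: "r > 0" and nc: "\<not> u constant_on ball x0 r"
  obtains s where "0 < s" "s \<le> r" "\<And>x. x \<in> ball x0 s - {x0} \<Longrightarrow> deriv u x \<noteq> 0"
proof -
  have du: "deriv u holomorphic_on ball x0 r" by (intro holomorphic_deriv u) auto
  have "\<exists>y\<in>ball x0 r. deriv u y \<noteq> 0"
  proof (rule ccontr)
    assume "\<not> (\<exists>y\<in>ball x0 r. deriv u y \<noteq> 0)"
    hence "(u has_field_derivative 0) (at y)" if "y \<in> ball x0 r" for y
      using holomorphic_derivI[OF u _ that] that by force
    moreover have "continuous_on (ball x0 r) u" by (rule holomorphic_on_imp_continuous_on[OF u])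
    ultimately obtain c where "\<And>y. y \<in> ball x0 r \<Longrightarrow> u y = c"
      using DERIV_zero_connected_constant[of "ball x0 r" "{}" u] by auto
    thus False using nc by (auto simp: constant_on_def)
  qed
  then obtain y where y: "y \<in> ball x0 r" "deriv u y \<noteq> 0" by blast
  show ?thesis
  proof (cases "deriv u x0 = 0")
    case True
    obtain s where s: "0 < s" "ball x0 s \<subseteq> ball x0 r" "\<And>x. x \<in> ball x0 s - {x0} \<Longrightarrow> deriv u x \<noteq> 0"
      using isolated_zeros[OF du _ _ _ True y] r by auto
    show ?thesis using s r by (intro that[of "min s r"]) auto
  next
    case False
    have "continuous_on (ball x0 r) (deriv u)" by (rule holomorphic_on_imp_continuous_on[OF du])
    hence "isCont (deriv u) x0" using r by (auto simp: continuous_on_eq_continuous_at)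
    hence "\<exists>s>0. \<forall>x. dist x0 x < s \<longrightarrow> deriv u x \<noteq> 0"
      using False by (rule continuous_at_avoid)
    then obtain s where "s > 0" "\<And>x. dist x0 x < s \<Longrightarrow> deriv u x \<noteq> 0" by blast
    thus ?thesis using r by (intro that[of "min s r"]) auto
  qed
qed

text \<open>Away from the centre \<open>u\<close> has local inverses, through which \<open>g\<close>
  becomes holomorphic; openness of \<open>u\<close> makes the images fill a neighbourhood of
  \<open>u x0\<close>, and continuity of \<open>v\<close> gives the limit. Ramification of
  \<open>u\<close> at \<open>x0\<close> is allowed, as it occurs at elliptic points, and
  \<open>g\<close> is prescribed only off the centre, as the centre may be a cusp.\<close>

lemma descends_along_chart:
  assumes r: "r > 0" and u: "u holomorphic_on ball x0 r" and v: "v holomorphic_on ball x0 r"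
    and nc: "\<not> u constant_on ball x0 r"
    and g: "\<And>x. x \<in> ball x0 r - {x0} \<Longrightarrow> g (u x) = v x"
  shows "isolated_singularity_at g (u x0)" "g \<midarrow>u x0\<rightarrow> v x0"
proof -
  obtain s where s: "0 < s" "s \<le> r" "\<And>x. x \<in> ball x0 s - {x0} \<Longrightarrow> deriv u x \<noteq> 0"
    using nonconstant_imp_deriv_nonzero_near[OF u r nc] by blast
  have op: "\<exists>\<rho>>0. ball (u x0) \<rho> \<subseteq> u ` ball x0 s'" if "0 < s'" "s' \<le> r" for s'
  proof -
    have "open (u ` ball x0 s')"
      by (rule open_mapping_thm[OF u _ _ _ _ nc]) (use that in auto)
    moreover have "u x0 \<in> u ` ball x0 s'" using that by auto
    ultimately show ?thesis unfolding open_contains_ball by blast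
  qed
  have ana: "g analytic_on {w}" if w: "w \<in> u ` ball x0 s" "w \<noteq> u x0" for w
  proof -
    obtain x where x: "x \<in> ball x0 s" "w = u x" using w(1) by blast
    hence x': "x \<in> ball x0 s - {x0}" using w(2) by auto
    have us: "u holomorphic_on ball x0 s - {x0}"
      by (rule holomorphic_on_subset[OF u]) (use s in auto)
    obtain r' where r': "r' > 0" "ball x r' \<subseteq> ball x0 s - {x0}" "open (u ` ball x r')" "inj_on u (ball x r')"
      using has_complex_derivative_locally_invertible[OF us x' _ s(3)[OF x']] by auto
    obtain k where k: "k holomorphic_on (u ` ball x r')" "\<And>z. z \<in> ball x r' \<Longrightarrow> k (u z) = z"
      using holomorphic_has_inverse[OF holomorphic_on_subset[OF us r'(2)] open_ball r'(4)] by metis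
    have "v \<circ> k holomorphic_on u ` ball x r'"
      by (rule holomorphic_on_compose_gen[OF k(1) v]) (use k(2) r'(2) s in auto)
    moreover have "(v \<circ> k) y = g y" if "y \<in> u ` ball x r'" for y
      using that k(2) r'(2) s(2) g by force
    ultimately have "g holomorphic_on u ` ball x r'"
      by (rule holomorphic_transform)
    moreover have "w \<in> u ` ball x r'" using x r'(1) by auto
    ultimately show ?thesis using r'(3) analytic_at by blast
  qed
  obtain \<rho> where \<rho>: "\<rho> > 0" "ball (u x0) \<rho> \<subseteq> u ` ball x0 s" using op[OF s(1,2)] by blast
  have "g analytic_on ball (u x0) \<rho> - {u x0}"
  proof (subst analytic_on_analytic_at, intro ballI)
    fix z assume "z \<in> ball (u x0) \<rho> - {u x0}"
    thus "g analytic_on {z}" using \<rho>(2) by (intro ana) blast+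
  qed
  thus "isolated_singularity_at g (u x0)"
    using \<rho>(1) unfolding isolated_singularity_at_def by blast
  show "g \<midarrow>u x0\<rightarrow> v x0"
  proof (rule LIM_I)
    fix e :: real assume e: "e > 0"
    have "continuous_on (ball x0 r) v" by (rule holomorphic_on_imp_continuous_on[OF v])
    hence "isCont v x0" using r by (auto simp: continuous_on_eq_continuous_at)
    then obtain d where d: "d > 0" "\<And>x. dist x x0 < d \<Longrightarrow> dist (v x) (v x0) < e"
      unfolding continuous_at_eps_delta using e by blast
    obtain \<rho>' where \<rho>': "\<rho>' > 0" "ball (u x0) \<rho>' \<subseteq> u ` ball x0 (min d r)"
      using op[of "min d r"] d r by auto
    have "norm (g w - v x0) < e" if w: "w \<noteq> u x0" "norm (w - u x0) < \<rho>'" for w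
    proof -
      have "w \<in> ball (u x0) \<rho>'" using w(2) by (simp add: dist_norm norm_minus_commute)
      then obtain x where x: "x \<in> ball x0 (min d r)" "w = u x" using \<rho>'(2) by blast
      hence "g w = v x" using w(1) by (auto intro: g)
      thus ?thesis using d(2)[of x] x(1) by (simp add: dist_norm norm_minus_commute)
    qed
    thus "\<exists>s>0. \<forall>x. x \<noteq> u x0 \<and> norm (x - u x0) < s \<longrightarrow> norm (g x - v x0) < e"
      using \<rho>'(1) by blast
  qed
qed

text \<open>Applied to the reciprocal of the Hauptmodul near its pole: by the open mapping theorem
  all values of large modulus are attained there.\<close>

lemma chart_covers_infinity:
  assumes r: "r > 0" and s: "s holomorphic_on ball x0 r" "s x0 = 0"
    and nc: "\<not> s constant_on ball x0 r"
  obtains R where "R > 0" "\<And>w. norm w > R \<Longrightarrow> \<exists>x\<in>ball x0 r - {x0}. s x = 1 / w"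
proof -
  have "open (s ` ball x0 r)"
    by (rule open_mapping_thm[OF s(1) _ _ _ _ nc]) auto
  moreover have "0 \<in> s ` ball x0 r" using r s(2) by (metis centre_in_ball imageI)
  ultimately obtain \<rho> where \<rho>: "\<rho> > 0" "ball 0 \<rho> \<subseteq> s ` ball x0 r"
    unfolding open_contains_ball by blast
  show ?thesis
  proof (rule that[of "1 / \<rho>"])
    fix w :: complex assume w: "norm w > 1 / \<rho>"
    have "norm w > 0" using w \<rho>(1) by (meson divide_pos_pos less_trans zero_less_one)
    hence "norm (1 / w) < \<rho>" using w \<rho>(1) by (simp add: norm_divide field_simps)
    hence "1 / w \<in> s ` ball x0 r" using \<rho>(2) by auto
    then obtain x where x: "x \<in> ball x0 r" "s x = 1 / w" by auto
    moreover have "x \<noteq> x0" using x s(2) \<open>norm w > 0\<close> by auto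
    ultimately show "\<exists>x\<in>ball x0 r - {x0}. s x = 1 / w" by blast
  qed (use \<rho> in auto)
qed

section \<open>The q-disc at a cusp\<close>

lemma periodic_int_multiple:
  assumes per: "\<And>z. Im z > B \<Longrightarrow> F (z + of_real h) = F z" and "Im z > B"
  shows "F (z + of_int k * of_real h) = F z"
proof -
  have nat: "F (z + of_nat n * of_real h) = F z" if "Im z > B" for n z
    using that
  proof (induction n)
    case (Suc n)
    have "F ((z + of_nat n * of_real h) + of_real h) = F (z + of_nat n * of_real h)"
      by (rule per) (use Suc.prems in simp)
    thus ?case using Suc by (simp add: algebra_simps)
  qed auto
  show ?thesis
  proof (cases k rule: int_cases2)
    case (nonneg n)
    thus ?thesis using nat assms(2) by simp
  next
    case (nonpos n)
    have "F ((z - of_nat n * of_real h) + of_nat n * of_real h) = F (z - of_nat n * of_real h)"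
      by (rule nat) (use assms(2) in simp)
    thus ?thesis using nonpos by simp
  qed
qed

text \<open>A right inverse of \<open>z \<mapsto> exp(2 pi \<i> z / h)\<close>, from the principal
  logarithm. Its jump across the negative real axis is a multiple of \<open>h\<close> and so
  invisible to functions of period \<open>h\<close>.\<close>

definition q_log :: "real \<Rightarrow> complex \<Rightarrow> complex" where
  "q_log h q = of_real (h / (2 * pi)) * (- \<i> * Ln q)"

lemma exp_q_log:
  assumes "h > 0" "q \<noteq> 0"
  shows "exp (2 * pi * \<i> * q_log h q / of_real h) = q"
  using assms by (simp add: q_log_def)

lemma Im_q_log:
  assumes "q \<noteq> 0"
  shows "Im (q_log h q) = - (h * ln (norm q) / (2 * pi))"
  using assms by (simp add: q_log_def del: of_real_divide)

lemma Im_q_log_gt: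
  assumes "h > 0" "q \<noteq> 0"
  shows "Im (q_log h q) > B \<longleftrightarrow> norm q < exp (- (2 * pi * B / h))"
proof -
  have "Im (q_log h q) > B \<longleftrightarrow> ln (norm q) < - (2 * pi * B / h)"
    using assms by (simp add: Im_q_log field_simps) (rule less_minus_iff)
  also have "\<dots> \<longleftrightarrow> norm q < exp (- (2 * pi * B / h))"
    using assms by (metis exp_less_cancel_iff exp_ln zero_less_norm_iff)
  finally show ?thesis .
qed

lemma q_log_exp:
  assumes "h > 0"
  obtains k :: int where "q_log h (exp (2 * pi * \<i> * z / of_real h)) = z + of_int k * of_real h"
proof -
  define y where "y = 2 * pi * \<i> * z / of_real h"
  have "exp (Ln (exp y)) = exp y" by simp
  then obtain k :: int where k: "Ln (exp y) = y + of_int (2 * k) * pi * \<i>"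
    unfolding exp_eq by blast
  have "q_log h (exp y) = z + of_int k * of_real h"
  proof -
    have "of_real (h / (2 * pi)) * (- \<i> * (2 * pi * \<i> * z / of_real h + of_int (2 * k) * pi * \<i>)) = z + of_int k * of_real h"
      using assms by (simp add: field_simps)
    thus ?thesis unfolding q_log_def k by (simp only: y_def)
  qed
  thus ?thesis using that unfolding y_def by blast
qed

text \<open>A function of period \<open>h\<close> on a half plane is a function of \<open>q\<close>
  on a punctured disc, and the limit at i infinity fills in the centre.\<close>

lemma periodic_disc_chart:
  assumes h: "h > 0" and hol: "F holomorphic_on {z. Im z > B}"
    and per: "\<And>z. Im z > B \<Longrightarrow> F (z + of_real h) = F z"
    and lim: "(F \<longlongrightarrow> L) at_ioo"
  defines "u \<equiv> \<lambda>q. if q = 0 then L else F (q_log h q)"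
  defines "r \<equiv> exp (- (2 * pi * B / h))"
  shows "u holomorphic_on ball 0 r"
    "\<And>z. Im z > B \<Longrightarrow> u (exp (2 * pi * \<i> * z / of_real h)) = F z"
proof -
  note perk = periodic_int_multiple[of B F h, OF per]
  have Fq: "F (q_log h (exp (2 * pi * \<i> * z / of_real h))) = F z" if "Im z > B" for z
    using q_log_exp[OF h, of z] perk[OF _ that] by metis
  thus "\<And>z. Im z > B \<Longrightarrow> u (exp (2 * pi * \<i> * z / of_real h)) = F z" by (simp add: u_def)
  have hol0: "u holomorphic_on ball 0 r - {0}"
    unfolding holomorphic_on_def
  proof
    fix q0 :: complex assume q0: "q0 \<in> ball 0 r - {0}"
    define c where "c = Ln q0"
    have ec: "exp c = q0" using q0 by (simp add: c_def)
    \<comment> \<open>A branch of the logarithm that is holomorphic on the disc around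
      \<open>q0\<close>. It differs from \<open>q_log h\<close> by integral multiples of
      \<open>h\<close>, which \<open>F\<close> does not see.\<close>
    define k where "k = (\<lambda>q. of_real (h / (2 * pi)) * (- \<i> * (Ln (q / q0) + c)))"
    have near: "u q = F (k q)" "Im (k q) > B" if q: "q \<in> ball q0 (norm q0) \<inter> ball 0 r" for q
    proof -
      have q': "q \<noteq> 0" using q by auto
      have ek: "exp (2 * pi * \<i> * k q / of_real h) = q"
      proof -
        have "2 * pi * \<i> * k q / of_real h = Ln (q / q0) + c"
          using h by (simp add: k_def)
        thus ?thesis using q' q0 by (simp only: exp_add ec) simp
      qed
      obtain m :: int where m: "q_log h q = k q + of_int m * of_real h"
        using q_log_exp[OF h, of "k q"] unfolding ek by blast
      have "Im (q_log h q) > B" using Im_q_log_gt[OF h q'] q by (simp add: r_def)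
      thus Imk: "Im (k q) > B" unfolding m by simp
      show "u q = F (k q)" unfolding u_def m using q' perk[OF _ Imk] by simp
    qed
    have kd: "k holomorphic_on ball q0 (norm q0)"
      unfolding k_def
    proof (intro holomorphic_intros)
      fix q assume q: "q \<in> ball q0 (norm q0)"
      have q0': "norm q0 > 0" using q0 by auto
      have "norm (q / q0 - 1) < 1"
      proof -
        have "q / q0 - 1 = (q - q0) / q0" using q0 by (simp add: diff_divide_distrib)
        thus ?thesis using q q0' by (simp add: norm_divide dist_norm norm_minus_commute)
      qed
      hence "Re (q / q0) > 0" using abs_Re_le_cmod[of "q / q0 - 1"] by (simp del: Re_divide)
      thus "q / q0 \<notin> \<real>\<^sub>\<le>\<^sub>0" by (auto simp: complex_nonpos_Reals_iff)
    qed (use q0 in auto)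
    have "(F \<circ> k) holomorphic_on (ball q0 (norm q0) \<inter> ball 0 r)"
      by (rule holomorphic_on_compose_gen[OF holomorphic_on_subset[OF kd] hol]) (use near(2) in auto)
    hence "u holomorphic_on (ball q0 (norm q0) \<inter> ball 0 r)"
      by (rule holomorphic_transform) (simp add: near(1))
    moreover have "q0 \<in> ball q0 (norm q0) \<inter> ball 0 r" using q0 by auto
    ultimately have "u field_differentiable at q0"
      by (meson holomorphic_on_imp_differentiable_at open_Int open_ball)
    thus "u field_differentiable at q0 within ball 0 r - {0}"
      by (rule field_differentiable_at_within)
  qed
  have "(u \<longlongrightarrow> L) (at 0)"
  proof -
    have "filterlim (\<lambda>q. - (h * ln (norm q) / (2 * pi))) at_top (at (0::complex))"
    proof -
      have "filterlim (\<lambda>x. - (h * ln x / (2 * pi))) at_top (at_right 0)"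
        using h by real_asymp
      moreover have "filterlim norm (at_right 0) (at (0::complex))"
        unfolding filterlim_at by (auto intro!: tendsto_norm_zero simp: eventually_at_filter)
      ultimately show ?thesis by (rule filterlim_compose)
    qed
    moreover have ev: "eventually (\<lambda>q. - (h * ln (norm q) / (2 * pi)) = Im (q_log h q)) (at (0::complex))"
      unfolding eventually_at_filter by (auto simp: Im_q_log)
    ultimately have "filterlim (q_log h) at_ioo (at 0)"
      unfolding filterlim_at_ioo_iff by (simp only: filterlim_cong[OF refl refl ev])
    from filterlim_compose[OF lim this] have "((\<lambda>q. F (q_log h q)) \<longlongrightarrow> L) (at 0)" .
    moreover have "eventually (\<lambda>q. F (q_log h q) = u q) (at 0)"
      unfolding eventually_at_filter by (auto simp: u_def)
    ultimately show ?thesis by (blast intro: Lim_transform_eventually)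
  qed
  moreover have "u 0 = L" by (simp add: u_def)
  ultimately have "(u \<longlongrightarrow> u 0) (at 0)" by simp
  hence u0: "(u \<longlongrightarrow> u 0) (at 0 within ball 0 r)"
    by (rule tendsto_mono[OF at_le[OF subset_UNIV]])
  show "u holomorphic_on ball 0 r"
  proof (rule no_isolated_singularity')
    show "(u \<longlongrightarrow> u z) (at z within ball 0 r)" if "z \<in> {0}" for z
      using that u0 by simp
    show "u holomorphic_on ball 0 r - {0}" by (rule hol0)
  qed auto
qed

section \<open>Cusps\<close>

lemma SL2Z_det: "\<sigma> \<in> SL2Z \<Longrightarrow> det \<sigma> = 1"
proof -
  assume "\<sigma> \<in> SL2Z"
  then obtain a b c d :: int where s: "\<sigma> = mat2 (of_int a) (of_int b) (of_int c) (of_int d)" "a * d - b * c = 1"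
    unfolding SL2Z_def by blast
  have "det \<sigma> = of_int (a * d - b * c)" by (simp add: s(1))
  thus "det \<sigma> = 1" unfolding s(2) by simp
qed

lemma act_upper_half:
  assumes "det A > 0" "z \<in> upper_half"
  shows "act A (Pt z) = Pt (moebius A z)"
  using assms cocycle_nonzero[of A z] by simp

lemma act_of_real:
  "act (mat2 a b c d) (Pt (of_real y)) =
     (if c * y + d = 0 then Infinity else Pt (of_real ((a * y + b) / (c * y + d))))"
proof -
  have "cocycle (mat2 a b c d) (of_real y) = of_real (c * y + d)" by simp
  moreover have "moebius (mat2 a b c d) (of_real y) = of_real ((a * y + b) / (c * y + d))"
    by (simp add: moebius_mat2)
  ultimately show ?thesis by (simp only: act.simps of_real_eq_0_iff)
qed

lemma act_mult_Infinity:
  assumes "det A \<noteq> 0" "det B \<noteq> 0"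
  shows "act (A ** B) Infinity = act A (act B Infinity)"
proof -
  obtain a b c d where A: "A = mat2 a b c d" by (rule mat2_cases)
  obtain a' b' c' d' where B: "B = mat2 a' b' c' d'" by (rule mat2_cases)
  show ?thesis
  proof (cases "c' = 0")
    case True
    hence "a' \<noteq> 0" using assms(2) by (simp add: B)
    thus ?thesis using True by (simp add: A B mat2_mult)
  next
    case False
    have 1: "c * (a' / c') + d = (c * a' + d * c') / c'" "a * (a' / c') + b = (a * a' + b * c') / c'"
      using False by (simp_all add: add_divide_distrib)
    have "act A (act B Infinity) = act A (Pt (of_real (a' / c')))" using False by (simp add: B)
    also have "\<dots> = act (A ** B) Infinity"
    proof -
      have cancel: "(y / k) / (x / k) = y / x" if "k \<noteq> 0" for x y k :: real using that by simp
      have "((a * a' + b * c') / c') / ((c * a' + d * c') / c') = (a * a' + b * c') / (c * a' + d * c')"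
        using False by (intro cancel)
      thus ?thesis unfolding A act_of_real 1 B mat2_mult act.simps(2) mat2_nth
        by (simp only: divide_eq_0_iff False simp_thms)
    qed
    finally show ?thesis ..
  qed
qed

lemma act_SL2Z_Infinity_not_upper_half:
  assumes "act A Infinity = Pt z"
  shows "z \<notin> upper_half"
proof
  assume "z \<in> upper_half"
  moreover have "z = of_real (A $ 1 $ 1 / A $ 2 $ 1)"
    using assms by (metis act.simps(2) sphere.distinct(1) sphere.inject)
  ultimately show False by (simp add: upper_half_def del: of_real_divide)
qed

text \<open>The right factor is the inverse of the first matrix times the second; it fixes
  \<open>Infinity\<close> and is therefore upper triangular.\<close>

lemma same_cusp:
  assumes "a * d - b * c \<noteq> 0" "act (mat2 a b c d) Infinity = act (mat2 a' b' c' d') Infinity"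
  shows "mat2 a' b' c' d' = mat2 a b c d ** mat2 ((d * a' - b * c') / (a * d - b * c))
      ((d * b' - b * d') / (a * d - b * c)) 0 ((a * d' - c * b') / (a * d - b * c))"
proof -
  define D where "D = a * d - b * c"
  have D: "D \<noteq> 0" using assms(1) by (simp add: D_def)
  have ac: "a * c' = c * a'"
  proof (cases "c = 0")
    case True
    hence "c' = 0" using assms(2) by (simp split: if_splits)
    thus ?thesis using True by simp
  next
    case False
    hence c': "c' \<noteq> 0" "complex_of_real (a / c) = of_real (a' / c')"
      using assms(2) by (simp_all split: if_splits)
    hence "a / c = a' / c'" by (simp only: of_real_eq_iff)
    thus ?thesis using False c'(1) by (simp add: frac_eq_eq mult.commute)
  qed
  have eqs: "a * ((d * a' - b * c') / D) = a'" "c * ((d * a' - b * c') / D) = c'"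
    "a * ((d * b' - b * d') / D) + b * ((a * d' - c * b') / D) = b'"
    "c * ((d * b' - b * d') / D) + d * ((a * d' - c * b') / D) = d'"
  proof -
    have "a * (d * a' - b * c') = D * a'"
    proof -
      have "a * (d * a' - b * c') = a * d * a' - b * (a * c')" by (simp add: algebra_simps)
      also have "\<dots> = D * a'" unfolding ac by (simp add: D_def algebra_simps)
      finally show ?thesis .
    qed
    thus "a * ((d * a' - b * c') / D) = a'" using D by (simp add: divide_simps)
    have "c * (d * a' - b * c') = D * c'"
    proof -
      have "c * (d * a' - b * c') = d * (c * a') - b * c * c'" by (simp add: algebra_simps)
      also have "\<dots> = D * c'" unfolding ac [symmetric] by (simp add: D_def algebra_simps)
      finally show ?thesis .
    qed
    thus "c * ((d * a' - b * c') / D) = c'" using D by (simp add: divide_simps)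
    have "a * (d * b' - b * d') + b * (a * d' - c * b') = D * b'" by (simp add: D_def algebra_simps)
    thus "a * ((d * b' - b * d') / D) + b * ((a * d' - c * b') / D) = b'"
      using D by (simp add: divide_simps)
    have "c * (d * b' - b * d') + d * (a * d' - c * b') = D * d'" by (simp add: D_def algebra_simps)
    thus "c * ((d * b' - b * d') / D) + d * ((a * d' - c * b') / D) = d'"
      using D by (simp add: divide_simps)
  qed
  show ?thesis using eqs by (simp add: mat2_mult D_def)
qed

lemma same_cusp_moebius:
  assumes "det A > 0" "det B > 0" "act A Infinity = act B Infinity"
  obtains \<alpha> \<beta> :: real where "\<alpha> > 0" "\<And>z. z \<in> upper_half \<Longrightarrow> moebius B z = moebius A (of_real \<alpha> * z + of_real \<beta>)"
proof -
  obtain a b c d where a: "A = mat2 a b c d" by (rule mat2_cases)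
  obtain a' b' c' d' where b: "B = mat2 a' b' c' d'" by (rule mat2_cases)
  have "a * d - b * c \<noteq> 0" using assms(1) by (simp add: a)
  then obtain p q r where B: "B = A ** mat2 p q 0 r"
    using same_cusp assms(3) unfolding a b by blast
  have pr: "p * r > 0" using assms(1,2) by (simp add: B det_mul zero_less_mult_iff)
  hence r: "r \<noteq> 0" "p / r > 0" by (auto simp: zero_less_mult_iff zero_less_divide_iff)
  show ?thesis
  proof (rule that[OF r(2), of "q / r"])
    fix z assume z: "z \<in> upper_half"
    have "moebius B z = moebius A (moebius (mat2 p q 0 r) z)"
      unfolding B using pr z by (intro moebius_mult_upper_half) auto
    also have "moebius (mat2 p q 0 r) z = of_real (p / r) * z + of_real (q / r)"
      by (simp add: moebius_mat2 add_divide_distrib)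
    finally show "moebius B z = moebius A (of_real (p / r) * z + of_real (q / r))" .
  qed
qed

text \<open>Orders and values at a cusp are defined by choosing some matrix, and this controls the
  choice. Two choices differ by an integral upper triangular matrix of determinant 1, whose diagonal
  is \<open>1, 1\<close> or \<open>-1, -1\<close>; squaring the cocycle removes the sign.\<close>

lemma same_cusp_SL2Z:
  assumes A: "A \<in> SL2Z" and B: "B \<in> SL2Z" and "act A Infinity = act B Infinity"
  obtains n :: int where "\<forall>z\<in>upper_half. moebius B z = moebius A (z + of_int n) \<and>
    cocycle B z ^ 2 = cocycle A (z + of_int n) ^ 2"
proof -
  obtain a b c d :: int where a: "A = mat2 (of_int a) (of_int b) (of_int c) (of_int d)" using A unfolding SL2Z_def by blast
  obtain a' b' c' d' :: int where b: "B = mat2 (of_int a') (of_int b') (of_int c') (of_int d')" using B unfolding SL2Z_def by blast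
  define p q r where "p = d * a' - b * c'" and "q = d * b' - b * d'" and "r = a * d' - c * b'"
  have dets: "det A = 1" "det B = 1" using A B by (auto simp: SL2Z_det)
  have eq: "B = A ** mat2 (of_int p) (of_int q) 0 (of_int r)"
  proof -
    have 1: "of_int a * of_int d - of_int b * of_int c = (1 :: real)"
      using dets(1) by (simp add: a)
    show ?thesis
      using same_cusp[OF _ assms(3)[unfolded a b]] unfolding 1
      by (simp add: a b p_def q_def r_def)
  qed
  have "det B = det A * (of_int p * of_int r)" unfolding eq by (simp add: det_mul)
  hence "of_int (p * r) = (1 :: real)" using dets by simp
  hence pr: "p * r = 1" by (simp only: of_int_eq_1_iff)
  hence "p = 1 \<and> r = 1 \<or> p = -1 \<and> r = -1" by (simp add: zmult_eq_1_iff)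
  hence rr: "of_int r * of_int r = (1::complex)" "of_int p = (of_int r :: complex)" "r \<noteq> 0" by auto
  have "det (mat2 (of_int p) (of_int q) 0 (of_int r)) = of_int (p * r)" by simp
  hence d1: "det (mat2 (of_int p) (of_int q) 0 (of_int r)) > 0" unfolding pr by simp
  have mo: "moebius (mat2 (of_int p) (of_int q) 0 (of_int r)) z = z + of_int (q * r)" for z
  proof -
    have "moebius (mat2 (of_int p) (of_int q) 0 (of_int r)) z = (of_int r * z + of_int q) / of_int r"
      using rr(2) by (simp add: moebius_mat2)
    also have "\<dots> = z + of_int q / of_int r" using rr(3) by (simp add: add_divide_distrib)
    also have "of_int q / of_int r = (of_int (q * r) :: complex)"
      using rr(1,3) by (simp add: divide_eq_eq mult.assoc)
    finally show ?thesis .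
  qed
  show ?thesis
  proof (rule that[of "q * r"], intro ballI conjI)
    fix z assume z: "z \<in> upper_half"
    have coc: "cocycle (mat2 (of_int p) (of_int q) 0 (of_int r)) z \<noteq> 0"
      using d1 z by (intro cocycle_nonzero) auto
    show "moebius B z = moebius A (z + of_int (q * r))"
      unfolding eq by (subst moebius_mult[OF coc]) (simp only: mo)
    show "cocycle B z ^ 2 = cocycle A (z + of_int (q * r)) ^ 2"
      unfolding eq moebius_mult[OF coc] mo using rr(1) by (simp add: power_mult_distrib power2_eq_square)
  qed
qed

lemma coprime_column_SL2Z:
  assumes "coprime (x :: int) y"
  obtains b d where "mat2 (of_int x) (of_int b) (of_int y) (of_int d) \<in> SL2Z"
proof -
  obtain u v where "u * x + v * y = 1" using bezout_int[of x y] assms by auto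
  hence "x * u - (- v) * y = 1" by (simp add: algebra_simps)
  hence "mat2 (of_int x) (of_int (- v)) (of_int y) (of_int u) \<in> SL2Z" unfolding SL2Z_def by blast
  thus ?thesis using that by blast
qed

lemma int_column_cusp:
  fixes x y :: int
  assumes "x \<noteq> 0 \<or> y \<noteq> 0"
  obtains \<sigma> where "\<sigma> \<in> SL2Z" "act \<sigma> Infinity = (if y = 0 then Infinity else Pt (of_real (of_int x / of_int y)))"
proof -
  define g where "g = gcd x y"
  have g: "g \<noteq> 0" using assms by (simp add: g_def)
  obtain x' y' where xy: "x = x' * g" "y = y' * g" "coprime x' y'"
    using gcd_coprime_exists[of x y] g unfolding g_def by auto
  obtain b d where "mat2 (of_int x') (of_int b) (of_int y') (of_int d) \<in> SL2Z"
    by (rule coprime_column_SL2Z[OF xy(3)])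
  moreover have "act (mat2 (of_int x') (of_int b) (of_int y') (of_int d)) Infinity =
     (if y = 0 then Infinity else Pt (of_real (of_int x / of_int y)))"
    using g by (simp add: xy)
  ultimately show ?thesis using that by blast
qed

lemma cusps_SL2Z:
  assumes "P \<in> cusps"
  obtains \<sigma> where "\<sigma> \<in> SL2Z" "P = act \<sigma> Infinity"
proof (cases P)
  case Infinity
  obtain \<sigma> where "\<sigma> \<in> SL2Z" "act \<sigma> Infinity = Infinity"
    using int_column_cusp[of 1 0] by auto
  thus ?thesis using that Infinity by auto
next
  case (Pt z)
  hence "z \<in> \<rat>" using assms by (auto simp: cusps_def)
  then obtain x y :: int where xy: "y > 0" "z = of_int x / of_int y"
    by (rule Rats_cases')
  obtain \<sigma> where \<sigma>: "\<sigma> \<in> SL2Z" "act \<sigma> Infinity = (if y = 0 then Infinity else Pt (of_real (of_int x / of_int y)))"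
    by (rule int_column_cusp[of x y]) (use xy in auto)
  show ?thesis using that[OF \<sigma>(1)] \<sigma>(2) xy Pt by simp
qed

lemma SL2Z_cusps: "\<sigma> \<in> SL2Z \<Longrightarrow> act \<sigma> Infinity \<in> cusps"
  unfolding SL2Z_def cusps_def
proof (elim CollectE exE conjE)
  fix a b c d :: int assume s: "\<sigma> = mat2 (of_int a) (of_int b) (of_int c) (of_int d)"
  have "of_real (of_int a / of_int c) \<in> (\<rat> :: complex set)" by simp
  thus "act \<sigma> Infinity \<in> insert Infinity (Pt ` \<rat>)"
    unfolding s by (simp del: of_real_divide)
qed

lemma mat_1_SL2Z: "mat 1 \<in> SL2Z"
  unfolding SL2Z_def mat_1_eq_mat2
  by (rule CollectI, rule exI[of _ 1], rule exI[of _ 0], rule exI[of _ 0], rule exI[of _ 1]) simp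

context AL_group
begin

text \<open>Up to a common scalar the entries of \<open>\<gamma>\<close> are integers, so rational
  points go to rational points.\<close>

lemma cusps_closed:
  assumes "\<gamma> \<in> \<Gamma>" "\<sigma> \<in> SL2Z"
  obtains \<sigma>' where "\<sigma>' \<in> SL2Z" "act \<gamma> (act \<sigma> Infinity) = act \<sigma>' Infinity"
proof -
  have d: "det \<gamma> > 0" "det \<sigma> = 1" using assms det_pos SL2Z_det by auto
  obtain l e a b c d' where \<gamma>: "\<gamma> = mat2 (l * of_int (e * a)) (l * of_int b) (l * of_int (c * int N)) (l * of_int (e * d'))"
    "l \<noteq> 0"
    using assms(1) \<Gamma>_subset_scaled_AL unfolding scaled_AL_def by blast
  obtain x b' y d'' :: int where \<sigma>: "\<sigma> = mat2 (of_int x) (of_int b') (of_int y) (of_int d'')"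
    using assms(2) unfolding SL2Z_def by blast
  define u v where "u = e * a * x + b * y" and "v = c * int N * x + e * d' * y"
  obtain p q where uv: "\<gamma> ** \<sigma> = mat2 (l * of_int u) p (l * of_int v) q"
  proof (rule that)
    have "l * of_int (e * a) * of_int x + l * of_int b * of_int y = l * of_int u"
      "l * of_int (c * int N) * of_int x + l * of_int (e * d') * of_int y = l * of_int v"
      by (simp_all add: u_def v_def algebra_simps)
    thus "\<gamma> ** \<sigma> = mat2 (l * of_int u) (l * of_int (e * a) * of_int b' + l * of_int b * of_int d'') (l * of_int v)
        (l * of_int (c * int N) * of_int b' + l * of_int (e * d') * of_int d'')"
      unfolding \<gamma>(1) \<sigma> mat2_mult by (simp only:)
  qed
  have "det (\<gamma> ** \<sigma>) \<noteq> 0" using d by (simp add: det_mul)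
  hence "u \<noteq> 0 \<or> v \<noteq> 0" by (auto simp: uv)
  then obtain \<sigma>' where \<sigma>': "\<sigma>' \<in> SL2Z" "act \<sigma>' Infinity = (if v = 0 then Infinity else Pt (of_real (of_int u / of_int v)))"
    by (rule int_column_cusp)
  have "act \<gamma> (act \<sigma> Infinity) = act (\<gamma> ** \<sigma>) Infinity"
    using d by (intro act_mult_Infinity [symmetric]) auto
  also have "\<dots> = (if v = 0 then Infinity else Pt (of_real (of_int u / of_int v)))"
    using \<gamma>(2) by (simp add: uv)
  also have "\<dots> = act \<sigma>' Infinity" by (rule \<sigma>'(2) [symmetric])
  finally show ?thesis using that \<sigma>'(1) by blast
qed

lemma parabolic:
  assumes "\<sigma> \<in> SL2Z"
  obtains \<gamma> where "\<gamma> \<in> \<Gamma>" "\<And>z. z \<in> upper_half \<Longrightarrow> moebius \<gamma> (moebius \<sigma> z) = moebius \<sigma> (z + of_nat N)"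
proof -
  obtain a b c d :: int where s: "\<sigma> = mat2 (of_int a) (of_int b) (of_int c) (of_int d)" "a * d - b * c = 1"
    using assms unfolding SL2Z_def by blast
  \<comment> \<open>The conjugate by \<open>\<sigma>\<close> of the translation by \<open>N\<close>;
    its lower left entry is \<open>-c^2 N\<close>. Hence \<open>N\<close> is a period at every
    cusp.\<close>
  define \<gamma> where "\<gamma> = mat2 (of_int (1 - a * c * int N)) (of_int (a * a * int N)) (of_int ((- (c * c)) * int N)) (of_int (1 + a * c * int N))"
  have "(1 - a * c * int N) * (1 + a * c * int N) - (a * a * int N) * ((- (c * c)) * int N) = 1"
    by (simp add: algebra_simps)
  hence "\<gamma> \<in> Gamma0 N" unfolding Gamma0_def \<gamma>_def by blast
  hence g: "\<gamma> \<in> \<Gamma>" using Gamma0_subset by blast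
  have "of_int (a * d - b * c) = (1 :: real)" unfolding s(2) by simp
  hence ad: "of_int a * of_int d = 1 + of_int b * (of_int c :: real)" by simp
  have e1: "(1 - a * c * int N) * b + (a * a * int N) * d = b + a * int N"
  proof -
    have "(1 - a * c * int N) * b + (a * a * int N) * d = b + a * int N * (a * d - b * c)" by (simp add: algebra_simps)
    thus ?thesis unfolding s(2) by simp
  qed
  have e2: "(- (c * c)) * int N * b + (1 + a * c * int N) * d = d + c * int N"
  proof -
    have "(- (c * c)) * int N * b + (1 + a * c * int N) * d = d + c * int N * (a * d - b * c)" by (simp add: algebra_simps)
    thus ?thesis unfolding s(2) by simp
  qed
  have "\<gamma> ** \<sigma> = mat2 (of_int ((1 - a * c * int N) * a + (a * a * int N) * c)) (of_int ((1 - a * c * int N) * b + (a * a * int N) * d))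
     (of_int ((- (c * c)) * int N * a + (1 + a * c * int N) * c)) (of_int ((- (c * c)) * int N * b + (1 + a * c * int N) * d))"
    unfolding s(1) \<gamma>_def mat2_mult by simp
  also have "\<dots> = mat2 (of_int a) (of_int (b + a * int N)) (of_int c) (of_int (d + c * int N))"
    unfolding e1 e2 by (simp add: algebra_simps)
  also have "\<dots> = \<sigma> ** mat2 1 (of_nat N) 0 1"
    unfolding s(1) mat2_mult by (simp add: algebra_simps)
  finally have eq: "\<gamma> ** \<sigma> = \<sigma> ** mat2 1 (of_nat N) 0 1" .
  show ?thesis
  proof (rule that[OF g])
    fix z assume z: "z \<in> upper_half"
    have "moebius \<gamma> (moebius \<sigma> z) = moebius (\<gamma> ** \<sigma>) z"
      using z SL2Z_det[OF assms] by (intro moebius_mult_upper_half [symmetric]) auto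
    also have "\<dots> = moebius \<sigma> (moebius (mat2 1 (of_nat N) 0 1) z)"
      unfolding eq using z by (intro moebius_mult_upper_half) auto
    finally show "moebius \<gamma> (moebius \<sigma> z) = moebius \<sigma> (z + of_nat N)"
      by (simp add: moebius_mat2)
  qed
qed

end

section \<open>Values of a Hauptmodul\<close>

definition sphere_lim :: "(complex \<Rightarrow> complex) \<Rightarrow> sphere \<Rightarrow> complex filter \<Rightarrow> bool" where
  "sphere_lim f L F = (case L of Pt c \<Rightarrow> (f \<longlongrightarrow> c) F | Infinity \<Rightarrow> filterlim f at_infinity F)"

lemma sphere_lim_compose:
  assumes "sphere_lim f L F" "filterlim k F G"
  shows "sphere_lim (\<lambda>x. f (k x)) L G"
  using assms by (cases L) (auto simp: sphere_lim_def intro: filterlim_compose)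

lemma sphere_lim_cong:
  assumes "sphere_lim f L F" "eventually (\<lambda>x. f x = k x) F"
  shows "sphere_lim k L F"
  using assms by (cases L) (auto simp: sphere_lim_def cong: filterlim_cong)

lemma sphere_lim_unique:
  assumes "sphere_lim f L F" "sphere_lim f L' F" "F \<noteq> bot"
  shows "L = L'"
  using assms not_tendsto_and_filterlim_at_infinity[OF assms(3)] tendsto_unique[OF assms(3)]
  by (cases L; cases L') (auto simp: sphere_lim_def)

lemma filterlim_affine_at_ioo:
  assumes "\<alpha> > 0"
  shows "filterlim (\<lambda>z. of_real \<alpha> * z + of_real \<beta>) at_ioo at_ioo"
proof -
  have "filterlim (\<lambda>z. \<alpha> * Im z) at_top at_ioo"
    by (rule filterlim_compose[OF _ filterlim_Im_at_ioo]) (use assms in real_asymp)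
  thus ?thesis unfolding filterlim_at_ioo_iff by simp
qed

lemma filterlim_shift_at_ioo: "filterlim (\<lambda>z. z + of_int n) at_ioo at_ioo"
  using filterlim_affine_at_ioo[of 1 "of_int n"] by simp

lemma moebius_holomorphic:
  assumes "det A \<noteq> 0"
  shows "moebius A holomorphic_on upper_half"
proof -
  have "cocycle A z \<noteq> 0" if "z \<in> upper_half" for z using assms that by (rule cocycle_nonzero)
  thus ?thesis unfolding moebius_def cocycle_def by (intro holomorphic_intros)
qed

lemma isCont_moebius:
  assumes "det A \<noteq> 0" "z \<in> upper_half"
  shows "isCont (moebius A) z"
  using holomorphic_on_imp_continuous_on[OF moebius_holomorphic[OF assms(1)]] assms(2) open_upper_half
  by (simp add: continuous_on_eq_continuous_at)

lemma eventually_upper_half: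
  assumes "z \<in> upper_half"
  shows "eventually (\<lambda>w. w \<in> upper_half) (nhds z)"
  using assms open_upper_half by (rule eventually_nhds_in_open[rotated])

lemma SL2Z_inverse:
  assumes "\<sigma> \<in> SL2Z"
  obtains \<sigma>' where "det \<sigma>' = 1" "\<And>z. z \<in> upper_half \<Longrightarrow> moebius \<sigma>' (moebius \<sigma> z) = z"
    "\<And>z. z \<in> upper_half \<Longrightarrow> moebius \<sigma> (moebius \<sigma>' z) = z"
proof -
  have d: "det \<sigma> = 1" by (rule SL2Z_det[OF assms])
  obtain a b c e where s: "\<sigma> = mat2 a b c e" by (rule mat2_cases)
  have ae: "a * e - b * c = 1" using d by (simp add: s)
  define \<sigma>' where "\<sigma>' = mat2 e (- b) (- c) a"
  have d': "det \<sigma>' = 1" using ae by (simp add: \<sigma>'_def algebra_simps)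
  have "\<sigma>' ** \<sigma> = mat 1" "\<sigma> ** \<sigma>' = mat 1"
    using ae by (simp_all add: \<sigma>'_def s mat2_mult mat_1_eq_mat2 algebra_simps)
  thus ?thesis
    using that[OF d'] moebius_mult_upper_half[of \<sigma> _ \<sigma>'] moebius_mult_upper_half[of \<sigma>' _ \<sigma>] d d'
    by (metis moebius_1 zero_less_one)
qed

text \<open>A bound on the value at one point would not exclude a pole, since the value at a pole is
  set to 0. The bound holds on a whole neighbourhood, where a pole would produce large
  values.\<close>

lemma modular_function_no_pole:
  assumes \<sigma>: "\<sigma> \<in> SL2Z" and bd: "\<And>z. Im z > B \<Longrightarrow> norm (t (moebius \<sigma> z)) \<le> K" and z: "Im z > B" "z \<in> upper_half"
  shows "\<not> is_pole t (moebius \<sigma> z)"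
proof
  assume pole: "is_pole t (moebius \<sigma> z)"
  obtain \<sigma>' where \<sigma>': "det \<sigma>' = 1" "\<And>z. z \<in> upper_half \<Longrightarrow> moebius \<sigma>' (moebius \<sigma> z) = z"
    "\<And>z. z \<in> upper_half \<Longrightarrow> moebius \<sigma> (moebius \<sigma>' z) = z" by (rule SL2Z_inverse[OF \<sigma>]) blast
  define p where "p = moebius \<sigma> z"
  have p: "p \<in> upper_half" unfolding p_def by (rule moebius_upper_half) (use z SL2Z_det[OF \<sigma>] in auto)
  have "isCont (moebius \<sigma>') p" using \<sigma>'(1) p by (intro isCont_moebius) auto
  hence "((\<lambda>y. Im (moebius \<sigma>' y)) \<longlongrightarrow> Im z) (at p)"
    using \<sigma>'(2)[OF z(2)] unfolding isCont_def p_def by (auto intro: tendsto_Im)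
  hence "eventually (\<lambda>y. Im (moebius \<sigma>' y) > B) (at p)"
    using z(1) by (rule order_tendstoD)
  moreover have "eventually (\<lambda>y. y \<in> upper_half) (at p)"
    using eventually_upper_half[OF p] by (simp add: eventually_at_filter eventually_mono)
  moreover have "eventually (\<lambda>y. norm (t y) > K) (at p)"
    using pole unfolding is_pole_def p_def [symmetric] filterlim_at_infinity_conv_norm_at_top
    by (simp add: filterlim_at_top_dense)
  ultimately have "eventually (\<lambda>y. False) (at p)"
  proof eventually_elim
    case (elim y)
    thus ?case using bd[of "moebius \<sigma>' y"] \<sigma>'(3)[of y] by simp
  qed
  thus False by simp
qed

lemma shift_slash_2:
  assumes "\<sigma> \<in> SL2Z" "\<sigma>' \<in> SL2Z" "z \<in> upper_half"
    "moebius \<sigma>' z = moebius \<sigma> (z + of_int n)" "cocycle \<sigma>' z ^ 2 = cocycle \<sigma> (z + of_int n) ^ 2"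
  shows "slash 2 F \<sigma>' z = slash 2 F \<sigma> (z + of_int n)"
  using assms SL2Z_det[of \<sigma>] SL2Z_det[of \<sigma>'] by (simp add: slash_2)

locale hauptmodul = AL_group +
  fixes t :: "complex \<Rightarrow> complex"
  assumes unif: "uniformizer \<Gamma> t"
begin

lemma t_mero: "t nicely_meromorphic_on upper_half"
  and t_inv: "\<gamma> \<in> \<Gamma> \<Longrightarrow> z \<in> upper_half \<Longrightarrow> t (moebius \<gamma> z) = t z"
  using unif unfolding uniformizer_def modular_function_def by auto

lemma t_order:
  assumes "P \<in> Hstar"
  shows "value_at t P = Pt c \<Longrightarrow> has_order \<Gamma> 0 (\<lambda>z. t z - c) P 1"
    "value_at t P = Infinity \<Longrightarrow> has_order \<Gamma> 0 t P (- 1)"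
  using unif assms unfolding uniformizer_def by (auto dest!: bspec[where x = P])

lemma value_upper:
  "z \<in> upper_half \<Longrightarrow> value_at t (Pt z) = (if is_pole t z then Infinity else Pt (t z))"
  by (simp add: value_at_def)

lemma t_analytic: "z \<in> upper_half \<Longrightarrow> \<not> is_pole t z \<Longrightarrow> t analytic_on {z}"
  using nicely_meromorphic_on_imp_analytic_at[OF t_mero] .

lemma upper_Hstar: "z \<in> upper_half \<Longrightarrow> Pt z \<in> Hstar" and cusp_Hstar: "\<sigma> \<in> SL2Z \<Longrightarrow> act \<sigma> Infinity \<in> Hstar"
  using SL2Z_cusps by (auto simp: Hstar_def)

lemma Hstar_cases:
  assumes "P \<in> Hstar"
  obtains z where "z \<in> upper_half" "P = Pt z" | \<sigma> where "\<sigma> \<in> SL2Z" "P = act \<sigma> Infinity"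
proof (cases "P \<in> cusps")
  case True
  thus ?thesis using that(2) by (elim cusps_SL2Z) blast
next
  case False
  thus ?thesis using assms that(1) by (auto simp: Hstar_def)
qed

text \<open>The translation by \<open>N\<close> shows that the infimum is over a nonempty set.
  Positivity is not claimed; where the width is divided by, the value 0 is treated as a separate
  case.\<close>

lemma cusp_width_nonneg:
  assumes "\<sigma> \<in> SL2Z"
  shows "cusp_width \<Gamma> \<sigma> \<ge> 0"
proof -
  obtain \<gamma> where "\<gamma> \<in> \<Gamma>" "\<And>z. z \<in> upper_half \<Longrightarrow> moebius \<gamma> (moebius \<sigma> z) = moebius \<sigma> (z + of_nat N)"
    using parabolic[OF assms] by blast
  hence "\<exists>\<gamma>\<in>\<Gamma>. \<forall>z\<in>upper_half. moebius \<gamma> (moebius \<sigma> z) = moebius \<sigma> (z + of_real (real N))"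
    by auto
  hence "real N \<in> {h. h > 0 \<and> (\<exists>\<gamma>\<in>\<Gamma>. \<forall>z\<in>upper_half. moebius \<gamma> (moebius \<sigma> z) = moebius \<sigma> (z + of_real h))}"
    using N by simp
  thus ?thesis unfolding cusp_width_def by (rule cInf_greatest[OF ex_in_conv[THEN iffD1, OF exI]]) simp
qed

lemma cusp_width_shift:
  assumes "\<And>z. z \<in> upper_half \<Longrightarrow> moebius \<sigma>' z = moebius \<sigma> (z + of_int n)"
  shows "cusp_width \<Gamma> \<sigma>' = cusp_width \<Gamma> \<sigma>"
proof -
  have shift: "z + of_real x \<in> upper_half" if "z \<in> upper_half" for z and x :: real
    using that by (simp add: upper_half_def)
  have "(\<forall>z\<in>upper_half. moebius \<gamma> (moebius \<sigma>' z) = moebius \<sigma>' (z + of_real h)) \<longleftrightarrow>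
      (\<forall>z\<in>upper_half. moebius \<gamma> (moebius \<sigma> z) = moebius \<sigma> (z + of_real h))" for \<gamma> h
  proof
    assume L: "\<forall>z\<in>upper_half. moebius \<gamma> (moebius \<sigma>' z) = moebius \<sigma>' (z + of_real h)"
    show "\<forall>z\<in>upper_half. moebius \<gamma> (moebius \<sigma> z) = moebius \<sigma> (z + of_real h)"
    proof
      fix z assume z: "z \<in> upper_half"
      define w where "w = z + of_real (- of_int n)"
      have w: "w \<in> upper_half" "w + of_real h \<in> upper_half" unfolding w_def by (rule shift[OF z], rule shift[OF shift[OF z]])
      show "moebius \<gamma> (moebius \<sigma> z) = moebius \<sigma> (z + of_real h)"
        using bspec[OF L w(1)] assms[OF w(1)] assms[OF w(2)] by (simp add: w_def algebra_simps)
    qed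
  next
    assume R: "\<forall>z\<in>upper_half. moebius \<gamma> (moebius \<sigma> z) = moebius \<sigma> (z + of_real h)"
    show "\<forall>z\<in>upper_half. moebius \<gamma> (moebius \<sigma>' z) = moebius \<sigma>' (z + of_real h)"
    proof
      fix z assume z: "z \<in> upper_half"
      have w: "z + of_real (of_int n) \<in> upper_half" "z + of_real h \<in> upper_half" by (rule shift[OF z])+
      show "moebius \<gamma> (moebius \<sigma>' z) = moebius \<sigma>' (z + of_real h)"
        using bspec[OF R w(1)] assms[OF z] assms[OF w(2)] by (simp add: algebra_simps)
    qed
  qed
  thus ?thesis unfolding cusp_width_def by simp
qed

text \<open>A cusp is never a point of the upper half plane, which excludes the first alternative of
  \<open>has_order\<close>. The matrix obtained may differ from \<open>\<sigma>\<close>.\<close>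

lemma has_order_cusp:
  assumes "has_order \<Gamma> k F (act \<sigma> Infinity) r" "\<sigma> \<in> SL2Z"
  obtains \<sigma>' c where "\<sigma>' \<in> SL2Z" "act \<sigma> Infinity = act \<sigma>' Infinity" "c \<noteq> 0"
    "((\<lambda>z. slash k F \<sigma>' z / exp (2 * pi * \<i> * of_real r * z / of_real (cusp_width \<Gamma> \<sigma>'))) \<longlongrightarrow> c) at_ioo"
proof -
  have "\<not> (\<exists>z\<in>upper_half. act \<sigma> Infinity = Pt z \<and> (\<exists>\<^sub>F w in at z. F w \<noteq> 0) \<and>
      r = of_int (zorder F z) / of_nat (elliptic_index \<Gamma> z))"
    using act_SL2Z_Infinity_not_upper_half by blast
  with assms(1) show ?thesis unfolding has_order_def using that by blast
qed

lemma t_cusp_shift: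
  assumes "\<sigma> \<in> SL2Z" "\<sigma>' \<in> SL2Z" "act \<sigma> Infinity = act \<sigma>' Infinity"
    "sphere_lim (\<lambda>z. t (moebius \<sigma> z)) L at_ioo"
  shows "sphere_lim (\<lambda>z. t (moebius \<sigma>' z)) L at_ioo"
proof -
  obtain n :: int where n: "\<forall>z\<in>upper_half. moebius \<sigma>' z = moebius \<sigma> (z + of_int n) \<and>
    cocycle \<sigma>' z ^ 2 = cocycle \<sigma> (z + of_int n) ^ 2"
    by (rule same_cusp_SL2Z[OF assms(1-3)])
  have "sphere_lim (\<lambda>z. t (moebius \<sigma> (z + of_int n))) L at_ioo"
    by (rule sphere_lim_compose[OF assms(4) filterlim_shift_at_ioo])
  moreover have "eventually (\<lambda>z. t (moebius \<sigma> (z + of_int n)) = t (moebius \<sigma>' z)) at_ioo"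
    using eventually_upper_half_at_ioo by eventually_elim (simp add: n)
  ultimately show ?thesis by (rule sphere_lim_cong)
qed

lemma norm_exp_cusp:
  "norm (exp (2 * pi * \<i> * of_real r * z / of_real h)) = exp (- (2 * pi * r / h * Im z))"
proof -
  have eq: "2 * pi * \<i> * of_real r * z / of_real h = of_real (2 * pi * r / h) * (\<i> * z)" by simp
  have "Re (2 * pi * \<i> * of_real r * z / of_real h) = - (2 * pi * r / h * Im z)"
    unfolding eq by (simp del: of_real_divide of_real_mult)
  thus ?thesis by (simp add: norm_exp_eq_Re)
qed

text \<open>\<open>cusp_value\<close> is defined through \<open>Lim\<close>, which carries no
  information unless a limit exists. Existence is extracted from the order condition of the
  uniformizer; only \<open>t_cusp_limit\<close> identifies the limit with the value.\<close>

lemma t_cusp_limit_exists: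
  assumes \<sigma>: "\<sigma> \<in> SL2Z"
  shows "\<exists>L. sphere_lim (\<lambda>z. t (moebius \<sigma> z)) L at_ioo"
proof (cases "value_at t (act \<sigma> Infinity)")
  case (Pt c)
  obtain \<sigma>' c' where s: "\<sigma>' \<in> SL2Z" "act \<sigma> Infinity = act \<sigma>' Infinity" "c' \<noteq> 0"
    and lim: "((\<lambda>z. slash 0 (\<lambda>z. t z - c) \<sigma>' z / exp (2 * pi * \<i> * of_real 1 * z / of_real (cusp_width \<Gamma> \<sigma>'))) \<longlongrightarrow> c') at_ioo"
    by (rule has_order_cusp[OF t_order(1)[OF cusp_Hstar[OF \<sigma>] Pt] \<sigma>])
  define h where "h = cusp_width \<Gamma> \<sigma>'"
  have h: "h \<ge> 0" unfolding h_def by (rule cusp_width_nonneg[OF s(1)])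
  have lim': "((\<lambda>z. (t (moebius \<sigma>' z) - c) / exp (2 * pi * \<i> * z / of_real h)) \<longlongrightarrow> c') at_ioo"
    using lim SL2Z_det[OF s(1)] by (simp add: slash_0 h_def)
  have "\<exists>l. ((\<lambda>z. t (moebius \<sigma>' z) - c) \<longlongrightarrow> l) at_ioo"
  \<comment> \<open>For \<open>h = 0\<close> the division by zero makes the exponential 1, and
    \<open>lim'\<close> is already the limit.\<close>
  proof (cases "h = 0")
    case True
    thus ?thesis using lim' by auto
  next
    case False
    hence "((\<lambda>z. (t (moebius \<sigma>' z) - c) / exp (2 * pi * \<i> * z / of_real h) * exp (2 * pi * \<i> * z / of_real h)) \<longlongrightarrow> c' * 0) at_ioo"
      using h by (intro tendsto_mult lim' q_tendsto_0) auto
    thus ?thesis by auto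
  qed
  then obtain l where "((\<lambda>z. t (moebius \<sigma>' z) - c) \<longlongrightarrow> l) at_ioo" by blast
  from tendsto_add[OF this tendsto_const[of c]]
  have "sphere_lim (\<lambda>z. t (moebius \<sigma>' z)) (Pt (l + c)) at_ioo" by (simp add: sphere_lim_def)
  thus ?thesis using t_cusp_shift[OF s(1) \<sigma> s(2)[symmetric]] by blast
next
  case Infinity
  obtain \<sigma>' c' where s: "\<sigma>' \<in> SL2Z" "act \<sigma> Infinity = act \<sigma>' Infinity" "c' \<noteq> 0"
    and lim: "((\<lambda>z. slash 0 t \<sigma>' z / exp (2 * pi * \<i> * of_real (- 1) * z / of_real (cusp_width \<Gamma> \<sigma>'))) \<longlongrightarrow> c') at_ioo"
    by (rule has_order_cusp[OF t_order(2)[OF cusp_Hstar[OF \<sigma>] Infinity] \<sigma>])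
  define h where "h = cusp_width \<Gamma> \<sigma>'"
  have h: "h \<ge> 0" unfolding h_def by (rule cusp_width_nonneg[OF s(1)])
  have lim': "((\<lambda>z. t (moebius \<sigma>' z) / exp (2 * pi * \<i> * of_real (-1) * z / of_real h)) \<longlongrightarrow> c') at_ioo"
    using lim SL2Z_det[OF s(1)] by (simp add: slash_0 h_def)
  have "\<exists>L. sphere_lim (\<lambda>z. t (moebius \<sigma>' z)) L at_ioo"
  proof (cases "h = 0")
    case True
    thus ?thesis using lim' by (auto simp: sphere_lim_def intro: exI[of _ "Pt c'"])
  next
    case False
    have "filterlim (\<lambda>z. exp (- (2 * pi * (- 1) / h * Im z))) at_top at_ioo"
      by (rule filterlim_compose[OF _ filterlim_Im_at_ioo]) (use False h in real_asymp)
    hence "filterlim (\<lambda>z. exp (2 * pi * \<i> * of_real (-1) * z / of_real h)) at_infinity at_ioo"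
      unfolding filterlim_at_infinity_conv_norm_at_top norm_exp_cusp .
    from tendsto_mult_filterlim_at_infinity[OF lim' s(3) this]
    have "filterlim (\<lambda>z. t (moebius \<sigma>' z)) at_infinity at_ioo" by simp
    thus ?thesis by (auto simp: sphere_lim_def intro: exI[of _ Infinity])
  qed
  thus ?thesis using t_cusp_shift[OF s(1) \<sigma> s(2)[symmetric]] by blast
qed

lemma t_cusp_limit:
  assumes \<sigma>: "\<sigma> \<in> SL2Z"
  shows "sphere_lim (\<lambda>z. t (moebius \<sigma> z)) (value_at t (act \<sigma> Infinity)) at_ioo"
proof -
  obtain L where L: "sphere_lim (\<lambda>z. t (moebius \<sigma> z)) L at_ioo" using t_cusp_limit_exists[OF \<sigma>] by blast
  define P where "P = act \<sigma> Infinity"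
  define \<sigma>0 where "\<sigma>0 = (SOME \<sigma>. \<sigma> \<in> SL2Z \<and> act \<sigma> Infinity = P)"
  have s0: "\<sigma>0 \<in> SL2Z \<and> act \<sigma>0 Infinity = P"
    unfolding \<sigma>0_def by (rule someI[of _ \<sigma>]) (use \<sigma> in \<open>auto simp: P_def\<close>)
  have L0: "sphere_lim (\<lambda>z. t (moebius \<sigma>0 z)) L at_ioo"
    using t_cusp_shift[OF \<sigma> _ _ L, of \<sigma>0] s0 by (simp add: P_def)
  have "value_at t P = cusp_value t P"
    using act_SL2Z_Infinity_not_upper_half[of \<sigma>] by (auto simp: value_at_def P_def split: sphere.split)
  also have "\<dots> = L"
  proof (cases L)
    case (Pt c)
    hence lim: "((\<lambda>z. t (moebius \<sigma>0 z)) \<longlongrightarrow> c) at_ioo" using L0 by (simp add: sphere_lim_def)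
    hence "\<not> filterlim (\<lambda>z. t (moebius \<sigma>0 z)) at_infinity at_ioo"
      using not_tendsto_and_filterlim_at_infinity[OF at_ioo_not_bot] by blast
    thus ?thesis using Pt tendsto_Lim[OF at_ioo_not_bot lim]
      unfolding cusp_value_def Let_def \<sigma>0_def [symmetric] by simp
  next
    case Infinity
    thus ?thesis using L0
      unfolding cusp_value_def Let_def \<sigma>0_def [symmetric] by (simp add: sphere_lim_def)
  qed
  finally show ?thesis using L by (simp add: P_def)
qed

text \<open>Invariance of values does not transport poles directly, as a pole has the value 0.
  Instead \<open>t\<close> agrees near \<open>\<gamma> z\<close> with its composition with the
  inverse of \<open>\<gamma>\<close>, which is continuous there.\<close>

lemma pole_inv:
  assumes \<gamma>: "\<gamma> \<in> \<Gamma>" and z: "z \<in> upper_half" and np: "\<not> is_pole t z"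
  shows "\<not> is_pole t (moebius \<gamma> z)"
proof
  assume pole: "is_pole t (moebius \<gamma> z)"
  obtain \<delta> where \<delta>: "\<delta> \<in> \<Gamma>" "\<delta> ** \<gamma> = mat 1" using inverse_exists[OF \<gamma>] by blast
  define p where "p = moebius \<gamma> z"
  have p: "p \<in> upper_half" unfolding p_def by (intro moebius_upper_half det_pos \<gamma> z)
  have \<delta>p: "moebius \<delta> p = z"
    unfolding p_def using moebius_mult_upper_half[OF det_pos[OF \<gamma>] z, of \<delta>] by (simp add: \<delta>(2))
  have "isCont t (moebius \<delta> p)" unfolding \<delta>p using t_analytic[OF z np] by (rule analytic_at_imp_isCont)
  moreover have "isCont (moebius \<delta>) p" using det_pos[OF \<delta>(1)] p by (intro isCont_moebius) auto
  ultimately have "isCont (\<lambda>y. t (moebius \<delta> y)) p" by (rule isCont_o2[rotated])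
  hence "((\<lambda>y. t (moebius \<delta> y)) \<longlongrightarrow> t z) (at p)" by (simp add: isCont_def \<delta>p)
  moreover have "eventually (\<lambda>y. t (moebius \<delta> y) = t y) (at p)"
    using eventually_upper_half[OF p] unfolding eventually_at_filter
    by eventually_elim (use t_inv[OF \<delta>(1)] in auto)
  ultimately have "(t \<longlongrightarrow> t z) (at p)" by (blast intro: Lim_transform_eventually)
  thus False using pole not_tendsto_and_filterlim_at_infinity[of "at p" t "t z"]
    unfolding is_pole_def p_def [symmetric] by auto
qed

text \<open>At a cusp, \<open>\<gamma> ** \<sigma>\<close> and a matrix in \<open>SL2Z\<close> for
  the image cusp differ by a real affine map with positive slope, which preserves limits at i
  infinity.\<close>

lemma value_inv:
  assumes P: "P \<in> Hstar" and \<gamma>: "\<gamma> \<in> \<Gamma>"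
  shows "value_at t (act \<gamma> P) = value_at t P"
  using P
proof (cases rule: Hstar_cases)
  case (1 z)
  obtain \<delta> where \<delta>: "\<delta> \<in> \<Gamma>" "\<delta> ** \<gamma> = mat 1" using inverse_exists[OF \<gamma>] by blast
  have \<gamma>z: "moebius \<gamma> z \<in> upper_half" by (intro moebius_upper_half det_pos \<gamma> 1)
  have \<delta>\<gamma>z: "moebius \<delta> (moebius \<gamma> z) = z"
    using moebius_mult_upper_half[OF det_pos[OF \<gamma>] 1(1), of \<delta>] by (simp add: \<delta>(2))
  have "is_pole t (moebius \<gamma> z) \<longleftrightarrow> is_pole t z"
    using pole_inv[OF \<gamma> 1(1)] pole_inv[OF \<delta>(1) \<gamma>z] unfolding \<delta>\<gamma>z by blast
  thus ?thesis
    using act_upper_half[OF det_pos[OF \<gamma>] 1(1)] 1 \<gamma>z t_inv[OF \<gamma> 1(1)] by (simp add: value_upper)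
next
  case (2 \<sigma>)
  obtain \<sigma>' where \<sigma>': "\<sigma>' \<in> SL2Z" "act \<gamma> (act \<sigma> Infinity) = act \<sigma>' Infinity"
    using cusps_closed[OF \<gamma> 2(1)] by blast
  have d: "det \<gamma> > 0" "det \<sigma> = 1" "det \<sigma>' = 1" using det_pos[OF \<gamma>] 2(1) \<sigma>'(1) SL2Z_det by auto
  have "act \<sigma>' Infinity = act (\<gamma> ** \<sigma>) Infinity"
    using \<sigma>'(2) d by (subst act_mult_Infinity) auto
  then obtain \<alpha> \<beta> :: real where ab: "\<alpha> > 0"
    "\<And>z. z \<in> upper_half \<Longrightarrow> moebius (\<gamma> ** \<sigma>) z = moebius \<sigma>' (of_real \<alpha> * z + of_real \<beta>)"
    using same_cusp_moebius[of \<sigma>' "\<gamma> ** \<sigma>"] d by (auto simp: det_mul)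
  have "sphere_lim (\<lambda>z. t (moebius \<sigma>' (of_real \<alpha> * z + of_real \<beta>))) (value_at t (act \<sigma>' Infinity)) at_ioo"
    by (rule sphere_lim_compose[OF t_cusp_limit[OF \<sigma>'(1)] filterlim_affine_at_ioo[OF ab(1)]])
  moreover have "eventually (\<lambda>z. t (moebius \<sigma>' (of_real \<alpha> * z + of_real \<beta>)) = t (moebius \<sigma> z)) at_ioo"
    using eventually_upper_half_at_ioo
  proof eventually_elim
    case (elim z)
    have "moebius \<sigma> z \<in> upper_half" using d elim by (intro moebius_upper_half) auto
    hence "t (moebius \<gamma> (moebius \<sigma> z)) = t (moebius \<sigma> z)" by (rule t_inv[OF \<gamma>])
    moreover have "moebius (\<gamma> ** \<sigma>) z = moebius \<gamma> (moebius \<sigma> z)"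
      using d elim by (intro moebius_mult_upper_half) auto
    ultimately show ?case using ab(2)[OF elim] by simp
  qed
  ultimately have "sphere_lim (\<lambda>z. t (moebius \<sigma> z)) (value_at t (act \<sigma>' Infinity)) at_ioo"
    by (rule sphere_lim_cong)
  from sphere_lim_unique[OF this t_cusp_limit[OF 2(1)] at_ioo_not_bot]
  show ?thesis unfolding 2(2) \<sigma>'(2) .
qed

lemma value_orbit:
  assumes "P \<in> Hstar"
  shows "the_elem (value_at t ` Gamma_orbit \<Gamma> P) = value_at t P"
proof -
  have "value_at t ` Gamma_orbit \<Gamma> P = {value_at t P}"
  proof -
    have "value_at t ` Gamma_orbit \<Gamma> P = (\<lambda>_. value_at t P) ` \<Gamma>"
      unfolding Gamma_orbit_def image_image by (rule image_cong) (simp_all add: value_inv[OF assms])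
    thus ?thesis using one_closed by auto
  qed
  thus ?thesis by simp
qed

lemma value_surj: "\<exists>P\<in>Hstar. value_at t P = v"
proof -
  have "bij_betw (\<lambda>C. the_elem (value_at t ` C)) (modular_curve \<Gamma>) UNIV"
    using unif by (simp add: uniformizer_def)
  hence "v \<in> (\<lambda>C. the_elem (value_at t ` C)) ` modular_curve \<Gamma>" unfolding bij_betw_def by blast
  thus ?thesis using value_orbit unfolding modular_curve_def by force
qed

lemma value_inj:
  assumes "P \<in> Hstar" "Q \<in> Hstar" "value_at t P = value_at t Q"
  shows "Gamma_orbit \<Gamma> P = Gamma_orbit \<Gamma> Q"
proof -
  have "inj_on (\<lambda>C. the_elem (value_at t ` C)) (modular_curve \<Gamma>)"
    using unif by (simp add: uniformizer_def bij_betw_def)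
  thus ?thesis
    by (rule inj_onD) (use assms value_orbit in \<open>auto simp: modular_curve_def\<close>)
qed

lemma t_inj:
  assumes "z \<in> upper_half" "w \<in> upper_half" "\<not> is_pole t z" "\<not> is_pole t w" "t z = t w"
  obtains \<gamma> where "\<gamma> \<in> \<Gamma>" "w = moebius \<gamma> z"
proof -
  have "Gamma_orbit \<Gamma> (Pt z) = Gamma_orbit \<Gamma> (Pt w)"
    by (rule value_inj) (use assms in \<open>auto simp: value_upper upper_Hstar\<close>)
  moreover have "Pt w \<in> Gamma_orbit \<Gamma> (Pt w)"
  proof -
    have "act (mat 1) (Pt w) = Pt w" using act_upper_half[of "mat 1" w] assms(2) by simp
    thus ?thesis using one_closed unfolding Gamma_orbit_def by force
  qed
  ultimately have "Pt w \<in> Gamma_orbit \<Gamma> (Pt z)" by simp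
  then obtain \<gamma> where \<gamma>: "\<gamma> \<in> \<Gamma>" "Pt w = act \<gamma> (Pt z)" unfolding Gamma_orbit_def by blast
  hence "w = moebius \<gamma> z" using act_upper_half[OF det_pos[OF \<gamma>(1)] assms(1)] by simp
  thus ?thesis using that \<gamma>(1) by blast
qed

lemma has_order_upper:
  assumes "has_order \<Gamma> k F (Pt z) r" "z \<in> upper_half"
  shows "\<exists>\<^sub>F w in at z. F w \<noteq> 0" "r = of_int (zorder F z) / of_nat (elliptic_index \<Gamma> z)"
proof -
  have "\<not> (\<exists>\<sigma>\<in>SL2Z. Pt z = act \<sigma> Infinity \<and> (\<exists>c. c \<noteq> 0 \<and>
        ((\<lambda>z. slash k F \<sigma> z / exp (2 * pi * \<i> * of_real r * z / of_real (cusp_width \<Gamma> \<sigma>))) \<longlongrightarrow> c) at_ioo))"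
    using act_SL2Z_Infinity_not_upper_half assms(2) by metis
  with assms(1) have "(\<exists>\<^sub>F w in at z. F w \<noteq> 0) \<and> r = of_int (zorder F z) / of_nat (elliptic_index \<Gamma> z)"
    unfolding has_order_def by blast
  thus "\<exists>\<^sub>F w in at z. F w \<noteq> 0" "r = of_int (zorder F z) / of_nat (elliptic_index \<Gamma> z)" by blast+
qed

text \<open>The index is a \<open>card\<close> and would be 0 for an infinite set. The quotient by
  it would then be 0, whereas the uniformizer has order 1 or -1 everywhere.\<close>

lemma elliptic_index_nonzero:
  assumes "z \<in> upper_half"
  shows "elliptic_index \<Gamma> z \<noteq> 0"
proof (cases "is_pole t z")
  case True
  hence "- 1 = of_int (zorder t z) / real (elliptic_index \<Gamma> z)"
    using has_order_upper(2)[OF t_order(2)[OF upper_Hstar[OF assms]] assms] assms by (simp add: value_upper)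
  thus ?thesis by (intro notI) simp
next
  case False
  hence "1 = of_int (zorder (\<lambda>w. t w - t z) z) / real (elliptic_index \<Gamma> z)"
    using has_order_upper(2)[OF t_order(1)[OF upper_Hstar[OF assms]] assms] assms by (simp add: value_upper)
  thus ?thesis by (intro notI) simp
qed

lemma t_nonconstant:
  assumes "z \<in> upper_half" "\<not> is_pole t z"
  shows "\<exists>\<^sub>F w in at z. t w \<noteq> t z"
  using has_order_upper(1)[OF t_order(1)[OF upper_Hstar[OF assms(1)]] assms(1), of "t z"] assms
  by (simp add: value_upper)

end

section \<open>Forms as polynomials in the Hauptmodul\<close>

lemma one_le_norm_power_int_nonpos:
  fixes x :: complex
  assumes "x \<noteq> 0" "norm x \<le> 1" "k \<le> 0"
  shows "norm (x powi k) \<ge> 1"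
proof -
  have "x powi k = inverse (x ^ nat (- k))"
    using assms(3) by (auto simp: power_int_def power_inverse)
  moreover have "norm x ^ nat (- k) \<le> 1" using assms(2) by (intro power_le_one) auto
  moreover have "norm x ^ nat (- k) > 0" using assms(1) by simp
  ultimately show ?thesis by (simp add: norm_inverse norm_power one_le_inverse)
qed

lemma continuous_nonzero_bound:
  fixes k :: "complex \<Rightarrow> complex"
  assumes "isCont k x" "k x \<noteq> 0"
  obtains d where "d > 0" "\<And>y. dist y x < d \<Longrightarrow> norm (k y) \<ge> norm (k x) / 2"
proof -
  obtain d where d: "d > 0" "\<And>y. dist y x < d \<Longrightarrow> dist (k y) (k x) < norm (k x) / 2"
    using assms unfolding continuous_at_eps_delta by (metis half_gt_zero zero_less_norm_iff)
  show ?thesis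
  proof (rule that[OF d(1)])
    fix y assume "dist y x < d"
    from d(2)[OF this] show "norm (k y) \<ge> norm (k x) / 2"
      using norm_triangle_sub[of "k x" "k y"] by (simp add: dist_norm norm_minus_commute)
  qed
qed

lemma tendsto_bounded:
  fixes F :: "complex \<Rightarrow> complex"
  assumes "(F \<longlongrightarrow> L) at_ioo"
  obtains B K where "K > 0" "\<And>z. Im z > B \<Longrightarrow> norm (F z) \<le> K"
proof -
  have "eventually (\<lambda>z. dist (F z) L < 1) at_ioo" using assms by (rule tendstoD) simp
  then obtain B where B: "\<And>z. Im z > B \<Longrightarrow> dist (F z) L < 1" unfolding eventually_at_ioo by blast
  show ?thesis
  proof (rule that[of "norm L + 1" B])
    show "norm L + 1 > 0" by (simp add: add_nonneg_pos)
    fix z assume "Im z > B"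
    from B[OF this] show "norm (F z) \<le> norm L + 1"
      using norm_triangle_sub[of "F z" L] by (simp add: dist_norm)
  qed
qed

lemma tendsto_bounded_below:
  fixes F :: "complex \<Rightarrow> complex"
  assumes "(F \<longlongrightarrow> L) at_ioo" "L \<noteq> 0"
  obtains B where "\<And>z. Im z > B \<Longrightarrow> norm (F z) \<ge> norm L / 2"
proof -
  have "eventually (\<lambda>z. dist (F z) L < norm L / 2) at_ioo" using assms by (intro tendstoD) auto
  then obtain B where B: "\<And>z. Im z > B \<Longrightarrow> dist (F z) L < norm L / 2" unfolding eventually_at_ioo by blast
  show ?thesis
  proof (rule that[of B])
    fix z assume "Im z > B"
    from B[OF this] show "norm (F z) \<ge> norm L / 2"
      using norm_triangle_sub[of L "F z"] by (simp add: dist_norm norm_minus_commute)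
  qed
qed

lemma quotient_power_bound:
  fixes E Z w :: complex
  assumes "norm E \<le> K" "norm (Z * w) \<ge> c" "c > 0" "w \<noteq> 0" "K \<ge> 0"
  shows "norm (E / Z ^ M) \<le> K / c ^ M * norm w ^ M"
proof -
  have Z: "norm Z * norm w \<ge> c" using assms(2) by (simp add: norm_mult)
  hence Zp: "norm Z > 0" using assms(3) by (cases "Z = 0") auto
  have "c ^ M \<le> (norm Z * norm w) ^ M" using Z assms(3) by (intro power_mono) auto
  hence "K * c ^ M \<le> K * (norm Z ^ M * norm w ^ M)" using assms(5) by (simp add: power_mult_distrib mult_left_mono)
  hence "K / norm Z ^ M \<le> K / c ^ M * norm w ^ M"
    using Zp assms(3) by (simp add: divide_le_eq mult_ac pos_le_divide_eq)
  moreover have "norm (E / Z ^ M) \<le> K / norm Z ^ M"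
    using assms(1) by (simp add: norm_divide norm_power divide_right_mono)
  ultimately show ?thesis by (rule order_trans[rotated])
qed

locale hauptmodul_forms = hauptmodul +
  fixes Z E :: "complex \<Rightarrow> complex" and \<tau>\<^sub>0 :: sphere and \<psi> :: "real^2^2 \<Rightarrow> complex" and M :: nat
  assumes \<tau>\<^sub>0: "\<tau>\<^sub>0 \<in> Hstar"
    and poles: "{P \<in> Hstar. value_at t P = Infinity} = Gamma_orbit \<Gamma> \<tau>\<^sub>0"
    and Z_form: "modular_form \<Gamma> 2 \<psi> Z"
    and \<psi>_sq: "\<forall>\<gamma>\<in>\<Gamma>. \<psi> \<gamma> ^ 2 = 1"
    and Z_order: "\<exists>r. 0 < r \<and> r \<le> 1 \<and> has_order \<Gamma> 2 Z \<tau>\<^sub>0 r"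
    and Z_order_0: "\<forall>P \<in> Hstar - Gamma_orbit \<Gamma> \<tau>\<^sub>0. has_order \<Gamma> 2 Z P 0"
    and M: "even M"
    and E_hol: "E holomorphic_on upper_half"
    and E_inv: "\<And>\<gamma> z. \<gamma> \<in> \<Gamma> \<Longrightarrow> z \<in> upper_half \<Longrightarrow> slash (2 * int M) E \<gamma> z = E z"
    and E_cusp: "\<And>\<sigma>. \<sigma> \<in> SL2Z \<Longrightarrow> \<exists>L. (slash (2 * int M) E \<sigma> \<longlongrightarrow> L) at_ioo"
begin

definition f :: "complex \<Rightarrow> complex" where "f z = E z / Z z ^ M"

text \<open>The choice is from an empty set at the values that \<open>t\<close> takes only at cusps; these isolated
  values are repaired by removing the singularities.\<close>

definition g :: "complex \<Rightarrow> complex" where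
  "g w = f (SOME z. z \<in> upper_half \<and> \<not> is_pole t z \<and> t z = w)"

lemma Z_hol: "Z holomorphic_on upper_half"
  and Z_inv: "\<gamma> \<in> \<Gamma> \<Longrightarrow> z \<in> upper_half \<Longrightarrow> slash 2 Z \<gamma> z = \<psi> \<gamma> * Z z"
  using Z_form by (auto simp: modular_form_def)

lemma f_slash:
  assumes "det A > 0" "z \<in> upper_half"
  shows "f (moebius A z) = slash (2 * int M) E A z / slash 2 Z A z ^ M"
proof -
  have "cocycle A z \<noteq> 0" using assms by (intro cocycle_nonzero) auto
  hence "of_real (det A) ^ M / cocycle A z ^ (2 * M) \<noteq> 0" using assms(1) by simp
  moreover have "slash 2 Z A z ^ M = of_real (det A) ^ M / cocycle A z ^ (2 * M) * Z (moebius A z) ^ M"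
    using assms(1) by (simp add: slash_2 power_mult_distrib power_divide power_mult)
  ultimately show ?thesis
    using assms(1) by (simp add: slash_even f_def)
qed

lemma f_inv:
  assumes "\<gamma> \<in> \<Gamma>" "z \<in> upper_half"
  shows "f (moebius \<gamma> z) = f z"
proof -
  \<comment> \<open>Here the evenness of \<open>M\<close> absorbs the multiplier of order at most
    2.\<close>
  have "\<psi> \<gamma> ^ M = 1"
    using M \<psi>_sq assms(1) by (auto elim!: evenE simp: power_mult)
  thus ?thesis
    using f_slash[OF det_pos[OF assms(1)] assms(2)] E_inv[OF assms] Z_inv[OF assms]
    by (simp add: f_def power_mult_distrib)
qed

text \<open>The choice in \<open>g\<close> does not matter: the fibres of \<open>t\<close> are
  orbits and \<open>f\<close> is invariant.\<close>

lemma g_t: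
  assumes "z \<in> upper_half" "\<not> is_pole t z"
  shows "g (t z) = f z"
proof -
  define z' where "z' = (SOME z'. z' \<in> upper_half \<and> \<not> is_pole t z' \<and> t z' = t z)"
  have z': "z' \<in> upper_half \<and> \<not> is_pole t z' \<and> t z' = t z"
    unfolding z'_def by (rule someI[of _ z]) (use assms in auto)
  obtain \<gamma> where "\<gamma> \<in> \<Gamma>" "z' = moebius \<gamma> z"
    by (rule t_inj[of z z']) (use assms z' in auto)
  hence "f z' = f z" using f_inv assms(1) by blast
  thus ?thesis by (simp add: g_def z'_def)
qed

lemma not_orbit:
  assumes "P \<in> Hstar" "value_at t P \<noteq> Infinity"
  shows "has_order \<Gamma> 2 Z P 0"
  using assms poles Z_order_0 by blast

text \<open>Since the stabiliser order is nonzero, order 0 on the curve means order 0 in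
  \<open>z\<close>, and \<open>Z\<close> is analytic.\<close>

lemma Z_nonzero:
  assumes "z \<in> upper_half" "\<not> is_pole t z"
  shows "Z z \<noteq> 0"
proof -
  have "has_order \<Gamma> 2 Z (Pt z) 0"
    by (rule not_orbit[OF upper_Hstar[OF assms(1)]]) (use assms in \<open>simp add: value_upper\<close>)
  note ord = has_order_upper[OF this assms(1)]
  have "zorder Z z = 0" using ord(2) elliptic_index_nonzero[OF assms(1)] by simp
  moreover have "Z analytic_on {z}"
    using Z_hol open_upper_half assms(1) analytic_at by blast
  ultimately show ?thesis using zorder_eq_0_iff ord(1) by blast
qed

text \<open>\<open>has_order\<close> speaks about some matrix for the cusp, but \<open>t\<close>,
  \<open>E\<close> and \<open>Z\<close> have to be compared along the same one. The change of matrix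
  is a translation, which alters the limit by the nonzero factor \<open>d\<close>.\<close>

lemma Z_cusp_shift:
  assumes "\<sigma> \<in> SL2Z" "has_order \<Gamma> 2 Z (act \<sigma> Infinity) r"
  obtains c where "c \<noteq> 0"
    "((\<lambda>z. slash 2 Z \<sigma> z / exp (2 * pi * \<i> * of_real r * z / of_real (cusp_width \<Gamma> \<sigma>))) \<longlongrightarrow> c) at_ioo"
proof -
  obtain \<sigma>' c where s: "\<sigma>' \<in> SL2Z" "act \<sigma> Infinity = act \<sigma>' Infinity" "c \<noteq> 0"
    and lim: "((\<lambda>z. slash 2 Z \<sigma>' z / exp (2 * pi * \<i> * of_real r * z / of_real (cusp_width \<Gamma> \<sigma>'))) \<longlongrightarrow> c) at_ioo"
    by (rule has_order_cusp[OF assms(2,1)])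
  obtain n :: int where n: "\<forall>z\<in>upper_half. moebius \<sigma> z = moebius \<sigma>' (z + of_int n) \<and>
    cocycle \<sigma> z ^ 2 = cocycle \<sigma>' (z + of_int n) ^ 2"
    by (rule same_cusp_SL2Z[OF s(1) assms(1) s(2)[symmetric]])
  define h where "h = cusp_width \<Gamma> \<sigma>'"
  have h: "cusp_width \<Gamma> \<sigma> = h" unfolding h_def by (rule cusp_width_shift[of _ _ n]) (use n in blast)
  define d where "d = exp (2 * pi * \<i> * of_real r * of_int n / of_real h)"
  have "((\<lambda>z. slash 2 Z \<sigma>' (z + of_int n) / exp (2 * pi * \<i> * of_real r * (z + of_int n) / of_real h)) \<longlongrightarrow> c) at_ioo"
    using filterlim_compose[OF lim filterlim_shift_at_ioo] unfolding h_def .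
  hence "((\<lambda>z. slash 2 Z \<sigma>' (z + of_int n) / exp (2 * pi * \<i> * of_real r * (z + of_int n) / of_real h) * d) \<longlongrightarrow> c * d) at_ioo"
    by (intro tendsto_mult tendsto_const)
  moreover have "eventually (\<lambda>z. slash 2 Z \<sigma>' (z + of_int n) / exp (2 * pi * \<i> * of_real r * (z + of_int n) / of_real h) * d
      = slash 2 Z \<sigma> z / exp (2 * pi * \<i> * of_real r * z / of_real h)) at_ioo"
    using eventually_upper_half_at_ioo
  proof eventually_elim
    case (elim z)
    have "slash 2 Z \<sigma> z = slash 2 Z \<sigma>' (z + of_int n)"
      using n elim by (intro shift_slash_2[OF s(1) assms(1)]) auto
    moreover have "exp (2 * pi * \<i> * of_real r * (z + of_int n) / of_real h) = exp (2 * pi * \<i> * of_real r * z / of_real h) * d"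
      unfolding d_def by (simp add: distrib_left add_divide_distrib flip: exp_add)
    ultimately show ?case by (simp add: d_def)
  qed
  ultimately have "((\<lambda>z. slash 2 Z \<sigma> z / exp (2 * pi * \<i> * of_real r * z / of_real (cusp_width \<Gamma> \<sigma>))) \<longlongrightarrow> c * d) at_ioo"
    unfolding h by (rule Lim_transform_eventually)
  moreover have "c * d \<noteq> 0" using s(3) by (simp add: d_def)
  ultimately show ?thesis using that by blast
qed

lemma moebius_SL2Z_upper:
  "\<sigma> \<in> SL2Z \<Longrightarrow> z \<in> upper_half \<Longrightarrow> moebius \<sigma> z \<in> upper_half"
  using SL2Z_det by (intro moebius_upper_half) auto

lemma cusp_periodic:
  assumes \<sigma>: "\<sigma> \<in> SL2Z" and k: "\<And>\<gamma> z. \<gamma> \<in> \<Gamma> \<Longrightarrow> z \<in> upper_half \<Longrightarrow> k (moebius \<gamma> z) = k z" and z: "z \<in> upper_half"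
  shows "k (moebius \<sigma> (z + of_real (real N))) = k (moebius \<sigma> z)"
proof -
  obtain \<gamma> where \<gamma>: "\<gamma> \<in> \<Gamma>" "\<And>z. z \<in> upper_half \<Longrightarrow> moebius \<gamma> (moebius \<sigma> z) = moebius \<sigma> (z + of_nat N)"
    using parabolic[OF \<sigma>] by blast
  show ?thesis using k[OF \<gamma>(1) moebius_SL2Z_upper[OF \<sigma> z]] \<gamma>(2)[OF z] by simp
qed

lemma t_holomorphic_ball:
  assumes "z0 \<in> upper_half" "\<not> is_pole t z0"
  obtains r where "r > 0" "ball z0 r \<subseteq> upper_half" "t holomorphic_on ball z0 r"
    "\<And>x. x \<in> ball z0 r \<Longrightarrow> \<not> is_pole t x"
proof -
  obtain r1 where r1: "r1 > 0" "t holomorphic_on ball z0 r1"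
    using t_analytic[OF assms] unfolding analytic_on_def by auto
  obtain r2 where r2: "r2 > 0" "ball z0 r2 \<subseteq> upper_half"
    using open_upper_half assms(1) unfolding open_contains_ball by blast
  show ?thesis
  proof (rule that[of "min r1 r2"])
    show hol: "t holomorphic_on ball z0 (min r1 r2)"
      by (rule holomorphic_on_subset[OF r1(2)]) auto
    fix x assume "x \<in> ball z0 (min r1 r2)"
    thus "\<not> is_pole t x" using not_is_pole_holomorphic[OF _ _ hol] by auto
  qed (use r1 r2 in auto)
qed

lemma g_local_upper:
  assumes "z0 \<in> upper_half" "\<not> is_pole t z0"
  shows "isolated_singularity_at g (t z0)" "g \<midarrow>t z0\<rightarrow> f z0"
proof -
  obtain r where r: "r > 0" "ball z0 r \<subseteq> upper_half" "t holomorphic_on ball z0 r"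
    "\<And>x. x \<in> ball z0 r \<Longrightarrow> \<not> is_pole t x"
    using t_holomorphic_ball[OF assms] by blast
  have f_hol: "f holomorphic_on ball z0 r"
    unfolding f_def
    by (intro holomorphic_intros holomorphic_on_subset[OF E_hol] holomorphic_on_subset[OF Z_hol])
       (use r Z_nonzero in auto)
  have nc: "\<not> t constant_on ball z0 r"
  proof
    assume "t constant_on ball z0 r"
    then obtain c where c: "\<And>x. x \<in> ball z0 r \<Longrightarrow> t x = c" by (auto simp: constant_on_def)
    have "eventually (\<lambda>x. x \<in> ball z0 r - {z0}) (at z0)"
      using r(1) by (intro eventually_at_in_open) auto
    hence "eventually (\<lambda>x. \<not> (t x \<noteq> t z0)) (at z0)"
      by eventually_elim (use c r(1) in auto)
    thus False using t_nonconstant[OF assms] by (simp add: frequently_def)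
  qed
  have gt: "g (t x) = f x" if "x \<in> ball z0 r - {z0}" for x
    using that r by (intro g_t) auto
  show "isolated_singularity_at g (t z0)" "g \<midarrow>t z0\<rightarrow> f z0"
    by (rule descends_along_chart[OF r(1,3) f_hol nc gt]; assumption)+
qed

lemma t_limit_no_pole:
  assumes \<sigma>: "\<sigma> \<in> SL2Z" and lim: "((\<lambda>z. t (moebius \<sigma> z)) \<longlongrightarrow> c) at_ioo"
  obtains B where "B \<ge> 0" "\<And>z. Im z > B \<Longrightarrow> z \<in> upper_half"
    "\<And>z. Im z > B \<Longrightarrow> \<not> is_pole t (moebius \<sigma> z)"
proof -
  obtain B K where B: "\<And>z. Im z > B \<Longrightarrow> norm (t (moebius \<sigma> z)) \<le> K"
    using tendsto_bounded[OF lim] by blast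
  show ?thesis
  proof (rule that[of "max 0 B"])
    fix z assume z: "Im z > max 0 B"
    thus zu: "z \<in> upper_half" by (simp add: upper_half_def)
    show "\<not> is_pole t (moebius \<sigma> z)"
      by (rule modular_function_no_pole[OF \<sigma>, where B = B and K = K]) (use B z zu in auto)
  qed auto
qed

text \<open>Off the orbit of \<open>\<tau>\<^sub>0\<close> the form \<open>Z\<close> has order 0, so
  the denominator has a nonzero limit.\<close>

lemma f_cusp_tendsto:
  assumes \<sigma>: "\<sigma> \<in> SL2Z" and c: "value_at t (act \<sigma> Infinity) = Pt c"
  shows "\<exists>L. ((\<lambda>z. f (moebius \<sigma> z)) \<longlongrightarrow> L) at_ioo"
proof -
  obtain c2 where c2: "c2 \<noteq> 0"
    "((\<lambda>z. slash 2 Z \<sigma> z / exp (2 * pi * \<i> * of_real 0 * z / of_real (cusp_width \<Gamma> \<sigma>))) \<longlongrightarrow> c2) at_ioo"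
    by (rule Z_cusp_shift[OF \<sigma> not_orbit[OF cusp_Hstar[OF \<sigma>]]]) (use c in auto)
  hence "(slash 2 Z \<sigma> \<longlongrightarrow> c2) at_ioo" by simp
  moreover obtain L where "(slash (2 * int M) E \<sigma> \<longlongrightarrow> L) at_ioo" using E_cusp[OF \<sigma>] by blast
  ultimately have "((\<lambda>z. slash (2 * int M) E \<sigma> z / slash 2 Z \<sigma> z ^ M) \<longlongrightarrow> L / c2 ^ M) at_ioo"
    using c2(1) by (intro tendsto_divide tendsto_power) auto
  moreover have "eventually (\<lambda>z. slash (2 * int M) E \<sigma> z / slash 2 Z \<sigma> z ^ M = f (moebius \<sigma> z)) at_ioo"
    using eventually_upper_half_at_ioo by eventually_elim (use f_slash SL2Z_det[OF \<sigma>] in auto)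
  ultimately show ?thesis by (blast intro: Lim_transform_eventually)
qed

text \<open>The chart uses the period \<open>N\<close> from \<open>parabolic\<close>, which need not
  be the width of the cusp. Then \<open>u\<close> may be ramified at 0, which
  \<open>descends_along_chart\<close> permits.\<close>

lemma g_local_cusp:
  assumes \<sigma>: "\<sigma> \<in> SL2Z" and c: "value_at t (act \<sigma> Infinity) = Pt c"
  shows "isolated_singularity_at g c \<and> (\<exists>L. g \<midarrow>c\<rightarrow> L)"
proof -
  have lim_t: "((\<lambda>z. t (moebius \<sigma> z)) \<longlongrightarrow> c) at_ioo"
    using t_cusp_limit[OF \<sigma>] by (simp add: c sphere_lim_def del: act.simps)
  obtain L where lim_f: "((\<lambda>z. f (moebius \<sigma> z)) \<longlongrightarrow> L) at_ioo" using f_cusp_tendsto[OF \<sigma> c] by blast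
  obtain B where B: "B \<ge> 0" "\<And>z. Im z > B \<Longrightarrow> z \<in> upper_half" "\<And>z. Im z > B \<Longrightarrow> \<not> is_pole t (moebius \<sigma> z)"
    by (rule t_limit_no_pole[OF \<sigma> lim_t]) blast
  have up: "moebius \<sigma> z \<in> upper_half" if "Im z > B" for z
    using moebius_SL2Z_upper[OF \<sigma> B(2)[OF that]] .
  have mob: "moebius \<sigma> holomorphic_on {z. Im z > B}"
    by (rule holomorphic_on_subset[OF moebius_holomorphic]) (use SL2Z_det[OF \<sigma>] B(2) in auto)
  define V where "V = {z \<in> upper_half. \<not> is_pole t z}"
  have t_hol: "t holomorphic_on V"
    using t_analytic by (auto simp: V_def intro!: analytic_imp_holomorphic[OF analytic_on_analytic_at[THEN iffD2]])
  have f_hol: "f holomorphic_on V"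
    unfolding f_def
    by (intro holomorphic_intros holomorphic_on_subset[OF E_hol] holomorphic_on_subset[OF Z_hol])
       (use Z_nonzero in \<open>auto simp: V_def\<close>)
  have img: "moebius \<sigma> ` {z. Im z > B} \<subseteq> V" using up B(3) by (auto simp: V_def)
  have h1: "(\<lambda>z. t (moebius \<sigma> z)) holomorphic_on {z. Im z > B}"
    using holomorphic_on_compose_gen[OF mob t_hol img] by (simp add: o_def)
  have h2: "(\<lambda>z. f (moebius \<sigma> z)) holomorphic_on {z. Im z > B}"
    using holomorphic_on_compose_gen[OF mob f_hol img] by (simp add: o_def)
  define h where "h = real N"
  have h: "h > 0" using N by (simp add: h_def)
  have p1: "t (moebius \<sigma> (z + of_real h)) = t (moebius \<sigma> z)" if "Im z > B" for z
    unfolding h_def by (rule cusp_periodic[OF \<sigma> t_inv B(2)[OF that]])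
  have p2: "f (moebius \<sigma> (z + of_real h)) = f (moebius \<sigma> z)" if "Im z > B" for z
    unfolding h_def by (rule cusp_periodic[OF \<sigma> f_inv B(2)[OF that]])
  define u where "u = (\<lambda>q. if q = 0 then c else t (moebius \<sigma> (q_log h q)))"
  define v where "v = (\<lambda>q. if q = 0 then L else f (moebius \<sigma> (q_log h q)))"
  define r where "r = exp (- (2 * pi * B / h))"
  have r: "r > 0" by (simp add: r_def)
  have u: "u holomorphic_on ball 0 r" "\<And>z. Im z > B \<Longrightarrow> u (exp (2 * pi * \<i> * z / of_real h)) = t (moebius \<sigma> z)"
    unfolding u_def r_def using periodic_disc_chart[OF h h1 p1 lim_t] by auto
  have v: "v holomorphic_on ball 0 r"
    unfolding v_def r_def using periodic_disc_chart(1)[OF h h2 p2 lim_f] by auto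
  have qB: "Im (q_log h q) > B" if "q \<in> ball 0 r - {0}" for q
    using that Im_q_log_gt[OF h, of q B] by (simp add: r_def)
  have gu: "g (u q) = v q" if q: "q \<in> ball 0 r - {0}" for q
    using q g_t[OF up[OF qB[OF q]] B(3)[OF qB[OF q]]] by (simp add: u_def v_def)
  \<comment> \<open>A constant \<open>u\<close> would make \<open>t\<close> constant near a point of
    the upper half plane, against \<open>t_nonconstant\<close>.\<close>
  have nc: "\<not> u constant_on ball 0 r"
  proof
    assume "u constant_on ball 0 r"
    then obtain k where k: "\<And>q. q \<in> ball 0 r \<Longrightarrow> u q = k" by (auto simp: constant_on_def)
    have tk: "t (moebius \<sigma> z) = k" if "Im z > B" for z
    proof -
      have "norm (exp (2 * pi * \<i> * z / of_real h)) < r"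
        using that h norm_exp_cusp[of 1 z h] by (simp add: r_def divide_strict_right_mono)
      thus ?thesis using u(2)[OF that] k by simp
    qed
    define z1 where "z1 = Complex 0 (B + 1)"
    have z1: "Im z1 > B" by (simp add: z1_def)
    define w where "w = moebius \<sigma> z1"
    obtain \<sigma>' where \<sigma>': "det \<sigma>' = 1" "\<And>z. z \<in> upper_half \<Longrightarrow> moebius \<sigma>' (moebius \<sigma> z) = z"
      "\<And>z. z \<in> upper_half \<Longrightarrow> moebius \<sigma> (moebius \<sigma>' z) = z" by (rule SL2Z_inverse[OF \<sigma>]) blast
    have w: "w \<in> upper_half" unfolding w_def by (rule up[OF z1])
    have "isCont (moebius \<sigma>') w" using \<sigma>'(1) w by (intro isCont_moebius) auto
    hence "((\<lambda>y. Im (moebius \<sigma>' y)) \<longlongrightarrow> Im z1) (at w)"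
      using \<sigma>'(2)[OF B(2)[OF z1]] unfolding isCont_def w_def by (auto intro: tendsto_Im)
    hence "eventually (\<lambda>y. Im (moebius \<sigma>' y) > B) (at w)" using z1 by (rule order_tendstoD)
    moreover have "eventually (\<lambda>y. y \<in> upper_half) (at w)"
      using eventually_upper_half[OF w] by (simp add: eventually_at_filter eventually_mono)
    ultimately have "eventually (\<lambda>y. \<not> (t y \<noteq> t w)) (at w)"
    proof eventually_elim
      case (elim y)
      thus ?case using tk[OF elim(1)] \<sigma>'(3) tk[OF z1] by (simp add: w_def)
    qed
    thus False using t_nonconstant[OF w] B(3)[OF z1] by (simp add: frequently_def w_def)
  qed
  have u0: "u 0 = c" by (simp add: u_def)
  show ?thesis
    using descends_along_chart[OF r u(1) v nc gu] unfolding u0 by blast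
qed

text \<open>Surjectivity of the Hauptmodul reaches every complex \<open>w\<close> from a point or a
  cusp, so that \<open>g\<close> extends to an entire function.\<close>

lemma g_local: "isolated_singularity_at g w \<and> (\<exists>L. g \<midarrow>w\<rightarrow> L)"
proof -
  obtain P where P: "P \<in> Hstar" "value_at t P = Pt w" using value_surj by blast
  from P(1) show ?thesis
  proof (cases rule: Hstar_cases)
    case (1 z)
    hence "\<not> is_pole t z" "t z = w" using P(2) by (auto simp: value_upper split: if_splits)
    thus ?thesis using g_local_upper[OF 1(1)] by blast
  next
    case (2 \<sigma>)
    thus ?thesis using g_local_cusp P(2) by blast
  qed
qed

lemma remove_sings_g_entire: "remove_sings g holomorphic_on UNIV"
proof -
  have "remove_sings g analytic_on {w}" for w
    using g_local[of w] remove_sings_analytic_at by blast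
  hence "remove_sings g analytic_on UNIV" using analytic_on_analytic_at by blast
  thus ?thesis by (rule analytic_imp_holomorphic)
qed

lemma remove_sings_g_t:
  assumes "z \<in> upper_half" "\<not> is_pole t z"
  shows "remove_sings g (t z) = f z"
  using g_local_upper(2)[OF assms] by (rule remove_sings_eqI)

text \<open>With \<open>e\<close> the stabiliser order, \<open>t\<close> has order \<open>-e\<close>
  at the pole and \<open>Z\<close> has order at most \<open>e\<close>, so \<open>Z * t\<close> is
  bounded away from 0 there while \<open>E\<close> is bounded. Hence \<open>f = E / Z^M\<close>
  grows at most like \<open>t^M\<close>, and every large \<open>w\<close> is a value of
  \<open>t\<close> near the pole.\<close>

lemma f_growth_upper:
  assumes z0: "z0 \<in> upper_half" and P: "\<tau>\<^sub>0 = Pt z0"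
  shows "\<exists>R C. \<forall>w. norm w > R \<longrightarrow> (\<exists>z\<in>upper_half. \<not> is_pole t z \<and> t z = w \<and> norm (f z) \<le> C * norm w ^ M)"
proof -
  have "Pt z0 \<in> Gamma_orbit \<Gamma> \<tau>\<^sub>0"
    unfolding Gamma_orbit_def P using act_upper_half[of "mat 1" z0] z0 one_closed by force
  hence inf: "value_at t (Pt z0) = Infinity" using poles by blast
  hence pole: "is_pole t z0" using z0 by (auto simp: value_upper split: if_splits)
  define e where "e = elliptic_index \<Gamma> z0"
  have e: "e > 0" using elliptic_index_nonzero[OF z0] by (simp add: e_def)
  note ord_t = has_order_upper[OF t_order(2)[OF upper_Hstar[OF z0] inf] z0, folded e_def]
  obtain r where r: "0 < r" "r \<le> 1" "has_order \<Gamma> 2 Z \<tau>\<^sub>0 r" using Z_order by blast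
  note ord_Z = has_order_upper[OF r(3)[unfolded P] z0, folded e_def]
  have "real_of_int (zorder t z0) = - real e" using ord_t(2) e by (simp add: field_simps)
  moreover have "real_of_int (zorder Z z0) = r * real e" using ord_Z(2) e by (simp add: field_simps)
  hence "real_of_int (zorder Z z0) \<le> real e" using r(2) mult_right_mono[of r 1 "real e"] by simp
  ultimately have ord: "zorder Z z0 + zorder t z0 \<le> 0" by linarith
  have t_mer: "t meromorphic_on {z0}"
    using t_mero z0 unfolding nicely_meromorphic_on_def by (auto intro: meromorphic_on_subset)
  have Z_ana: "Z analytic_on {z0}" using Z_hol open_upper_half z0 analytic_at by blast
  have "isolated_singularity_at t z0" "not_essential t z0" using t_mer meromorphic_at_iff by blast+
  from zorder_exist[OF this ord_t(1)] obtain rt where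
    gt0: "zor_poly t z0 z0 \<noteq> 0" and rt: "rt > 0" "zor_poly t z0 holomorphic_on cball z0 rt"
    "\<And>w. w \<in> cball z0 rt - {z0} \<Longrightarrow> t w = zor_poly t z0 w * (w - z0) powi zorder t z0 \<and> zor_poly t z0 w \<noteq> 0"
    by blast
  have "isolated_singularity_at Z z0" "not_essential Z z0"
    using Z_ana isolated_singularity_at_analytic not_essential_analytic by blast+
  from zorder_exist[OF this ord_Z(1)] obtain rz where
    gz0: "zor_poly Z z0 z0 \<noteq> 0" and rz: "rz > 0" "zor_poly Z z0 holomorphic_on cball z0 rz"
    "\<And>w. w \<in> cball z0 rz - {z0} \<Longrightarrow> Z w = zor_poly Z z0 w * (w - z0) powi zorder Z z0 \<and> zor_poly Z z0 w \<noteq> 0"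
    by blast
  define k where "k = (\<lambda>w. zor_poly t z0 w * zor_poly Z z0 w)"
  have "isCont (zor_poly t z0) z0" "isCont (zor_poly Z z0) z0"
    using holomorphic_on_imp_continuous_on[OF rt(2)] holomorphic_on_imp_continuous_on[OF rz(2)] rt(1) rz(1)
    by (auto intro!: continuous_on_interior)
  hence "isCont k z0" unfolding k_def by (intro continuous_intros)
  moreover have "k z0 \<noteq> 0" using gt0 gz0 by (simp add: k_def)
  ultimately obtain d where d: "d > 0" "\<And>y. dist y z0 < d \<Longrightarrow> norm (k y) \<ge> norm (k z0) / 2"
    using continuous_nonzero_bound by blast
  define c where "c = norm (k z0) / 2"
  have c: "c > 0" using \<open>k z0 \<noteq> 0\<close> by (simp add: c_def)
  obtain ru where ru: "ru > 0" "cball z0 ru \<subseteq> upper_half"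
    using open_upper_half z0 unfolding open_contains_cball by blast
  have "compact (E ` cball z0 ru)"
    by (intro compact_continuous_image holomorphic_on_imp_continuous_on holomorphic_on_subset[OF E_hol] ru) auto
  hence "bounded (E ` cball z0 ru)" by (rule compact_imp_bounded)
  then obtain K where K: "K > 0" "\<And>x. x \<in> cball z0 ru \<Longrightarrow> norm (E x) \<le> K"
    unfolding bounded_pos by auto
  define \<rho> where "\<rho> = Min {rt, rz, ru, d, 1}"
  have \<rho>: "\<rho> > 0" "\<rho> \<le> rt" "\<rho> \<le> rz" "\<rho> \<le> ru" "\<rho> \<le> d" "\<rho> \<le> 1"
    using rt(1) rz(1) ru(1) d(1) by (auto simp: \<rho>_def)
  define B where "B = ball z0 \<rho>"
  have t_form: "t w = zor_poly t z0 w * (w - z0) powi zorder t z0" "t w \<noteq> 0"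
    "zor_poly t z0 w \<noteq> 0" if "w \<in> B - {z0}" for w
    using rt(3)[of w] that \<rho> by (auto simp: B_def)
  have t_hol: "t holomorphic_on B - {z0}"
  proof -
    have "(\<lambda>w. zor_poly t z0 w * (w - z0) powi zorder t z0) holomorphic_on B - {z0}"
      by (intro holomorphic_intros holomorphic_on_subset[OF rt(2)]) (use \<rho> in \<open>auto simp: B_def\<close>)
    thus ?thesis by (rule holomorphic_transform) (simp add: t_form(1))
  qed
  have no_pole: "\<not> is_pole t w" if "w \<in> B - {z0}" for w
    using not_is_pole_holomorphic[OF _ that t_hol] by (simp add: B_def open_delete)
  have Zt: "norm (Z w * t w) \<ge> c" if w: "w \<in> B - {z0}" for w
  proof -
    have w': "w - z0 \<noteq> 0" "norm (w - z0) \<le> 1" "dist w z0 < d" "w \<in> cball z0 rz - {z0}"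
      using w \<rho> by (auto simp: B_def dist_norm norm_minus_commute)
    have "Z w * t w = k w * ((w - z0) powi (zorder Z z0 + zorder t z0))"
      using rz(3)[OF w'(4)] t_form(1)[OF w] w'(1) by (simp add: k_def power_int_add)
    moreover have "norm ((w - z0) powi (zorder Z z0 + zorder t z0)) \<ge> 1"
      by (rule one_le_norm_power_int_nonpos[OF w'(1,2) ord])
    ultimately have "norm (Z w * t w) \<ge> norm (k w) * 1"
      by (simp only: norm_mult) (intro mult_left_mono, auto)
    thus ?thesis using d(2)[OF w'(3)] by (simp add: c_def)
  qed
  \<comment> \<open>The reciprocal of \<open>t\<close>, made holomorphic at the pole; the open
    mapping theorem is applied to it.\<close>
  define s where "s = (\<lambda>w. if w = z0 then 0 else inverse (t w))"
  have s_hol: "s holomorphic_on ball z0 \<rho>"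
  proof (rule no_isolated_singularity')
    have "(\<lambda>w. inverse (t w)) holomorphic_on B - {z0}"
      using t_form(2) by (intro holomorphic_intros t_hol) auto
    thus "s holomorphic_on ball z0 \<rho> - {z0}"
      unfolding B_def by (rule holomorphic_transform) (auto simp: s_def)
    have "((\<lambda>w. inverse (t w)) \<longlongrightarrow> 0) (at z0)"
      using pole unfolding is_pole_def by (rule filterlim_compose[OF tendsto_inverse_0])
    moreover have "eventually (\<lambda>w. inverse (t w) = s w) (at z0)"
      unfolding eventually_at_filter by (auto simp: s_def)
    ultimately have "(s \<longlongrightarrow> 0) (at z0)" by (blast intro: Lim_transform_eventually)
    hence "(s \<longlongrightarrow> 0) (at z0 within ball z0 \<rho>)" by (rule tendsto_mono[OF at_le[OF subset_UNIV]])
    thus "\<And>z. z \<in> {z0} \<Longrightarrow> (s \<longlongrightarrow> s z) (at z within ball z0 \<rho>)" by (simp add: s_def)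
  qed auto
  have s0: "s z0 = 0" by (simp add: s_def)
  have nc: "\<not> s constant_on ball z0 \<rho>"
  proof
    assume "s constant_on ball z0 \<rho>"
    then obtain a where a: "\<And>x. x \<in> ball z0 \<rho> \<Longrightarrow> s x = a" by (auto simp: constant_on_def)
    have "z0 + of_real (\<rho> / 2) \<in> B - {z0}" using \<rho>(1) by (simp add: B_def dist_norm)
    hence "s (z0 + of_real (\<rho> / 2)) \<noteq> 0" "z0 + of_real (\<rho> / 2) \<in> ball z0 \<rho>"
      using t_form(2) by (auto simp: s_def B_def)
    thus False using a[of z0] a s0 \<rho>(1) by auto
  qed
  obtain R where R: "R > 0" "\<And>w. norm w > R \<Longrightarrow> \<exists>x\<in>ball z0 \<rho> - {z0}. s x = 1 / w"
    using chart_covers_infinity[OF \<rho>(1) s_hol s0 nc] by blast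
  show ?thesis
  proof (intro exI allI impI)
    fix w :: complex assume w: "norm w > R"
    then obtain x where x: "x \<in> B - {z0}" "s x = 1 / w" using R(2) unfolding B_def by blast
    have w0: "w \<noteq> 0" using w R(1) by auto
    have tx: "t x = w" using x w0 by (auto simp: s_def inverse_eq_divide)
    have xu: "x \<in> cball z0 ru" using x(1) \<rho> by (auto simp: B_def)
    have "norm (f x) \<le> K / c ^ M * norm w ^ M"
      unfolding f_def by (rule quotient_power_bound[OF K(2)[OF xu]])
        (use Zt[OF x(1)] c w0 K(1) tx in auto)
    thus "\<exists>z\<in>upper_half. \<not> is_pole t z \<and> t z = w \<and> norm (f z) \<le> K / c ^ M * norm w ^ M"
      using xu ru(2) no_pole[OF x(1)] tx by blast
  qed
qed

text \<open>The estimate of \<open>f_growth_upper\<close> carried out with slashed functions at a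
  cusp, where the order conditions become exponential rates.\<close>

lemma f_growth_cusp:
  assumes \<sigma>: "\<sigma> \<in> SL2Z" and P: "\<tau>\<^sub>0 = act \<sigma> Infinity"
  shows "\<exists>R C. \<forall>w. norm w > R \<longrightarrow> (\<exists>z\<in>upper_half. \<not> is_pole t z \<and> t z = w \<and> norm (f z) \<le> C * norm w ^ M)"
proof -
  have d1: "det \<sigma> = 1" by (rule SL2Z_det[OF \<sigma>])
  have "act (mat 1 ** \<sigma>) Infinity = act (mat 1) (act \<sigma> Infinity)"
    using d1 by (intro act_mult_Infinity) auto
  hence "\<tau>\<^sub>0 \<in> Gamma_orbit \<Gamma> \<tau>\<^sub>0" unfolding Gamma_orbit_def P using one_closed by force
  hence inf: "value_at t (act \<sigma> Infinity) = Infinity" using poles P by blast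
  \<comment> \<open>All poles lie in one orbit, and the group maps cusps to cusps.\<close>
  have no_pole: "\<not> is_pole t z" if z: "z \<in> upper_half" for z
  proof
    assume "is_pole t z"
    hence "Pt z \<in> Gamma_orbit \<Gamma> \<tau>\<^sub>0" using poles upper_Hstar[OF z] value_upper[OF z] by auto
    then obtain \<gamma> where "\<gamma> \<in> \<Gamma>" "Pt z = act \<gamma> (act \<sigma> Infinity)" unfolding Gamma_orbit_def P by blast
    then obtain \<sigma>' where "Pt z = act \<sigma>' Infinity" using cusps_closed[OF _ \<sigma>] by metis
    thus False using act_SL2Z_Infinity_not_upper_half z by metis
  qed
  have t_inf: "filterlim (\<lambda>z. t (moebius \<sigma> z)) at_infinity at_ioo"
    using t_cusp_limit[OF \<sigma>] by (simp add: inf sphere_lim_def del: act.simps)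
  obtain \<sigma>1 c1 where s1: "\<sigma>1 \<in> SL2Z" "act \<sigma> Infinity = act \<sigma>1 Infinity" "c1 \<noteq> 0"
    and lim1: "((\<lambda>z. slash 0 t \<sigma>1 z / exp (2 * pi * \<i> * of_real (- 1) * z / of_real (cusp_width \<Gamma> \<sigma>1))) \<longlongrightarrow> c1) at_ioo"
    by (rule has_order_cusp[OF t_order(2)[OF cusp_Hstar[OF \<sigma>] inf] \<sigma>])
  have t_inf1: "filterlim (\<lambda>z. t (moebius \<sigma>1 z)) at_infinity at_ioo"
    using t_cusp_limit[OF s1(1)] by (simp add: inf s1(2)[symmetric] sphere_lim_def del: act.simps)
  obtain r where r: "0 < r" "r \<le> 1" "has_order \<Gamma> 2 Z \<tau>\<^sub>0 r" using Z_order by blast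
  obtain c2 where c2: "c2 \<noteq> 0"
    "((\<lambda>z. slash 2 Z \<sigma>1 z / exp (2 * pi * \<i> * of_real r * z / of_real (cusp_width \<Gamma> \<sigma>1))) \<longlongrightarrow> c2) at_ioo"
    by (rule Z_cusp_shift[OF s1(1)]) (use r(3) P s1(2) in auto)
  define h where "h = cusp_width \<Gamma> \<sigma>1"
  have h: "h \<ge> 0" unfolding h_def by (rule cusp_width_nonneg[OF s1(1)])
  have d1': "det \<sigma>1 = 1" by (rule SL2Z_det[OF s1(1)])
  obtain B1 where B1: "\<And>z. Im z > B1 \<Longrightarrow>
      norm (slash 0 t \<sigma>1 z / exp (2 * pi * \<i> * of_real (- 1) * z / of_real h)) \<ge> norm c1 / 2"
    using tendsto_bounded_below[OF lim1 s1(3)] unfolding h_def by blast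
  obtain B2 where B2: "\<And>z. Im z > B2 \<Longrightarrow>
      norm (slash 2 Z \<sigma>1 z / exp (2 * pi * \<i> * of_real r * z / of_real h)) \<ge> norm c2 / 2"
    using tendsto_bounded_below[OF c2(2,1)] unfolding h_def by blast
  obtain LE where "(slash (2 * int M) E \<sigma>1 \<longlongrightarrow> LE) at_ioo" using E_cusp[OF s1(1)] by blast
  then obtain B3 K where B3: "K > 0" "\<And>z. Im z > B3 \<Longrightarrow> norm (slash (2 * int M) E \<sigma>1 z) \<le> K"
    using tendsto_bounded by blast
  have "eventually (\<lambda>z. norm (t (moebius \<sigma>1 z)) > 1) at_ioo"
    using t_inf1 unfolding filterlim_at_infinity_conv_norm_at_top by (simp add: filterlim_at_top_dense)
  then obtain B4 where B4: "\<And>z. Im z > B4 \<Longrightarrow> norm (t (moebius \<sigma>1 z)) > 1" unfolding eventually_at_ioo by blast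
  define B where "B = Max {0, B1, B2, B3, B4}"
  have B: "B \<ge> 0" "B \<ge> B1" "B \<ge> B2" "B \<ge> B3" "B \<ge> B4" by (auto simp: B_def)
  have Bu: "z \<in> upper_half" if "Im z > B" for z using that B(1) by (simp add: upper_half_def)
  define c where "c = norm c2 / 2 * (norm c1 / 2)"
  have c: "c > 0" using c2(1) s1(3) by (simp add: c_def)
  have Zt: "norm (slash 2 Z \<sigma>1 z * t (moebius \<sigma>1 z)) \<ge> c" if z: "Im z > B" for z
  proof -
    define e1 e2 where "e1 = exp (2 * pi * \<i> * of_real (- 1) * z / of_real h)" and "e2 = exp (2 * pi * \<i> * of_real r * z / of_real h)"
    have e0: "e1 \<noteq> 0" "e2 \<noteq> 0" by (simp_all add: e1_def e2_def)
    \<comment> \<open>As \<open>r \<le> 1\<close>, the decay of \<open>Z\<close> does not outweigh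
      the growth of \<open>t\<close>. If \<open>h = 0\<close>, both exponentials are 1.\<close>
    have "norm e2 * norm e1 = exp (2 * pi * (1 - r) / h * Im z)"
      unfolding e1_def e2_def norm_exp_cusp by (simp add: algebra_simps diff_divide_distrib flip: exp_add)
    moreover have "2 * pi * (1 - r) / h * Im z \<ge> 0" using r(2) h z B(1) by (intro mult_nonneg_nonneg divide_nonneg_nonneg) auto
    ultimately have e12: "norm e2 * norm e1 \<ge> 1" by simp
    have 1: "norm (t (moebius \<sigma>1 z) / e1) \<ge> norm c1 / 2"
      using B1[of z] z B(2) d1' unfolding e1_def by (simp add: slash_0)
    have 2: "norm (slash 2 Z \<sigma>1 z / e2) \<ge> norm c2 / 2"
      using B2[of z] z B(3) unfolding e2_def by simp
    have "c \<le> norm (slash 2 Z \<sigma>1 z / e2) * norm (t (moebius \<sigma>1 z) / e1)"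
      unfolding c_def by (intro mult_mono 1 2) auto
    also have "\<dots> \<le> norm (slash 2 Z \<sigma>1 z / e2) * norm (t (moebius \<sigma>1 z) / e1) * (norm e2 * norm e1)"
      using e12 mult_left_mono[OF e12, of "norm (slash 2 Z \<sigma>1 z / e2) * norm (t (moebius \<sigma>1 z) / e1)"] by simp
    also have "\<dots> = norm (slash 2 Z \<sigma>1 z * t (moebius \<sigma>1 z))"
      using e0 by (simp add: norm_mult norm_divide)
    finally show ?thesis .
  qed
  define F where "F = (\<lambda>z. inverse (t (moebius \<sigma>1 z)))"
  have up: "moebius \<sigma>1 z \<in> upper_half" if "Im z > B" for z
    using moebius_SL2Z_upper[OF s1(1) Bu[OF that]] .
  have t0: "t (moebius \<sigma>1 z) \<noteq> 0" if "Im z > B" for z using B4[of z] that B(5) by auto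
  have F_hol: "F holomorphic_on {z. Im z > B}"
  proof -
    have mob: "moebius \<sigma>1 holomorphic_on {z. Im z > B}"
      by (rule holomorphic_on_subset[OF moebius_holomorphic]) (use d1' Bu in auto)
    have t_hol: "t holomorphic_on upper_half"
      using t_analytic no_pole by (intro analytic_imp_holomorphic[OF analytic_on_analytic_at[THEN iffD2]]) auto
    have img: "moebius \<sigma>1 ` {z. Im z > B} \<subseteq> upper_half" using up by auto
    have "(\<lambda>z. t (moebius \<sigma>1 z)) holomorphic_on {z. Im z > B}"
      using holomorphic_on_compose_gen[OF mob t_hol img] by (simp add: o_def)
    thus ?thesis unfolding F_def using t0 by (intro holomorphic_intros) auto
  qed
  \<comment> \<open>The chart for \<open>1/t\<close> uses the positive period \<open>N\<close>,
    because the width \<open>h\<close> is only known to be nonnegative.\<close>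
  define H where "H = real N"
  have H: "H > 0" using N by (simp add: H_def)
  have per: "F (z + of_real H) = F z" if "Im z > B" for z
    unfolding F_def H_def using cusp_periodic[OF s1(1) t_inv Bu[OF that]] by simp
  have lim: "(F \<longlongrightarrow> 0) at_ioo"
    unfolding F_def by (rule filterlim_compose[OF tendsto_inverse_0 t_inf1])
  define u where "u = (\<lambda>q. if q = 0 then 0 else F (q_log H q))"
  define \<rho> where "\<rho> = exp (- (2 * pi * B / H))"
  have \<rho>: "\<rho> > 0" by (simp add: \<rho>_def)
  have u: "u holomorphic_on ball 0 \<rho>"
    unfolding u_def \<rho>_def using periodic_disc_chart(1)[OF H F_hol per lim] by auto
  have u0: "u 0 = 0" by (simp add: u_def)
  have qB: "Im (q_log H q) > B" if "q \<in> ball 0 \<rho> - {0}" for q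
    using that Im_q_log_gt[OF H, of q B] by (simp add: \<rho>_def)
  have nc: "\<not> u constant_on ball 0 \<rho>"
  proof
    assume "u constant_on ball 0 \<rho>"
    then obtain a where a: "\<And>x. x \<in> ball 0 \<rho> \<Longrightarrow> u x = a" by (auto simp: constant_on_def)
    define q where "q = (of_real (\<rho> / 2) :: complex)"
    have q: "q \<in> ball 0 \<rho> - {0}" using \<rho> by (simp add: q_def)
    hence "u q \<noteq> 0" using t0[OF qB[OF q]] by (simp add: u_def F_def)
    moreover have "u q = u 0" using a[of q] a[of 0] q \<rho> by simp
    ultimately show False using u0 by simp
  qed
  obtain R where R: "R > 0" "\<And>w. norm w > R \<Longrightarrow> \<exists>x\<in>ball 0 \<rho> - {0}. u x = 1 / w"
    using chart_covers_infinity[OF \<rho> u u0 nc] by blast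
  show ?thesis
  proof (intro exI allI impI)
    fix w :: complex assume w: "norm w > R"
    then obtain q where q: "q \<in> ball 0 \<rho> - {0}" "u q = 1 / w" using R(2) by blast
    have w0: "w \<noteq> 0" using w R(1) by auto
    define z where "z = q_log H q"
    have z: "Im z > B" unfolding z_def by (rule qB[OF q(1)])
    have "inverse (t (moebius \<sigma>1 z)) = 1 / w" using q by (simp add: u_def F_def z_def)
    hence tz: "t (moebius \<sigma>1 z) = w" using w0 by (simp add: inverse_eq_divide)
    have "norm (slash (2 * int M) E \<sigma>1 z / slash 2 Z \<sigma>1 z ^ M) \<le> K / c ^ M * norm w ^ M"
      by (rule quotient_power_bound) (use Zt[OF z] c w0 B3 tz z B(4) in auto)
    moreover have "f (moebius \<sigma>1 z) = slash (2 * int M) E \<sigma>1 z / slash 2 Z \<sigma>1 z ^ M"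
      using d1' Bu[OF z] by (intro f_slash) auto
    ultimately show "\<exists>z\<in>upper_half. \<not> is_pole t z \<and> t z = w \<and> norm (f z) \<le> K / c ^ M * norm w ^ M"
      using up[OF z] no_pole tz by metis
  qed
qed

text \<open>Removing the singularities of \<open>g\<close> gives an entire function, which the
  growth lemmas bound by a multiple of \<open>|w|^M\<close> for large \<open>w\<close>. Liouville's
  theorem makes it a polynomial of degree at most \<open>M\<close>.\<close>

theorem quotient_is_polynomial:
  obtains P :: "complex poly" where "Polynomial.degree P \<le> M"
    "\<And>z. z \<in> upper_half \<Longrightarrow> \<not> is_pole t z \<Longrightarrow> E z = poly P (t z) * Z z ^ M"
proof -
  have "\<exists>R C. \<forall>w. norm w > R \<longrightarrow> (\<exists>z\<in>upper_half. \<not> is_pole t z \<and> t z = w \<and> norm (f z) \<le> C * norm w ^ M)"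
    using \<tau>\<^sub>0 by (cases rule: Hstar_cases) (auto intro: f_growth_upper f_growth_cusp)
  then obtain R C where RC: "\<And>w. norm w > R \<Longrightarrow> \<exists>z\<in>upper_half. \<not> is_pole t z \<and> t z = w \<and> norm (f z) \<le> C * norm w ^ M"
    by blast
  define G where "G = remove_sings g"
  have bound: "norm (G w) \<le> C * norm w ^ M" if "R + 1 \<le> norm w" for w
    using RC[of w] that remove_sings_g_t unfolding G_def by force
  define P where "P = (\<Sum>k\<le>M. Polynomial.monom ((deriv ^^ k) G 0 / fact k) k)"
  have "G w = poly P w" for w
    using Liouville_polynomial[OF remove_sings_g_entire[folded G_def] bound, where \<xi> = w]
    by (simp add: P_def poly_sum poly_monom)
  moreover have "Polynomial.degree P \<le> M"
    unfolding P_def by (intro degree_sum_le) (auto intro: order_trans[OF degree_monom_le])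
  ultimately show ?thesis
  proof (intro that)
    fix z assume z: "z \<in> upper_half" "\<not> is_pole t z"
    have "E z / Z z ^ M = G (t z)" unfolding G_def remove_sings_g_t[OF z] f_def ..
    thus "E z = poly P (t z) * Z z ^ M"
      using Z_nonzero[OF z] \<open>\<And>w. G w = poly P w\<close> by (simp add: field_simps)
  qed
qed

end

section \<open>Residues of p-adic integers\<close>

context prime_residue_ideal
begin

lemma unit_mod_I:
  assumes "coprime D (int p)"
  obtains x where "x \<in> R" "of_int D * x - 1 \<in> I"
proof -
  obtain a b where ab: "a * D + b * int p = 1"
    using bezout_int[of D "int p"] assms by auto
  have "of_int D * of_int a - 1 = (of_int (- b) * of_nat p :: 'a)"
  proof -
    have "(of_int (a * D + b * int p) :: 'a) = 1" by (simp add: ab)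
    thus ?thesis by (simp add: algebra_simps)
  qed
  moreover have "of_int (- b) * of_nat p \<in> I" by (rule mult_I'[OF of_int_R p_in_I])
  ultimately show ?thesis using that[OF of_int_R[of a]] by simp
qed

end

lemma carrier_padic_ints:
  "x \<in> carrier (padic_ints p) \<longleftrightarrow> (\<forall>n. 0 \<le> x n \<and> x n < int p ^ n \<and> x (Suc n) mod int p ^ n = x n)"
  by (auto simp: padic_ints_def)

lemma add_pow_one_padic_ints:
  assumes "p > 0"
  shows "add_pow (padic_ints p) k \<one>\<^bsub>padic_ints p\<^esub> = (\<lambda>n. int k mod int p ^ n)"
proof (induction k)
  case 0
  interpret cring "padic_ints p" using assms by (rule cring_padic_ints)
  show ?case unfolding add.nat_pow_0 by (simp add: padic_ints_def)
next
  case (Suc k)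
  interpret cring "padic_ints p" using assms by (rule cring_padic_ints)
  show ?case unfolding add.nat_pow_Suc Suc by (simp add: padic_ints_def mod_simps algebra_simps)
qed

text \<open>Division by \<open>p\<close> loses one digit of precision, so the quotient at level
  \<open>n\<close> is built from level \<open>n + 1\<close> of \<open>x\<close>.\<close>

lemma in_PIdl_padic_ints:
  assumes p: "p > 0" and x: "x \<in> carrier (padic_ints p)" and x1: "x 1 = 0"
  shows "x \<in> PIdl\<^bsub>padic_ints p\<^esub> (add_pow (padic_ints p) p \<one>\<^bsub>padic_ints p\<^esub>)"
proof -
  have c: "0 \<le> x n" "x n < int p ^ n" "x (Suc n) mod int p ^ n = x n" for n
    using x by (auto simp: carrier_padic_ints)
  have mod_p: "x (Suc n) mod int p = 0" for n
  proof (induction n)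
    case (Suc n)
    have "x (Suc (Suc n)) mod int p = (x (Suc (Suc n)) mod int p ^ Suc n) mod int p"
      by (rule mod_mod_cancel[symmetric]) simp
    thus ?case using Suc c(3)[of "Suc n"] by simp
  qed (use x1 in simp)
  define y where "y n = x (Suc n) div int p" for n
  have yp: "y n * int p = x (Suc n)" for n using mod_p[of n] by (simp add: y_def mod_0_imp_dvd)
  have "y \<in> carrier (padic_ints p)"
    unfolding carrier_padic_ints
  proof (intro allI conjI)
    fix n
    show "0 \<le> y n" using c(1) by (simp add: y_def div_int_pos_iff)
    have "y n * int p < int p ^ n * int p" using c(2)[of "Suc n"] unfolding yp by (simp add: mult.commute)
    thus "y n < int p ^ n" using p by simp
    have "int p * (y (Suc n) mod int p ^ n) = x (Suc (Suc n)) mod (int p * int p ^ n)"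
      by (metis mult_mod_right yp mult.commute)
    also have "\<dots> = int p * y n" using c(3)[of "Suc n"] yp[of n] by (simp add: mult.commute)
    finally show "y (Suc n) mod int p ^ n = y n" using p by simp
  qed
  moreover have "x = y \<otimes>\<^bsub>padic_ints p\<^esub> add_pow (padic_ints p) p \<one>\<^bsub>padic_ints p\<^esub>"
    unfolding add_pow_one_padic_ints[OF p]
    using yp c(3) by (simp add: padic_ints_def mod_mult_right_eq)
  ultimately show ?thesis unfolding cgenideal_def by blast
qed

locale padic_hom =
  fixes R :: "'a::idom set" and p :: nat and \<phi> :: "'a \<Rightarrow> nat \<Rightarrow> int"
  assumes p: "Factorial_Ring.prime p"
    and subring: "subring R (ring_of_type_algebra :: 'a ring)"
    and hom: "\<phi> \<in> ring_hom ((ring_of_type_algebra :: 'a ring)\<lparr>carrier := R\<rparr>) (padic_ints p)"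
begin

lemma R_closed:
  "1 \<in> R" "a \<in> R \<Longrightarrow> b \<in> R \<Longrightarrow> a * b \<in> R" "a \<in> R \<Longrightarrow> b \<in> R \<Longrightarrow> a + b \<in> R"
  "a \<in> R \<Longrightarrow> b \<in> R \<Longrightarrow> a - b \<in> R"
proof -
  interpret ring "ring_of_type_algebra :: 'a ring" by (rule ring_from_type_algebra)
  note E = subringE[OF subring]
  show "1 \<in> R" "a \<in> R \<Longrightarrow> b \<in> R \<Longrightarrow> a * b \<in> R"
    and add: "a \<in> R \<Longrightarrow> b \<in> R \<Longrightarrow> a + b \<in> R" for a b
    using E(3) E(6,7)[of a b] by (simp_all add: ring_of_type_algebra_def)
  have "\<ominus>\<^bsub>ring_of_type_algebra\<^esub> b = - b" for b :: 'a
    by (rule minus_equality) (simp_all add: ring_of_type_algebra_def)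
  thus "a \<in> R \<Longrightarrow> b \<in> R \<Longrightarrow> a - b \<in> R" using E(5)[of b] add[of a "- b"] by simp
qed

lemma hom_carrier: "a \<in> R \<Longrightarrow> \<phi> a \<in> carrier (padic_ints p)"
  using ring_hom_closed[OF hom] by simp

lemma hom_add: "a \<in> R \<Longrightarrow> b \<in> R \<Longrightarrow> \<phi> (a + b) = \<phi> a \<oplus>\<^bsub>padic_ints p\<^esub> \<phi> b"
  using ring_hom_add[OF hom, of a b] by (simp add: ring_of_type_algebra_def)

text \<open>The image modulo \<open>p\<close>: component 1 of the inverse system is the residue
  modulo \<open>p^1\<close>.\<close>

definition res where "res a = \<phi> a 1"

lemma residue_range: "a \<in> R \<Longrightarrow> 0 \<le> res a \<and> res a < int p"
  using hom_carrier[of a] unfolding carrier_padic_ints res_def by (metis power_one_right)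

lemma residue_add: "a \<in> R \<Longrightarrow> b \<in> R \<Longrightarrow> res (a + b) = (res a + res b) mod int p"
  by (simp add: res_def hom_add padic_ints_def)

lemma residue_mult: "a \<in> R \<Longrightarrow> b \<in> R \<Longrightarrow> res (a * b) = (res a * res b) mod int p"
  using ring_hom_mult[OF hom, of a b] by (simp add: res_def ring_of_type_algebra_def padic_ints_def)

lemma residue_one: "res 1 = 1 mod int p"
  using ring_hom_one[OF hom] by (simp add: res_def ring_of_type_algebra_def padic_ints_def)

lemma residue_diff:
  assumes "a \<in> R" "b \<in> R"
  shows "res (a - b) = (res a - res b) mod int p"
proof -
  note ab = R_closed(4)[OF assms]
  have "res a = (res (a - b) + res b) mod int p" using residue_add[OF ab assms(2)] by simp
  hence "(res a - res b) mod int p = res (a - b) mod int p" by (simp add: mod_simps)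
  thus ?thesis using residue_range[OF ab] by simp
qed

lemma residue_power: "a \<in> R \<Longrightarrow> a ^ n \<in> R \<and> res (a ^ n) = (res a) ^ n mod int p"
  by (induction n) (auto simp: R_closed residue_one residue_mult mod_simps)

lemma residue_of_nat: "(of_nat n :: 'a) \<in> R \<and> res (of_nat n) = int n mod int p"
proof (induction n)
  case 0
  show ?case using R_closed(4)[of 1 1] residue_diff[of 1 1] by (simp add: R_closed(1))
next
  case (Suc n)
  thus ?case using R_closed(3)[of 1 "of_nat n"] residue_add[of 1 "of_nat n"]
    by (simp add: R_closed(1) residue_one mod_simps)
qed

text \<open>The condition \<open>frob_I\<close> is Fermat's little theorem for the residue of
  \<open>a\<close>.\<close>

lemma prime_residue_ideal: "prime_residue_ideal R {a \<in> R. res a = 0} p"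
proof
  fix a assume a: "a \<in> R"
  obtain k where k: "res a = int k" using residue_range[OF a] nonneg_int_cases by blast
  have "[k ^ p = k] (mod p)"
  proof (cases "p dvd k")
    case True
    moreover from this have "p dvd k ^ p" using p prime_gt_0_nat by (simp add: dvd_power_le dvd_trans)
    ultimately show ?thesis by (simp add: cong_def dvd_eq_mod_eq_0)
  next
    case False
    from cong_scalar_left[OF fermat_theorem[OF p False], of k] show ?thesis
      using prime_gt_0_nat[OF p] by (simp flip: power_Suc)
  qed
  hence "[int k ^ p = int k] (mod int p)" by (simp flip: cong_int_iff)
  thus "a ^ p - a \<in> {a \<in> R. res a = 0}"
    using residue_power[OF a, of p] residue_diff[of "a ^ p" a] R_closed(4)[of "a ^ p" a] a
    by (simp add: k cong_def mod_simps mod_eq_dvd_iff)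
qed (use residue_of_nat[of p] in \<open>auto simp: p R_closed residue_diff residue_mult\<close>)

lemma hom_diff_in_PIdl:
  assumes "a \<in> R" "b \<in> R" "res (a - b) = 0"
  shows "\<phi> a \<ominus>\<^bsub>padic_ints p\<^esub> \<phi> b \<in> PIdl\<^bsub>padic_ints p\<^esub> (add_pow (padic_ints p) p \<one>\<^bsub>padic_ints p\<^esub>)"
proof -
  have p0: "p > 0" using p prime_gt_0_nat by blast
  interpret cring "padic_ints p" using p0 by (rule cring_padic_ints)
  note [simp] = hom_carrier[OF assms(1)] hom_carrier[OF assms(2)] hom_carrier[OF R_closed(4)[OF assms(1,2)]]
  have "\<phi> a = \<phi> (a - b) \<oplus>\<^bsub>padic_ints p\<^esub> \<phi> b"
    using hom_add[OF R_closed(4)[OF assms(1,2)] assms(2)] by simp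
  hence "\<phi> a \<ominus>\<^bsub>padic_ints p\<^esub> \<phi> b = \<phi> (a - b)"
    by (simp add: minus_eq a_assoc r_neg)
  thus ?thesis using in_PIdl_padic_ints[OF p0, of "\<phi> (a - b)"] assms(3) by (simp add: res_def)
qed

end

section \<open>The Lucas congruences\<close>

text \<open>The point \<open>q = 0\<close> comes from no point of the upper half plane; continuity
  extends the equality to it.\<close>

lemma fps_eq_of_eventually_at_0:
  fixes F G :: "complex fps"
  assumes f: "f has_fps_expansion F" and g: "g has_fps_expansion G" and eq: "eventually (\<lambda>x. f x = g x) (at 0)"
  shows "F = G"
proof -
  have "f \<midarrow>0\<rightarrow> f 0" "g \<midarrow>0\<rightarrow> g 0"
    using has_fps_expansion_imp_continuous[OF f, of UNIV] has_fps_expansion_imp_continuous[OF g, of UNIV]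
    by (simp_all add: isCont_def)
  hence "f 0 = g 0" using eq Lim_transform_eventually tendsto_unique at_neq_bot by metis
  hence "eventually (\<lambda>x. f x = g x) (nhds 0)"
    using eq by (simp add: eventually_nhds_conv_at)
  thus ?thesis using f g fps_expansion_unique_complex has_fps_expansion_cong by blast
qed

lemma filterlim_q_log: "h > 0 \<Longrightarrow> filterlim (q_log h) at_ioo (at 0)"
  unfolding filterlim_at_ioo_iff filterlim_at_top_dense eventually_at
proof (intro allI)
  fix B assume "h > 0"
  thus "\<exists>d>0. \<forall>x\<in>UNIV. x \<noteq> 0 \<and> dist x 0 < d \<longrightarrow> B < Im (q_log h x)"
    by (intro exI[of _ "exp (- (2 * pi * B / h))"]) (auto simp: Im_q_log_gt)
qed

lemma has_q_expansion_at_0: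
  assumes "has_q_expansion f A"
  shows "eventually (\<lambda>q. f (q_log 1 q) = eval_fps A q) (at 0)"
proof -
  have "eventually (\<lambda>z. f z = eval_fps A (exp (2 * pi * \<i> * z))) at_ioo"
    using assms by (simp add: has_q_expansion_def)
  from eventually_compose_filterlim[OF this filterlim_q_log[of 1]]
  have "eventually (\<lambda>q. f (q_log 1 q) = eval_fps A (exp (2 * pi * \<i> * q_log 1 q))) (at 0)" by simp
  moreover have "eventually (\<lambda>q::complex. q \<noteq> 0) (at 0)" by (simp add: eventually_at_filter)
  ultimately show ?thesis
    by eventually_elim (use exp_q_log[of 1] in simp)
qed

text \<open>Since \<open>t\<close> tends to 0 at i infinity, it has no poles at large height, and
  the identity of functions holds there. Substituting \<open>q_log 1\<close> turns it into an
  identity in \<open>q\<close> near 0.\<close>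

lemma (in hauptmodul_forms) q_expansion_polynomial:
  assumes tq: "has_q_expansion t tq" "fps_nth tq 0 = 0" and Zq: "has_q_expansion Z Zq"
    and A: "has_q_expansion E A"
  obtains P where "Polynomial.degree P \<le> M" "A = (fps_of_poly P oo tq) * Zq ^ M"
proof -
  obtain P where P: "Polynomial.degree P \<le> M"
    "\<And>z. z \<in> upper_half \<Longrightarrow> \<not> is_pole t z \<Longrightarrow> E z = poly P (t z) * Z z ^ M"
    using quotient_is_polynomial by blast
  have "((\<lambda>z. t (moebius (mat 1) z)) \<longlongrightarrow> fps_nth tq 0) at_ioo"
    using has_q_expansion_tendsto[OF tq(1)] by simp
  then obtain B where B: "\<And>z. Im z > B \<Longrightarrow> z \<in> upper_half" "\<And>z. Im z > B \<Longrightarrow> \<not> is_pole t (moebius (mat 1) z)"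
    using t_limit_no_pole[OF mat_1_SL2Z] by metis
  have "eventually (\<lambda>z. E z = poly P (t z) * Z z ^ M) at_ioo"
    unfolding eventually_at_ioo using B P(2) by (intro exI[of _ B]) auto
  from eventually_compose_filterlim[OF this filterlim_q_log[of 1]]
  have "eventually (\<lambda>q. E (q_log 1 q) = poly P (t (q_log 1 q)) * Z (q_log 1 q) ^ M) (at 0)" by simp
  hence eq: "eventually (\<lambda>q. eval_fps A q = (poly P \<circ> eval_fps tq) q * eval_fps Zq q ^ M) (at 0)"
    using has_q_expansion_at_0[OF tq(1)] has_q_expansion_at_0[OF Zq] has_q_expansion_at_0[OF A]
    by eventually_elim simp
  have exps: "eval_fps A has_fps_expansion A" "eval_fps tq has_fps_expansion tq" "eval_fps Zq has_fps_expansion Zq"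
    using tq Zq A by (auto simp: has_q_expansion_def intro: eval_fps_has_fps_expansion)
  have "poly P has_fps_expansion fps_of_poly P"
    using eval_fps_has_fps_expansion[of "fps_of_poly P"] by (simp flip: eval_fps_of_poly[abs_def])
  hence "(\<lambda>q. (poly P \<circ> eval_fps tq) q * eval_fps Zq q ^ M) has_fps_expansion (fps_of_poly P oo tq) * Zq ^ M"
    using exps tq(2) by (intro has_fps_expansion_mult has_fps_expansion_power has_fps_expansion_compose)
  from fps_eq_of_eventually_at_0[OF exps(1) this eq] show ?thesis by (rule that[OF P(1)])
qed

theorem theorem1p1:
  fixes N :: nat and S :: "nat set" and \<Gamma> :: "(real^2^2) set"
    and R :: "complex set"
    and t Z :: "complex \<Rightarrow> complex" and tq Zq :: "complex fps"
    and \<tau>\<^sub>0 :: sphere and \<psi> :: "real^2^2 \<Rightarrow> complex"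
    and T :: "nat \<Rightarrow> complex"
    and p :: nat and \<phi> :: "complex \<Rightarrow> nat \<Rightarrow> int"
  assumes "N \<ge> 1"
    and "\<forall>e\<in>S. hall_divisor e N"
    and "\<Gamma> = AL_extension N S"
    and "has_genus (modular_curve_topology \<Gamma>) 0"
    and "subring R (ring_of_type_algebra :: complex ring)"
    and "uniformizer \<Gamma> t"
    and "has_q_expansion t tq"
    and "fps_nth tq 0 = 0" and "fps_nth tq 1 = 1" and "\<forall>n. fps_nth tq n \<in> R"
    and "\<tau>\<^sub>0 \<in> Hstar"
    and "{P \<in> Hstar. value_at t P = Pt 0} = Gamma_orbit \<Gamma> Infinity"
    and "{P \<in> Hstar. value_at t P = Infinity} = Gamma_orbit \<Gamma> \<tau>\<^sub>0"
    and "modular_form \<Gamma> 2 \<psi> Z"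
    and "\<forall>\<gamma>\<in>\<Gamma>. \<psi> \<gamma> ^ 2 = 1"
    and "has_q_expansion Z Zq"
    and "fps_nth Zq 0 = 1" and "\<forall>n. fps_nth Zq n \<in> R"
    and "\<exists>r. 0 < r \<and> r \<le> 1 \<and> has_order \<Gamma> 2 Z \<tau>\<^sub>0 r"
    and "\<forall>P \<in> Hstar - Gamma_orbit \<Gamma> \<tau>\<^sub>0. has_order \<Gamma> 2 Z P 0"
    and "fps_compose (Abs_fps T) tq = Zq"
    and "Factorial_Ring.prime p"
    and "ring_embedding ((ring_of_type_algebra :: complex ring)\<lparr>carrier := R\<rparr>) (padic_ints p) \<phi>"
  shows "lucas_congruences p \<phi> T"
proof -
  interpret AL_group N S by unfold_locales (use assms in auto)
  have \<Gamma>: "\<Gamma> = AL_group.\<Gamma> N S" using assms(3) by (simp add: \<Gamma>_def)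
  interpret hauptmodul N S t by unfold_locales (use assms \<Gamma> in simp)
  obtain M i E A D where M_eq: "M = (p - 1) * p ^ i" "even M"
    and E: "E holomorphic_on upper_half"
      "\<And>\<gamma> z. \<gamma> \<in> AL_group.\<Gamma> N S \<Longrightarrow> z \<in> upper_half \<Longrightarrow> slash (2 * int M) E \<gamma> z = E z"
      "\<And>\<sigma>. \<sigma> \<in> SL2Z \<Longrightarrow> \<exists>L. (slash (2 * int M) E \<sigma> \<longlongrightarrow> L) at_ioo"
    and A: "fps_conv_radius A \<ge> 1" "\<And>z. z \<in> upper_half \<Longrightarrow> E z = eval_fps A (exp (2 * pi * \<i> * z))"
      "fps_nth A 0 = 1"
    and D: "coprime D (int p)" "\<And>n. n > 0 \<Longrightarrow> \<exists>u::int. of_int D * fps_nth A n = of_int (int p * u)"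
  proof (rule invariant_form_exists[OF assms(22)], goal_cases)
    case (1 M i E A D)
    show ?case by (rule 1(1)[OF 1(2-11)])
  qed
  interpret hauptmodul_forms N S t Z E \<tau>\<^sub>0 \<psi> M
    by unfold_locales (use assms \<Gamma> M_eq(2) E in \<open>simp_all only:\<close>)
  have "has_q_expansion E A"
    unfolding has_q_expansion_def
    using A eventually_upper_half_at_ioo by (auto elim!: eventually_mono intro: less_le_trans[of 0 1])
  then obtain P where P: "Polynomial.degree P \<le> M" "A = (fps_of_poly P oo tq) * Zq ^ M"
    using q_expansion_polynomial assms(7,8,16) by blast
  interpret padic_hom R p \<phi>
    by (rule padic_hom.intro) (use assms(5,22,23) in \<open>simp_all add: ring_embedding_def\<close>)
  define I where "I = {a \<in> R. res a = 0}"
  interpret prime_residue_ideal R I p unfolding I_def by (rule prime_residue_ideal)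
  obtain x where x: "x \<in> R" "of_int D * x - 1 \<in> I" by (rule unit_mod_I[OF D(1)])
  define F where "F = Abs_fps T"
  have Fq: "F oo tq = Zq" using assms(21) by (simp add: F_def)
  have F0: "fps_nth F 0 = 1" using assms(17) by (simp flip: Fq)
  \<comment> \<open>In degree 0 the coefficient vanishes; in positive degree it is an integral
    multiple of \<open>p\<close>.\<close>
  have DA: "fps_const (of_int D) * (A - 1) \<in> IF"
  proof -
    have "of_int D * fps_nth (A - 1) n \<in> I" for n
    proof (cases "n = 0")
      case False
      then obtain u :: int where "of_int D * fps_nth A n = of_int (int p * u)" using D(2) by auto
      thus ?thesis using False mult_I[OF p_in_I of_int_R[of u]] by simp
    qed (simp add: A(3) zero_I)
    thus ?thesis by (simp add: IF_def)
  qed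
  have RF: "tq \<in> RF" "F oo tq \<in> RF" using assms(10,18) by (auto simp: RF_def Fq)
  have P0: "fps_nth (fps_of_poly P) n = 0" if "n > (p - 1) * p ^ i" for n
    using that P(1) unfolding M_eq(1)[symmetric] by (simp add: Polynomial.coeff_eq_0)
  \<comment> \<open>The defining relation of \<open>T\<close> replaces \<open>Zq\<close> by
    \<open>F oo tq\<close>, which puts the identity into the variable \<open>t\<close>.\<close>
  have PA: "A = (fps_of_poly P oo tq) * (F oo tq) ^ ((p - 1) * p ^ i)" using P(2) unfolding M_eq(1)[symmetric] Fq .
  have T: "T n \<in> R" "T n - T (n mod p) * T (n div p) \<in> I" for n
    using lucas_from_polynomial[OF assms(8,9) RF F0 P0 PA of_int_R x DA, of n] by (simp_all add: F_def)
  show ?thesis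
    unfolding lucas_congruences_def
  proof (intro allI impI)
    fix s and d :: "nat \<Rightarrow> nat" assume d: "\<forall>i\<le>s. d i \<le> p - 1"
    have "d i < p" if "i \<le> s" for i
      using d that prime_gt_0_nat[OF assms(22)] by (metis Suc_pred' less_Suc_eq_le)
    hence "T (\<Sum>i\<le>s. d i * p ^ i) - (\<Prod>i\<le>s. T (d i)) \<in> I"
      by (intro lucas_product T)
    moreover have "(\<Prod>i\<le>s. T (d i)) \<in> R" by (intro prod_R T)
    ultimately show "\<phi> (T (\<Sum>i\<le>s. d i * p ^ i)) \<ominus>\<^bsub>padic_ints p\<^esub> \<phi> (\<Prod>i\<le>s. T (d i))
        \<in> PIdl\<^bsub>padic_ints p\<^esub> (add_pow (padic_ints p) p \<one>\<^bsub>padic_ints p\<^esub>)"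
      using T(1) by (intro hom_diff_in_PIdl) (auto simp: I_def)
  qed
qed

end
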